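(* Let $-\infty<a<b<\infty$ and let $p,q,w:(a,b)\to\mathbb{R}$ be measurable with $p^{-1},q,w\in L^1(a,b)$, $p>0$ and $w\neq 0$ a.e. on $(a,b)$, such that both $\{x\in(a,b):w(x)>0\}$ and $\{x\in(a,b):w(x)<0\}$ have positive Lebesgue measure. Assume that $\int_a^b w\neq0$. Let $\mathcal{D}$ be a selfadjoint domain, let $c(\mathcal{D})$ be the associated constant, and set $$\alpha:=c(\mathcal{D})+\|q_-\|_1,\qquad \delta:=2+2\,\frac{\|w\|_1}{\bigl|\int_a^b w\bigr|},$$ where $q_-(x):=\min\{0,q(x)\}$. Assume that there exists a real-valued function $g\in \mathrm{AC}[a,b]$ with $g(a)=g(b)=0$ and $g'\in L^2_p(a,b)$ such that $gw>0$ a.e. on $(a,b)$. Let $\varepsilon>0$ be such that $$\mu_{\frac1p}\bigl(\{x\in[a,b]:p(x)g(x)w(x)<\varepsilon\}\bigr)\le\frac{1}{2\alpha\delta^2}.$$ Then every eigenvalue $\lambda\in\mathbb{C}\setminus\mathbb{R}$ of the operator $A(\mathcal{D})$ satisfies $$|\operatorname{Im}\lambda|\le\frac{2}{\varepsilon}\,\alpha^{3/2}\,\delta^2\,\|g'\|_{p,2}$$ and $$|\operatorname{Re}\lambda|\le\frac{2}{\varepsilon}\,\alpha\,\delta^2\bigl(\sqrt{\alpha}\,\|g'\|_{p,2}+(\alpha+\|q\|_1)\|g\|_\infty\bigr).$$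
   Context: Function spaces: $\mathrm{AC}[a,b]$ is the set of absolutely continuous functions on $[a,b]$. For a measurable $r:(a,b)\to[0,\infty)$, $\mu_r$ is the measure on $(a,b)$ with $d\mu_r=r\,dt$, $L^2_r(a,b):=L^2((a,b),\mu_r)$, and $\|\cdot\|_{r,2}$ is its norm, i.e. $\|f\|_{r,2}^2=\int_a^b|f|^2r$. $\|\cdot\|_1$ and $\|\cdot\|_\infty$ are the usual $L^1$- and $L^\infty$-norms on $(a,b)$. Differential expression: $\tau(f)=\frac1w\bigl(-(pf')'+qf\bigr)$. The maximal domain $\mathcal{D}_{\max}$ is the set of all $f:(a,b)\to\mathbb{C}$ in $L^2_{|w|}(a,b)$ such that $f$ and $pf'$ are absolutely continuous on $[a,b]$ and $\tau(f)\in L^2_{|w|}(a,b)$. A selfadjoint domain is a set $\mathcal{D}$ of one of the following two forms: (separated) $\mathcal{D}_{\rm sep}(l,r)=\{f\in\mathcal{D}_{\max}:(pf')(a)=lf(a),\ (pf')(b)=rf(b)\}$ with $l,r\in\mathbb{R}\cup\{\infty\}$, where $l=\infty$ (resp. $r=\infty$) means the Dirichlet condition $f(a)=0$ (resp. $f(b)=0$); (coupled) $\mathcal{D}_{\rm coup}(\varphi,R)=\left\{f\in\mathcal{D}_{\max}:\begin{pmatrix}f(b)\\(pf')(b)\end{pmatrix}=e^{i\varphi}R\begin{pmatrix}f(a)\\(pf')(a)\end{pmatrix}\right\}$ with $\varphi\in[0,2\pi)$ and $R=(r_{ij})_{i,j=1}^2\in\mathbb{R}^{2\times2}$, $\det R=1$.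 The constant $c(\mathcal{D})\ge0$ is defined by: $c(\mathcal{D})=|l|+|r|$ if $\mathcal{D}=\mathcal{D}_{\rm sep}(l,r)$ with $l,r\in\mathbb{R}$; $c(\mathcal{D})=|r|$ if $\mathcal{D}=\mathcal{D}_{\rm sep}(\infty,r)$ with $r\in\mathbb{R}$; $c(\mathcal{D})=|l|$ if $\mathcal{D}=\mathcal{D}_{\rm sep}(l,\infty)$ with $l\in\mathbb{R}$; $c(\mathcal{D})=0$ if $\mathcal{D}=\mathcal{D}_{\rm sep}(\infty,\infty)$; $c(\mathcal{D})=\frac{|r_{11}|+|r_{22}|+2}{|r_{12}|}$ if $\mathcal{D}=\mathcal{D}_{\rm coup}(\varphi,R)$ and $r_{12}\ne0$; $c(\mathcal{D})=|r_{11}r_{21}|$ if $\mathcal{D}=\mathcal{D}_{\rm coup}(\varphi,R)$ and $r_{12}=0$. The operator $A(\mathcal{D})$ in $L^2_{|w|}(a,b)$ is $A(\mathcal{D})f=\tau(f)$ with $\operatorname{dom}A(\mathcal{D})=\mathcal{D}$. Thus $\lambda$ is an eigenvalue of $A(\mathcal{D})$ iff there is $\phi\in\mathcal{D}$, $\phi\neq0$, with $-(p\phi')'+q\phi=\lambda w\phi$ a.e. on $(a,b)$. *)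

theory Defs
  imports "HOL-Probability.Essential_Supremum" "HOL-Analysis.Analysis"
begin

text \<open>
  Functions on \<open>(a,b)\<close> or \<open>[a,b]\<close> are total functions on \<^typ>\<open>real\<close>
  whose values outside the interval are irrelevant; measurability and integrability refer to
  \<open>lebesgue_on {a<..<b}\<close>.
\<close>

definition AC :: "real \<Rightarrow> real \<Rightarrow> (real \<Rightarrow> 'a::real_normed_vector) set" where
  "AC a b = {f. \<forall>\<epsilon>>0. \<exists>\<delta>>0. \<forall>I :: (real \<times> real) set.
     finite I \<and> (\<forall>(s, t)\<in>I. a \<le> s \<and> s < t \<and> t \<le> b) \<and>
     disjoint_family_on (\<lambda>(s, t). {s<..<t}) I \<and> (\<Sum>(s, t)\<in>I. t - s) < \<delta>
     \<longrightarrow> (\<Sum>(s, t)\<in>I. norm (f t - f s)) < \<epsilon>}"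

text \<open>
  The measure \<open>r dt\<close> on \<open>(a,b)\<close>. The weights used below (\<open>p\<close>, \<open>1/p\<close>, \<open>\<bar>w\<bar>\<close>) are
  nonnegative almost everywhere, so the truncation of negative values by \<^const>\<open>ennreal\<close>
  only affects a null set.
\<close>

definition weighted_measure :: "real \<Rightarrow> real \<Rightarrow> (real \<Rightarrow> real) \<Rightarrow> real measure" where
  "weighted_measure a b r = density (lebesgue_on {a<..<b}) (\<lambda>x. ennreal (r x))"

definition L2_space ::
    "real \<Rightarrow> real \<Rightarrow> (real \<Rightarrow> real) \<Rightarrow> (real \<Rightarrow> 'a::{banach, second_countable_topology}) set" where
  "L2_space a b r = {f. f \<in> borel_measurable (weighted_measure a b r) \<and>
     integrable (weighted_measure a b r) (\<lambda>x. (norm (f x))\<^sup>2)}"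

definition L2_norm ::
    "real \<Rightarrow> real \<Rightarrow> (real \<Rightarrow> real) \<Rightarrow> (real \<Rightarrow> 'a::{banach, second_countable_topology}) \<Rightarrow> real" where
  "L2_norm a b r f = sqrt (LINT x|weighted_measure a b r. (norm (f x))\<^sup>2)"

definition L1_norm :: "real \<Rightarrow> real \<Rightarrow> (real \<Rightarrow> real) \<Rightarrow> real" where
  "L1_norm a b f = (LINT x|lebesgue_on {a<..<b}. \<bar>f x\<bar>)"

definition Linf_norm :: "real \<Rightarrow> real \<Rightarrow> (real \<Rightarrow> real) \<Rightarrow> real" where
  "Linf_norm a b f = real_of_ereal (esssup (lebesgue_on {a<..<b}) (\<lambda>x. ereal \<bar>f x\<bar>))"

text \<open>
  For \<open>f \<in> AC a b\<close> the derivative exists almost everywhere, so \<open>p f'\<close> is only determined up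
  to a null set; "\<open>p f'\<close> is absolutely continuous on \<open>[a,b]\<close>" means that it has an absolutely
  continuous representative. That representative is unique on \<open>[a,b]\<close>, by continuity, and
  provides the boundary values \<open>(p f')(a)\<close> and \<open>(p f')(b)\<close>.
\<close>

definition is_quasi_derivative ::
    "real \<Rightarrow> real \<Rightarrow> (real \<Rightarrow> real) \<Rightarrow> (real \<Rightarrow> complex) \<Rightarrow> (real \<Rightarrow> complex) \<Rightarrow> bool" where
  "is_quasi_derivative a b p f h \<longleftrightarrow> h \<in> AC a b \<and>
     (AE x in lebesgue_on {a<..<b}. h x = of_real (p x) * vector_derivative f (at x))"

definition quasi_derivative ::
    "real \<Rightarrow> real \<Rightarrow> (real \<Rightarrow> real) \<Rightarrow> (real \<Rightarrow> complex) \<Rightarrow> real \<Rightarrow> complex" where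
  "quasi_derivative a b p f = (SOME h. is_quasi_derivative a b p f h)"

definition SL_expr ::
    "real \<Rightarrow> real \<Rightarrow> (real \<Rightarrow> real) \<Rightarrow> (real \<Rightarrow> real) \<Rightarrow> (real \<Rightarrow> real)
      \<Rightarrow> (real \<Rightarrow> complex) \<Rightarrow> real \<Rightarrow> complex" where
  "SL_expr a b p q w f x =
     (1 / of_real (w x)) *
     (- vector_derivative (quasi_derivative a b p f) (at x) + of_real (q x) * f x)"

definition maximal_domain ::
    "real \<Rightarrow> real \<Rightarrow> (real \<Rightarrow> real) \<Rightarrow> (real \<Rightarrow> real) \<Rightarrow> (real \<Rightarrow> real) \<Rightarrow> (real \<Rightarrow> complex) set" where
  "maximal_domain a b p q w = {f. f \<in> L2_space a b (\<lambda>x. \<bar>w x\<bar>) \<and> f \<in> AC a b \<and>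
     (\<exists>h. is_quasi_derivative a b p f h) \<and>
     SL_expr a b p q w f \<in> L2_space a b (\<lambda>x. \<bar>w x\<bar>)}"

text \<open>
  \<open>Infinite\<close> is the parameter value \<open>\<infinity>\<close>, i.e. the Dirichlet condition. Selfadjoint domains
  are represented by their boundary conditions. Two admissible parameter pairs of a coupled
  condition may describe the same domain, namely \<open>(\<phi>, R)\<close> and \<open>(\<phi> \<plusminus> \<pi>, -R)\<close>, for which
  \<open>bc_constant\<close> below has the same value.
\<close>

datatype endpoint_param = Finite real | Infinite

datatype boundary_condition =
    Separated endpoint_param endpoint_param
  | Coupled real "real ^ 2 ^ 2"

fun admissible :: "boundary_condition \<Rightarrow> bool" where
  "admissible (Separated l r) \<longleftrightarrow> True"
| "admissible (Coupled \<phi> R) \<longleftrightarrow> 0 \<le> \<phi> \<and> \<phi> < 2 * pi \<and> det R = 1"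

fun endpoint_condition :: "endpoint_param \<Rightarrow> complex \<Rightarrow> complex \<Rightarrow> bool" where
  "endpoint_condition (Finite l) u v \<longleftrightarrow> v = of_real l * u"
| "endpoint_condition Infinite u v \<longleftrightarrow> u = 0"

fun satisfies_bc ::
    "real \<Rightarrow> real \<Rightarrow> boundary_condition \<Rightarrow> (real \<Rightarrow> complex) \<Rightarrow> (real \<Rightarrow> complex) \<Rightarrow> bool" where
  "satisfies_bc a b (Separated l r) f h \<longleftrightarrow>
     endpoint_condition l (f a) (h a) \<and> endpoint_condition r (f b) (h b)"
| "satisfies_bc a b (Coupled \<phi> R) f h \<longleftrightarrow>
     (vector [f b, h b] :: complex ^ 2) =
       cis \<phi> *s ((\<chi> i j. of_real (R $ i $ j)) *v vector [f a, h a])"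

definition selfadjoint_domain ::
    "real \<Rightarrow> real \<Rightarrow> (real \<Rightarrow> real) \<Rightarrow> (real \<Rightarrow> real) \<Rightarrow> (real \<Rightarrow> real)
      \<Rightarrow> boundary_condition \<Rightarrow> (real \<Rightarrow> complex) set" where
  "selfadjoint_domain a b p q w B =
     {f \<in> maximal_domain a b p q w. satisfies_bc a b B f (quasi_derivative a b p f)}"

fun bc_constant :: "boundary_condition \<Rightarrow> real" where
  "bc_constant (Separated (Finite l) (Finite r)) = \<bar>l\<bar> + \<bar>r\<bar>"
| "bc_constant (Separated Infinite (Finite r)) = \<bar>r\<bar>"
| "bc_constant (Separated (Finite l) Infinite) = \<bar>l\<bar>"
| "bc_constant (Separated Infinite Infinite) = 0"
| "bc_constant (Coupled \<phi> R) =
     (if R $ 1 $ 2 \<noteq> 0 then (\<bar>R $ 1 $ 1\<bar> + \<bar>R $ 2 $ 2\<bar> + 2) / \<bar>R $ 1 $ 2\<bar>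
      else \<bar>R $ 1 $ 1 * R $ 2 $ 1\<bar>)"

text \<open>
  Eigenvalues of the operator \<open>f \<mapsto> SL_expr a b p q w f\<close> in \<open>L2_space a b \<bar>w\<bar>\<close> with domain
  \<open>D\<close>. Elements of that space are functions modulo equality almost everywhere with respect to
  \<open>\<bar>w\<bar> dt\<close>, hence the almost-everywhere formulation.
\<close>

definition is_eigenvalue ::
    "real \<Rightarrow> real \<Rightarrow> (real \<Rightarrow> real) \<Rightarrow> (real \<Rightarrow> real) \<Rightarrow> (real \<Rightarrow> real)
      \<Rightarrow> (real \<Rightarrow> complex) set \<Rightarrow> complex \<Rightarrow> bool" where
  "is_eigenvalue a b p q w D z \<longleftrightarrow> (\<exists>f\<in>D.
     \<not> (AE x in weighted_measure a b (\<lambda>x. \<bar>w x\<bar>). f x = 0) \<and>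
     (AE x in weighted_measure a b (\<lambda>x. \<bar>w x\<bar>). SL_expr a b p q w f x = z * f x))"

end

theory Submission
  imports Defs
begin

text \<open>
  Let \<open>f\<close> be an eigenfunction for a nonreal \<open>\<lambda>\<close>, \<open>h = p f'\<close> and \<open>K = max \<bar>f\<bar>\<close>. Integrating
  \<open>(h \<cdot> cnj f)'\<close> produces a boundary term that is real and at most \<open>c K\<^sup>2\<close> in absolute value;
  hence \<open>\<integral> w \<bar>f\<bar>\<^sup>2 = 0\<close> and \<open>\<integral> p \<bar>f'\<bar>\<^sup>2 \<le> \<alpha> K\<^sup>2\<close>. The first identity together with a bound on the oscillation
  of \<open>\<bar>f\<bar>\<^sup>2\<close> yields \<open>K\<^sup>2 \<le> \<delta>\<^sup>2 \<alpha> \<integral> \<bar>f\<bar>\<^sup>2 / p\<close>, so that \<open>\<integral> g w \<bar>f\<bar>\<^sup>2\<close> is at least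
  \<open>\<epsilon> K\<^sup>2 / (2 \<alpha> \<delta>\<^sup>2)\<close>. Integrating \<open>(h \<cdot> g cnj f)'\<close>, which has no boundary terms, expresses
  \<open>\<lambda> \<integral> g w \<bar>f\<bar>\<^sup>2\<close> by quantities that are controlled by \<open>\<alpha>\<close>, \<open>g\<close>, \<open>q\<close> and \<open>K\<close>.

  All this rests on the fundamental theorem of calculus for absolutely continuous functions. Their
  differentiability almost everywhere is a double application of Vitali's covering theorem;
  the derivative is then Henstock-Kurzweil integrable, because near the exceptional null set absolute continuity
  makes the increments of \<open>f\<close> negligible, and bounded variation turns this into Lebesgue integrability.
\<close>

section \<open>Absolutely continuous functions\<close>

text \<open>For a sign-changing weight, \<open>\<integral> w \<bar>f\<bar>\<^sup>2\<close> vanishes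
  at a nonreal eigenvalue, so the quadratic form of \<open>f\<close> alone says nothing about the
  size of \<lambda>. The function \<open>g\<close> repairs this: \<open>g w\<close> is positive, so
  \<lambda> becomes a quotient with positive denominator. That denominator could still be small
  where \<open>p g w\<close> is small; this is what \<epsilon> and the smallness condition control.

  Numerator and denominator are both compared with \<open>K\<^sup>2\<close>, so the normalisation of
  \<open>f\<close> cancels. Hence the boundary form has to be bounded by boundary values of
  \<open>f\<close> only, never of \<open>h\<close>, and the shape of \<open>bc_constant\<close>
  comes from eliminating \<open>h\<close>. The quotient in \<delta> arises from \<open>K\<^sup>2
  \<integral> w = \<integral> w (K\<^sup>2 - \<bar>f\<bar>\<^sup>2)\<close>, where the last factor
  is an oscillation of \<open>\<bar>f\<bar>\<^sup>2\<close>. Half of the resulting lower bound for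
  \<open>\<integral> \<bar>f\<bar>\<^sup>2 / p\<close> may be lost on the set where
  \<open>p g w < \<epsilon>\<close>; this is the factor 2 in
  \<open>1 / (2 \<alpha> \<delta>\<^sup>2)\<close>.\<close>

text \<open>The definition speaks of sets of nondegenerate intervals. Later families are indexed by
  cells or tagged cells, and clamping end points can collapse intervals. Collapsed intervals
  contribute zero to both sums; the others are pairwise distinct because they are disjoint and
  nonempty.\<close>

lemma AC_family:
  assumes f: "f \<in> AC a b" and e: "e > 0"
  shows "\<exists>d>0. \<forall>(J::'i set) s t. finite J \<longrightarrow> (\<forall>j\<in>J. a \<le> s j \<and> s j \<le> t j \<and> t j \<le> b) \<longrightarrow>
     disjoint_family_on (\<lambda>j. {s j<..<t j}) J \<longrightarrow> (\<Sum>j\<in>J. t j - s j) < d \<longrightarrow>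
     (\<Sum>j\<in>J. norm (f (t j) - f (s j))) < e"
proof -
  obtain d where d: "d > 0" and *: "\<forall>I :: (real \<times> real) set. finite I \<and> (\<forall>(s, t)\<in>I. a \<le> s \<and> s < t \<and> t \<le> b) \<and>
     disjoint_family_on (\<lambda>(s, t). {s<..<t}) I \<and> (\<Sum>(s, t)\<in>I. t - s) < d
     \<longrightarrow> (\<Sum>(s, t)\<in>I. norm (f t - f s)) < e"
    using f[unfolded AC_def mem_Collect_eq, THEN spec, THEN mp, OF e] by (elim exE conjE)
  show ?thesis
  proof (intro exI conjI allI impI)
    fix J :: "'i set" and s t
    assume fin: "finite J" and st: "\<forall>j\<in>J. a \<le> s j \<and> s j \<le> t j \<and> t j \<le> b"
      and disj: "disjoint_family_on (\<lambda>j. {s j<..<t j}) J" and len: "(\<Sum>j\<in>J. t j - s j) < d"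
    define J' where "J' = {j\<in>J. s j < t j}"
    define I where "I = (\<lambda>j. (s j, t j)) ` J'"
    have inj: "inj_on (\<lambda>j. (s j, t j)) J'"
    proof (rule inj_onI)
      fix i j assume ij: "i \<in> J'" "j \<in> J'" "(s i, t i) = (s j, t j)"
      show "i = j"
      proof (rule ccontr)
        assume "i \<noteq> j"
        then have "{s i<..<t i} \<inter> {s j<..<t j} = {}"
          using ij by (intro disjoint_family_onD[OF disj]) (simp_all add: J'_def)
        then show False using ij by (simp add: J'_def)
      qed
    qed
    have sumI: "(\<Sum>(s, t)\<in>I. F s t) = (\<Sum>j\<in>J. F (s j) (t j))" if "\<And>x. F x x = (0::real)" for F
    proof -
      have "(\<Sum>(s, t)\<in>I. F s t) = (\<Sum>j\<in>J'. F (s j) (t j))"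
        unfolding I_def by (subst sum.reindex[OF inj]) simp
      also have "\<dots> = (\<Sum>j\<in>J. F (s j) (t j))"
        using fin st that unfolding J'_def by (intro sum.mono_neutral_left) (auto, metis order_le_less)
      finally show ?thesis .
    qed
    have "disjoint_family_on (\<lambda>(s, t). {s<..<t}) I"
      unfolding disjoint_family_on_def
    proof (intro ballI impI)
      fix x y assume "x \<in> I" "y \<in> I" "x \<noteq> y"
      then obtain i j where "i \<in> J" "j \<in> J" "i \<noteq> j" "x = (s i, t i)" "y = (s j, t j)"
        by (auto simp: I_def J'_def)
      then show "(case x of (s, t) \<Rightarrow> {s<..<t}) \<inter> (case y of (s, t) \<Rightarrow> {s<..<t}) = {}"
        using disjoint_family_onD[OF disj] by simp
    qed
    moreover have "finite I" "\<forall>(s, t)\<in>I. a \<le> s \<and> s < t \<and> t \<le> b"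
      using fin st by (auto simp: I_def J'_def)
    ultimately have "(\<Sum>(s, t)\<in>I. norm (f t - f s)) < e"
      using len by (intro *[THEN spec, THEN mp] conjI) (simp_all add: sumI)
    then show "(\<Sum>j\<in>J. norm (f (t j) - f (s j))) < e"
      by (subst (asm) sumI) auto
  qed (rule d)
qed

text \<open>The hypothesis has the shape that \<open>AC_family\<close> delivers for
  \<open>fst\<close> and \<open>snd\<close>, so closure properties pass directly from one to the
  other.\<close>

lemma AC_I:
  assumes "\<And>e. e > 0 \<Longrightarrow> \<exists>d>0. \<forall>I :: (real \<times> real) set. finite I \<longrightarrow> (\<forall>(s, t)\<in>I. a \<le> s \<and> s \<le> t \<and> t \<le> b) \<longrightarrow>
     disjoint_family_on (\<lambda>i. {fst i<..<snd i}) I \<longrightarrow> (\<Sum>i\<in>I. snd i - fst i) < d \<longrightarrow>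
     (\<Sum>i\<in>I. norm (f (snd i) - f (fst i))) < e"
  shows "f \<in> AC a b"
  unfolding AC_def mem_Collect_eq
proof (intro allI impI)
  fix e :: real assume "e > 0"
  from assms[OF this] obtain d where d: "d > 0" "\<forall>I :: (real \<times> real) set. finite I \<longrightarrow> (\<forall>(s, t)\<in>I. a \<le> s \<and> s \<le> t \<and> t \<le> b) \<longrightarrow>
     disjoint_family_on (\<lambda>i. {fst i<..<snd i}) I \<longrightarrow> (\<Sum>i\<in>I. snd i - fst i) < d \<longrightarrow>
     (\<Sum>i\<in>I. norm (f (snd i) - f (fst i))) < e" by (elim exE conjE)
  show "\<exists>\<delta>>0. \<forall>I :: (real \<times> real) set.
     finite I \<and> (\<forall>(s, t)\<in>I. a \<le> s \<and> s < t \<and> t \<le> b) \<and>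
     disjoint_family_on (\<lambda>(s, t). {s<..<t}) I \<and> (\<Sum>(s, t)\<in>I. t - s) < \<delta>
     \<longrightarrow> (\<Sum>(s, t)\<in>I. norm (f t - f s)) < e"
  proof (intro exI conjI allI impI; (elim conjE)?)
    fix I :: "(real \<times> real) set"
    assume I: "finite I" "\<forall>(s, t)\<in>I. a \<le> s \<and> s < t \<and> t \<le> b"
     "disjoint_family_on (\<lambda>(s, t). {s<..<t}) I" "(\<Sum>(s, t)\<in>I. t - s) < d"
    have "\<forall>(s, t)\<in>I. a \<le> s \<and> s \<le> t \<and> t \<le> b" using I(2) by auto
    then show "(\<Sum>(s, t)\<in>I. norm (f t - f s)) < e"
      using d(2)[THEN spec, of I] I(1,3,4) by (simp add: case_prod_unfold)
  qed (rule d(1))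
qed

lemma AC_subinterval:
  assumes "f \<in> AC a b" "a \<le> c" "d \<le> b"
  shows "f \<in> AC c d"
proof (rule AC_I)
  fix e :: real assume "e > 0"
  from AC_family[OF assms(1) this, where ?'i = "real \<times> real"]
  obtain \<delta> where \<delta>: "\<delta> > 0" "\<forall>(I :: (real \<times> real) set) s t. finite I \<longrightarrow> (\<forall>j\<in>I. a \<le> s j \<and> s j \<le> t j \<and> t j \<le> b) \<longrightarrow>
     disjoint_family_on (\<lambda>j. {s j<..<t j}) I \<longrightarrow> (\<Sum>j\<in>I. t j - s j) < \<delta> \<longrightarrow>
     (\<Sum>j\<in>I. norm (f (t j) - f (s j))) < e" by (elim exE conjE)
  show "\<exists>\<delta>>0. \<forall>I :: (real \<times> real) set. finite I \<longrightarrow> (\<forall>(s, t)\<in>I. c \<le> s \<and> s \<le> t \<and> t \<le> d) \<longrightarrow>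
     disjoint_family_on (\<lambda>i. {fst i<..<snd i}) I \<longrightarrow> (\<Sum>i\<in>I. snd i - fst i) < \<delta> \<longrightarrow>
     (\<Sum>i\<in>I. norm (f (snd i) - f (fst i))) < e"
  proof (intro exI conjI allI impI)
    fix I :: "(real \<times> real) set"
    assume I: "finite I" "\<forall>(s, t)\<in>I. c \<le> s \<and> s \<le> t \<and> t \<le> d"
     "disjoint_family_on (\<lambda>i. {fst i<..<snd i}) I" "(\<Sum>i\<in>I. snd i - fst i) < \<delta>"
    have "\<forall>j\<in>I. a \<le> fst j \<and> fst j \<le> snd j \<and> snd j \<le> b" using I(2) assms(2,3) by auto
    then show "(\<Sum>i\<in>I. norm (f (snd i) - f (fst i))) < e"
      using \<delta>(2)[THEN spec, THEN spec, THEN spec, of I fst snd] I(1,3,4) by simp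
  qed (rule \<delta>(1))
qed

text \<open>Common core of the closure under bounded linear maps and under products: domination of
  increments is all that either needs.\<close>

lemma AC_norm_diff_le:
  assumes f: "f \<in> AC a b" and h: "h \<in> AC a b" and C: "C \<ge> 0"
    and le: "\<And>s t. a \<le> s \<Longrightarrow> s \<le> t \<Longrightarrow> t \<le> b \<Longrightarrow> norm (k t - k s) \<le> C * (norm (f t - f s) + norm (h t - h s))"
  shows "k \<in> AC a b"
proof (rule AC_I)
  fix e :: real assume "e > 0"
  \<comment> \<open>With \<open>C + 1\<close> in place of \<open>C\<close> the case
    \<open>C = 0\<close> needs no separate treatment, and the total \<open>e * C / (C + 1)\<close>
    stays strictly below \<open>e\<close>.\<close>
  then have e': "e / (2 * (C + 1)) > 0" using C by auto
  obtain d1 where d1: "d1 > 0" "\<forall>I :: (real \<times> real) set. \<forall> s t. finite I \<longrightarrow> (\<forall>j\<in>I. a \<le> s j \<and> s j \<le> t j \<and> t j \<le> b) \<longrightarrow>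
     disjoint_family_on (\<lambda>j. {s j<..<t j}) I \<longrightarrow> (\<Sum>j\<in>I. t j - s j) < d1 \<longrightarrow>
     (\<Sum>j\<in>I. norm (f (t j) - f (s j))) < e / (2 * (C + 1))"
    using AC_family[OF f e', where ?'i = "real \<times> real"] by (elim exE conjE)
  obtain d2 where d2: "d2 > 0" "\<forall>I :: (real \<times> real) set. \<forall> s t. finite I \<longrightarrow> (\<forall>j\<in>I. a \<le> s j \<and> s j \<le> t j \<and> t j \<le> b) \<longrightarrow>
     disjoint_family_on (\<lambda>j. {s j<..<t j}) I \<longrightarrow> (\<Sum>j\<in>I. t j - s j) < d2 \<longrightarrow>
     (\<Sum>j\<in>I. norm (h (t j) - h (s j))) < e / (2 * (C + 1))"
    using AC_family[OF h e', where ?'i = "real \<times> real"] by (elim exE conjE)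
  show "\<exists>d>0. \<forall>I :: (real \<times> real) set. finite I \<longrightarrow> (\<forall>(s, t)\<in>I. a \<le> s \<and> s \<le> t \<and> t \<le> b) \<longrightarrow>
     disjoint_family_on (\<lambda>i. {fst i<..<snd i}) I \<longrightarrow> (\<Sum>i\<in>I. snd i - fst i) < d \<longrightarrow>
     (\<Sum>i\<in>I. norm (k (snd i) - k (fst i))) < e"
  proof (intro exI[of _ "min d1 d2"] conjI allI impI)
    fix I :: "(real \<times> real) set"
    assume I: "finite I" "\<forall>(s, t)\<in>I. a \<le> s \<and> s \<le> t \<and> t \<le> b"
      "disjoint_family_on (\<lambda>i. {fst i<..<snd i}) I" "(\<Sum>i\<in>I. snd i - fst i) < min d1 d2"
    have 1: "(\<Sum>i\<in>I. norm (f (snd i) - f (fst i))) < e / (2 * (C + 1))"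
      using d1(2)[THEN spec, THEN spec, THEN spec, of I fst snd] I by (simp add: case_prod_unfold)
    have 2: "(\<Sum>i\<in>I. norm (h (snd i) - h (fst i))) < e / (2 * (C + 1))"
      using d2(2)[THEN spec, THEN spec, THEN spec, of I fst snd] I by (simp add: case_prod_unfold)
    have "(\<Sum>i\<in>I. norm (k (snd i) - k (fst i))) \<le>
        (\<Sum>i\<in>I. C * (norm (f (snd i) - f (fst i)) + norm (h (snd i) - h (fst i))))"
      using I(2) by (intro sum_mono le) auto
    also have "\<dots> = C * ((\<Sum>i\<in>I. norm (f (snd i) - f (fst i))) + (\<Sum>i\<in>I. norm (h (snd i) - h (fst i))))"
      by (simp only: sum_distrib_left[symmetric] sum.distrib)
    also have "\<dots> \<le> C * (e / (2 * (C + 1)) + e / (2 * (C + 1)))"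
      using 1 2 C by (intro mult_left_mono add_mono) auto
    also have "e / (2 * (C + 1)) + e / (2 * (C + 1)) = e / (C + 1)"
      using mult_divide_mult_cancel_left[of 2 e "C + 1"] by (simp only: add_divide_distrib[symmetric] mult_2[symmetric]) simp
    also have "C * (e / (C + 1)) = e * C / (C + 1)"
      by simp
    also have "\<dots> < e"
      using C \<open>e > 0\<close> by (simp add: field_simps)
    finally show "(\<Sum>i\<in>I. norm (k (snd i) - k (fst i))) < e" .
  qed (use d1 d2 in auto)
qed

lemma AC_bounded_linear:
  assumes f: "f \<in> AC a b" and L: "bounded_linear L"
  shows "(\<lambda>x. L (f x)) \<in> AC a b"
proof -
  obtain K where K: "K > 0" "\<And>x. norm (L x) \<le> norm x * K"
    using bounded_linear.pos_bounded[OF L] by blast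
  interpret bounded_linear L by fact
  show ?thesis
  proof (rule AC_norm_diff_le[OF f f, of K])
    fix s t
    have "norm (L (f t) - L (f s)) \<le> K * norm (f t - f s)"
      using K(2)[of "f t - f s"] by (simp add: diff mult.commute)
    also have "\<dots> \<le> K * (norm (f t - f s) + norm (f t - f s))"
      using K by (intro mult_left_mono) auto
    finally show "norm (L (f t) - L (f s)) \<le> K * (norm (f t - f s) + norm (f t - f s))" .
  qed (use K in auto)
qed

lemma AC_continuous_on:
  assumes f: "f \<in> AC a b"
  shows "continuous_on {a..b} f"
  unfolding continuous_on_iff
proof (intro ballI allI impI)
  fix x e :: real assume x: "x \<in> {a..b}" and e: "e > 0"
  \<comment> \<open>Continuity uses families of a single interval, hence the index type
    \<open>unit\<close>.\<close>
  obtain d where d: "d > 0" "\<forall>I :: unit set. \<forall> s t. finite I \<longrightarrow> (\<forall>j\<in>I. a \<le> s j \<and> s j \<le> t j \<and> t j \<le> b) \<longrightarrow>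
     disjoint_family_on (\<lambda>j. {s j<..<t j}) I \<longrightarrow> (\<Sum>j\<in>I. t j - s j) < d \<longrightarrow>
     (\<Sum>j\<in>I. norm (f (t j) - f (s j))) < e"
    using AC_family[OF f e, where ?'i = unit] by (elim exE conjE)
  have *: "norm (f t - f s) < e" if "a \<le> s" "s \<le> t" "t \<le> b" "t - s < d" for s t
    using d(2)[THEN spec, THEN spec, THEN spec, of "{()}" "\<lambda>_. s" "\<lambda>_. t"] that
    by (simp add: disjoint_family_on_def)
  have "dist (f y) (f x) < e" if y: "y \<in> {a..b}" "dist y x < d" for y
  proof (cases "x \<le> y")
    case True
    then show ?thesis using *[of x y] x y by (simp add: dist_norm)
  next
    case False
    then show ?thesis using *[of y x] x y by (simp add: dist_norm norm_minus_commute)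
  qed
  with d(1) show "\<exists>d>0. \<forall>x'\<in>{a..b}. dist x' x < d \<longrightarrow> dist (f x') (f x) < e" by blast
qed

lemma AC_bounded:
  assumes "f \<in> AC a b"
  obtains K where "K \<ge> 0" "\<And>x. x \<in> {a..b} \<Longrightarrow> norm (f x) \<le> K"
proof -
  have "bounded (f ` {a..b})"
    by (intro compact_imp_bounded compact_continuous_image AC_continuous_on assms) auto
  then obtain K where "\<And>x. x \<in> {a..b} \<Longrightarrow> norm (f x) \<le> K"
    unfolding bounded_iff by blast
  then show ?thesis by (intro that[of "max K 0"]) (auto simp: le_max_iff_disj)
qed

lemma AC_mult:
  fixes f h :: "real \<Rightarrow> 'a::real_normed_algebra"
  assumes f: "f \<in> AC a b" and h: "h \<in> AC a b"
  shows "(\<lambda>x. f x * h x) \<in> AC a b"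
proof -
  obtain K where K: "K \<ge> 0" "\<And>x. x \<in> {a..b} \<Longrightarrow> norm (f x) \<le> K" using AC_bounded[OF f] by blast
  obtain L where L: "L \<ge> 0" "\<And>x. x \<in> {a..b} \<Longrightarrow> norm (h x) \<le> L" using AC_bounded[OF h] by blast
  show ?thesis
  proof (rule AC_norm_diff_le[OF f h, of "K + L"])
    fix s t assume st: "a \<le> s" "s \<le> t" "t \<le> b"
    have "f t * h t - f s * h s = (f t - f s) * h t + f s * (h t - h s)"
      by (simp add: algebra_simps)
    also have "norm \<dots> \<le> norm (f t - f s) * norm (h t) + norm (f s) * norm (h t - h s)"
      by (intro order_trans[OF norm_triangle_ineq] add_mono norm_mult_ineq)
    also have "\<dots> \<le> norm (f t - f s) * (K + L) + (K + L) * norm (h t - h s)"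
      using K(2)[of s] L(2)[of t] st K(1) L(1) by (intro add_mono mult_left_mono mult_right_mono) auto
    finally show "norm (f t * h t - f s * h s) \<le> (K + L) * (norm (f t - f s) + norm (h t - h s))"
      by (simp add: algebra_simps)
  qed (use K L in auto)
qed

section \<open>Increments over divisions of an interval\<close>

text \<open>Cells on the line are recovered from \<open>Inf\<close> and \<open>Sup\<close>, so sums
  over a division need no separate choice of end points and the cells can serve as their own
  indices.\<close>

lemma division_real_interval:
  fixes D :: "real set set"
  assumes D: "D division_of S" and k: "k \<in> D"
  shows "Inf k \<le> Sup k" "k = {Inf k..Sup k}" "Inf k \<in> S" "Sup k \<in> S"
proof -
  obtain u v where "k = cbox u v" "k \<noteq> {}" "k \<subseteq> S"
    using division_ofD(2,3,4)[OF D] k by metis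
  then show "Inf k \<le> Sup k" "k = {Inf k..Sup k}" "Inf k \<in> S" "Sup k \<in> S" by auto
qed

lemma disjoint_family_on_division:
  fixes D :: "real set set"
  assumes D: "D division_of S"
  shows "disjoint_family_on (\<lambda>k. {Inf k<..<Sup k}) D"
  unfolding disjoint_family_on_def
proof (intro ballI impI)
  fix k l assume kl: "k \<in> D" "l \<in> D" "k \<noteq> l"
  then have "interior k \<inter> interior l = {}" using division_ofD(5)[OF D] by blast
  moreover have "interior k = {Inf k<..<Sup k}" "interior l = {Inf l<..<Sup l}"
    using division_real_interval(2)[OF D kl(1)] division_real_interval(2)[OF D kl(2)]
    by (metis interior_atLeastAtMost_real)+
  ultimately show "{Inf k<..<Sup k} \<inter> {Inf l<..<Sup l} = {}" by simp
qed

lemma AC_division: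
  assumes f: "f \<in> AC a b" and e: "e > 0"
  obtains d where "d > 0" "\<And>D S. D division_of S \<Longrightarrow> S \<subseteq> {a..b} \<Longrightarrow> (\<Sum>k\<in>D. Sup k - Inf k) < d \<Longrightarrow>
    (\<Sum>k\<in>D. norm (f (Sup k) - f (Inf k))) < e"
proof -
  obtain d where d: "d > 0" "\<forall>I :: real set set. \<forall> s t. finite I \<longrightarrow> (\<forall>j\<in>I. a \<le> s j \<and> s j \<le> t j \<and> t j \<le> b) \<longrightarrow>
     disjoint_family_on (\<lambda>j. {s j<..<t j}) I \<longrightarrow> (\<Sum>j\<in>I. t j - s j) < d \<longrightarrow>
     (\<Sum>j\<in>I. norm (f (t j) - f (s j))) < e"
    using AC_family[OF f e, where ?'i = "real set"] by (elim exE conjE)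
  show ?thesis
  proof (rule that[OF d(1)])
    fix D S assume D: "D division_of S" and S: "S \<subseteq> {a..b}" and len: "(\<Sum>k\<in>D. Sup k - Inf k) < d"
    have "Inf k \<in> {a..b}" "Sup k \<in> {a..b}" if "k \<in> D" for k
      using division_real_interval(3,4)[OF D that] S by blast+
    then show "(\<Sum>k\<in>D. norm (f (Sup k) - f (Inf k))) < e"
      using division_real_interval(1)[OF D] len
      by (intro d(2)[THEN spec, THEN spec, THEN spec, THEN mp, THEN mp, THEN mp, THEN mp]
        division_ofD(1)[OF D] disjoint_family_on_division[OF D]) auto
  qed
qed

lemma sum_division_real_telescope:
  fixes f :: "real \<Rightarrow> 'a::real_normed_vector"
  assumes "D division_of {a..b}" "a \<le> b"
  shows "(\<Sum>k\<in>D. f (Sup k) - f (Inf k)) = f b - f a"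
proof -
  \<comment> \<open>The left end point is merely a convenient tag; with tags, the telescoping sum
    for tagged divisions applies.\<close>
  define p where "p = (\<lambda>k. (Inf k, k)) ` D"
  note DD = division_ofD[OF assms(1)] and DI = division_real_interval[OF assms(1)]
  have "p tagged_division_of {a..b}"
  proof (rule tagged_division_ofI)
    show "finite p" using DD(1) by (simp add: p_def)
    show "\<Union>{K. \<exists>x. (x, K) \<in> p} = {a..b}" unfolding DD(6)[symmetric] by (auto simp: p_def)
  next
    fix x K assume "(x, K) \<in> p"
    then have K: "K \<in> D" "x = Inf K" by (auto simp: p_def)
    show "x \<in> K" using DI(1,2)[OF K(1)] K(2) by (metis atLeastAtMost_iff order_refl)
    show "K \<subseteq> {a..b}" "\<exists>a b. K = cbox a b" using DD(2,4) K(1) by auto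
    fix y L assume "(y, L) \<in> p" and "(x, K) \<noteq> (y, L)"
    then have "L \<in> D" "K \<noteq> L" using K by (auto simp: p_def)
    then show "interior K \<inter> interior L = {}" using DD(5) K by blast
  qed
  from additive_tagged_division_1[OF assms(2) this, of f] show ?thesis
    unfolding p_def by (subst (asm) sum.reindex) (auto simp: inj_on_def)
qed

section \<open>Interval families\<close>

lemma sum_lengths_le:
  fixes s t :: "'i \<Rightarrow> real"
  assumes fin: "finite J" and st: "\<And>j. j \<in> J \<Longrightarrow> s j \<le> t j \<and> {s j<..<t j} \<subseteq> U"
    and disj: "disjoint_family_on (\<lambda>j. {s j<..<t j}) J" and U: "U \<in> lmeasurable"
  shows "(\<Sum>j\<in>J. t j - s j) \<le> measure lebesgue U"
proof -
  have "(\<Sum>j\<in>J. t j - s j) = (\<Sum>j\<in>J. measure lebesgue {s j<..<t j})"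
    using st by (intro sum.cong) auto
  also have "\<dots> = measure lebesgue (\<Union>j\<in>J. {s j<..<t j})"
    using st by (intro measure_finite_Union[symmetric] fin disj) auto
  also have "\<dots> \<le> measure lebesgue U"
  proof (intro measure_mono_fmeasurable UN_least U)
    show "(\<Union>j\<in>J. {s j<..<t j}) \<in> sets lebesgue" using fin by (intro sets.finite_UN) auto
  qed (use st in blast)
  finally show ?thesis .
qed

text \<open>The clamped point is the projection of \<open>x\<close> to the cell from
  \<open>c i\<close> to \<open>c (Suc i)\<close>. Cells to the left of \<open>x\<close> contribute
  their full increment, cells to the right contribute zero, and the cell containing \<open>x\<close>
  contributes the part up to \<open>x\<close>.\<close>

lemma clamp_telescope:
  fixes f :: "real \<Rightarrow> 'a::ab_group_add"
  assumes "incseq c" and "c 0 \<le> x"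
  shows "(\<Sum>i<n. f (max (c i) (min (c (Suc i)) x)) - f (c i)) = f (min x (c n)) - f (c 0)"
proof (induction n)
  case (Suc n)
  have "c n \<le> c (Suc n)" using \<open>incseq c\<close> by (simp add: incseq_SucD)
  then show ?case by (simp add: Suc) (auto simp: min_def max_def)
qed (use assms in \<open>simp add: min_def\<close>)

text \<open>The increments of \<open>f\<close> are split along a uniform grid by clamping the end points to its cells.\<close>

lemma AC_bounded_variation:
  fixes f :: "real \<Rightarrow> 'a::real_normed_vector"
  assumes f: "f \<in> AC a b" and "a \<le> b"
  obtains B where "\<And>D S. D division_of S \<Longrightarrow> S \<subseteq> {a..b} \<Longrightarrow> (\<Sum>k\<in>D. norm (f (Sup k) - f (Inf k))) \<le> B"
proof -
  obtain d where d: "d > 0" "\<forall>I :: real set set. \<forall> s t. finite I \<longrightarrow> (\<forall>j\<in>I. a \<le> s j \<and> s j \<le> t j \<and> t j \<le> b) \<longrightarrow>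
     disjoint_family_on (\<lambda>j. {s j<..<t j}) I \<longrightarrow> (\<Sum>j\<in>I. t j - s j) < d \<longrightarrow>
     (\<Sum>j\<in>I. norm (f (t j) - f (s j))) < 1"
    using AC_family[OF f zero_less_one, where ?'i = "real set"] by (elim exE conjE)
  \<comment> \<open>The mesh \<open>(b - a) / N\<close> falls below \<open>d\<close>, so the
    variation inside each grid cell is less than 1 and \<open>N\<close> itself bounds the total
    variation.\<close>
  obtain N :: nat where N: "(b - a) / d < real N" using reals_Archimedean2 by blast
  then have N0: "N > 0" using \<open>a \<le> b\<close> d(1) by (auto intro!: Nat.gr0I simp: divide_less_0_iff)
  define h where "h = (b - a) / N"
  have h: "h \<ge> 0" "h < d" using \<open>a \<le> b\<close> N N0 d(1) by (simp_all add: h_def field_simps)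
  define c where "c = (\<lambda>i::nat. a + real i * h)"
  have inc: "incseq c" using h(1) unfolding c_def by (intro incseq_SucI) (simp add: distrib_right)
  have c0: "c 0 = a" and step: "c (Suc i) - c i < d" for i
    using h(2) by (simp_all add: c_def distrib_right)
  have cN: "c N = b" using N0 by (simp add: c_def h_def)
  have c_le: "c i \<le> b" if "i \<le> N" for i using incseqD[OF inc that] cN by simp
  have c_ge: "a \<le> c i" for i using incseqD[OF inc, of 0 i] c0 by simp
  have c_suc: "c i \<le> c (Suc i)" for i using inc by (simp add: incseq_SucD)
  define cl where "cl = (\<lambda>i x. max (c i) (min (c (Suc i)) x))"
  have cl_sum: "(\<Sum>i<N. f (cl i x) - f (c i)) = f x - f a" if "x \<in> {a..b}" for x
    using clamp_telescope[OF inc, of x f N] that by (simp add: cl_def c0 cN min_absorb1)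
  show ?thesis
  proof (rule that[of N])
    fix D S assume D: "D division_of S" and S: "S \<subseteq> {a..b}"
    note DI = division_real_interval[OF D]
    have ab: "Inf k \<in> {a..b}" "Sup k \<in> {a..b}" if "k \<in> D" for k using DI(3,4)[OF that] S by auto
    have part: "(\<Sum>k\<in>D. norm (f (cl i (Sup k)) - f (cl i (Inf k)))) < 1" if "i < N" for i
    proof -
      have range: "c i \<le> cl i (Inf k) \<and> cl i (Inf k) \<le> cl i (Sup k) \<and> cl i (Sup k) \<le> c (Suc i)" if "k \<in> D" for k
        using DI(1)[OF that] c_suc[of i] by (auto simp: cl_def min_def max_def)
      \<comment> \<open>Projection to a grid cell can only shrink an open interval, so disjointness
        is inherited from the division.\<close>
      have sub: "{cl i (Inf k)<..<cl i (Sup k)} \<subseteq> {Inf k<..<Sup k}" for k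
        by (auto simp: cl_def)
      have disj: "disjoint_family_on (\<lambda>k. {cl i (Inf k)<..<cl i (Sup k)}) D"
        unfolding disjoint_family_on_def
      proof (intro ballI impI)
        fix k l assume "k \<in> D" "l \<in> D" "k \<noteq> l"
        then have "{Inf k<..<Sup k} \<inter> {Inf l<..<Sup l} = {}"
          by (rule disjoint_family_onD[OF disjoint_family_on_division[OF D]])
        then show "{cl i (Inf k)<..<cl i (Sup k)} \<inter> {cl i (Inf l)<..<cl i (Sup l)} = {}"
          using sub[of k] sub[of l] by blast
      qed
      have len: "(\<Sum>k\<in>D. cl i (Sup k) - cl i (Inf k)) \<le> c (Suc i) - c i"
      proof -
        have "{cl i (Inf k)<..<cl i (Sup k)} \<subseteq> {c i..c (Suc i)}" if "k \<in> D" for k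
          using range[OF that] by auto
        then show ?thesis
          using sum_lengths_le[OF division_ofD(1)[OF D] _ disj, of "{c i..c (Suc i)}"] range c_suc[of i] by simp
      qed
      have "\<forall>k\<in>D. a \<le> cl i (Inf k) \<and> cl i (Inf k) \<le> cl i (Sup k) \<and> cl i (Sup k) \<le> b"
        using range c_ge[of i] c_le[of "Suc i"] that by fastforce
      with len step[of i] show ?thesis
        by (intro d(2)[THEN spec, THEN spec, THEN spec, THEN mp, THEN mp, THEN mp, THEN mp]
          division_ofD(1)[OF D] disj) auto
    qed
    have "(\<Sum>k\<in>D. norm (f (Sup k) - f (Inf k))) \<le>
        (\<Sum>k\<in>D. \<Sum>i<N. norm (f (cl i (Sup k)) - f (cl i (Inf k))))"
    proof (rule sum_mono)
      fix k assume k: "k \<in> D"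
      have "f (Sup k) - f (Inf k) = (\<Sum>i<N. f (cl i (Sup k)) - f (cl i (Inf k)))"
      proof -
        have "f (Sup k) - f (Inf k) = (f (Sup k) - f a) - (f (Inf k) - f a)" by simp
        also have "\<dots> = (\<Sum>i<N. (f (cl i (Sup k)) - f (c i)) - (f (cl i (Inf k)) - f (c i)))"
          unfolding cl_sum[OF ab(1)[OF k], symmetric] cl_sum[OF ab(2)[OF k], symmetric]
          by (rule sum_subtractf[symmetric])
        finally show ?thesis by simp
      qed
      then show "norm (f (Sup k) - f (Inf k)) \<le> (\<Sum>i<N. norm (f (cl i (Sup k)) - f (cl i (Inf k))))"
        by (metis norm_sum)
    qed
    also have "\<dots> = (\<Sum>i<N. \<Sum>k\<in>D. norm (f (cl i (Sup k)) - f (cl i (Inf k))))"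
      by (rule sum.swap)
    also have "\<dots> \<le> (\<Sum>i<N. 1)"
      using part by (intro sum_mono) (auto intro: less_imp_le)
    finally show "(\<Sum>k\<in>D. norm (f (Sup k) - f (Inf k))) \<le> real N" by simp
  qed
qed

lemma sum_length_division:
  fixes D :: "real set set"
  assumes D: "D division_of S"
  shows "(\<Sum>k\<in>D. Sup k - Inf k) = measure lebesgue S"
proof -
  have "(\<Sum>k\<in>D. Sup k - Inf k) = (\<Sum>k\<in>D. measure lebesgue k)"
  proof (rule sum.cong[OF refl])
    fix k assume "k \<in> D"
    note K = division_real_interval(1,2)[OF D this]
    have "measure lebesgue {Inf k..Sup k} = Sup k - Inf k" using K(1) by simp
    then show "Sup k - Inf k = measure lebesgue k" using K(2) by simp
  qed
  also have "\<dots> = measure lebesgue S"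
    by (rule content_division[OF D])
  finally show ?thesis .
qed

text \<open>\<open>H\<close> plays the role of the gaps left by \<open>G\<close> in
  \<open>F\<close>. Both \<open>F\<close> and \<open>G\<close> are completed to divisions of the
  whole interval that share the outer cells \<open>C\<close>; the two telescoping sums agree and
  \<open>C\<close> cancels. The cells of \<open>H\<close> are not claimed to lie in those of
  \<open>F\<close>, as only the sums matter. The identity will be used for lengths and for the
  increments of an absolutely continuous function with the same \<open>H\<close>.\<close>

lemma division_complement:
  fixes F G :: "real set set"
  assumes F: "F division_of S" and S: "S \<subseteq> {a..b}" and "a \<le> b"
    and G: "G division_of T" and T: "T \<subseteq> (\<Union>k\<in>F. interior k)"
    and nondeg: "\<And>k. k \<in> G \<Longrightarrow> interior k \<noteq> {}"
  obtains H S' where "H division_of S'" "S' \<subseteq> {a..b}"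
    "\<And>\<phi> :: real \<Rightarrow> real. (\<Sum>k\<in>F. \<phi> (Sup k) - \<phi> (Inf k)) =
      (\<Sum>k\<in>G. \<phi> (Sup k) - \<phi> (Inf k)) + (\<Sum>k\<in>H. \<phi> (Sup k) - \<phi> (Inf k))"
proof -
  obtain P where P: "F \<subseteq> P" "P division_of {a..b}"
    using partial_division_extend_interval[of F a b] F S division_ofD(6)[OF F] by auto
  define C where "C = P - F"
  have C: "C division_of \<Union>C"
    using division_of_subset[of P C] P division_ofD(6)[OF P(2)] by (auto simp: C_def)
  have FC: "interior k \<inter> interior l = {}" if "k \<in> F" "l \<in> C" for k l
    using division_ofD(5)[OF P(2), of k l] that P(1) by (auto simp: C_def)
  have "(\<Union>k\<in>F. interior k) \<inter> interior (\<Union>C) = {}"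
    using FC by (intro Int_interior_Union_intervals division_ofD(1,4)[OF C]) auto
  then have int: "interior T \<inter> interior (\<Union>C) = {}"
    using T interior_subset by blast
  \<comment> \<open>A common cell would lie in both unions, whose interiors are disjoint, and so
    have empty interior; \<open>nondeg\<close> rules this out.\<close>
  have GC: "G \<inter> C = {}"
  proof (rule equals0I)
    fix k assume k: "k \<in> G \<inter> C"
    then have "interior k \<subseteq> interior T" using division_ofD(2)[OF G] by (simp add: interior_mono)
    moreover have "interior k \<subseteq> interior (\<Union>C)" using k by (intro interior_mono) auto
    ultimately have "interior k \<subseteq> {}" using int by blast
    then show False using nondeg k by blast
  qed
  have "G \<union> C division_of T \<union> \<Union>C"
    by (rule division_disjoint_union[OF G C int])
  moreover have "T \<union> \<Union>C \<subseteq> {a..b}"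
  proof (rule Un_least)
    have "T \<subseteq> \<Union>F" using T interior_subset by blast
    then show "T \<subseteq> {a..b}" using division_ofD(6)[OF F] S by simp
    show "\<Union>C \<subseteq> {a..b}" using division_ofD(2)[OF P(2)] by (auto simp: C_def)
  qed
  ultimately obtain R where R: "G \<union> C \<subseteq> R" "R division_of {a..b}"
    using partial_division_extend_interval[of "G \<union> C" a b] division_ofD(6)[of "G \<union> C"] by (metis box_real(2))
  define H where "H = R - (G \<union> C)"
  have H: "H division_of \<Union>H"
    using division_of_subset[of R H] R division_ofD(6)[OF R(2)] by (auto simp: H_def)
  show ?thesis
  proof (rule that[OF H])
    show "\<Union>H \<subseteq> {a..b}" using division_ofD(2)[OF R(2)] by (auto simp: H_def)
    fix \<phi> :: "real \<Rightarrow> real"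
    let ?\<Delta> = "\<lambda>k. \<phi> (Sup k) - \<phi> (Inf k)"
    have fin: "finite F" "finite C" "finite G" "finite H"
      using F C G H by (auto dest: division_ofD(1))
    have PFC: "P = F \<union> C" "F \<inter> C = {}" and RGCH: "R = (G \<union> C) \<union> H" "(G \<union> C) \<inter> H = {}"
      using P(1) R(1) by (auto simp: C_def H_def)
    have "sum ?\<Delta> F + sum ?\<Delta> C = sum ?\<Delta> P"
      using PFC fin by (simp add: sum.union_disjoint)
    also have "\<dots> = sum ?\<Delta> R"
      using sum_division_real_telescope[OF P(2) \<open>a \<le> b\<close>, of \<phi>] sum_division_real_telescope[OF R(2) \<open>a \<le> b\<close>, of \<phi>] by simp
    also have "\<dots> = sum ?\<Delta> G + sum ?\<Delta> C + sum ?\<Delta> H"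
      using RGCH fin GC by (simp add: sum.union_disjoint)
    finally show "sum ?\<Delta> F = sum ?\<Delta> G + sum ?\<Delta> H" by simp
  qed
qed

section \<open>Finite Vitali selection\<close>

text \<open>A closed interval is a ball about its midpoint, and Vitali's theorem asks only that
  \<open>x\<close> lie in the ball, not at its centre. The countable disjoint family is cut down to
  a finite one; \<open>X\<close> collects the discarded tail and the negligible set missed by the
  whole family.\<close>

lemma Vitali_intervals:
  fixes S U :: "real set"
  assumes U: "open U" "U \<in> lmeasurable" "S \<subseteq> U" and e: "e > 0"
    and P: "\<And>x d. x \<in> S \<Longrightarrow> d > 0 \<Longrightarrow> \<exists>s t. s < t \<and> x \<in> {s..t} \<and> t - s < d \<and> P s t"
  obtains G X where "G division_of \<Union>G" "\<Union>G \<subseteq> U" "\<And>k. k \<in> G \<Longrightarrow> Inf k < Sup k \<and> P (Inf k) (Sup k)"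
    "S \<subseteq> \<Union>G \<union> X" "X \<in> lmeasurable" "measure lebesgue X < e"
proof -
  define K where "K = {(s, t). s < t \<and> {s..t} \<subseteq> U \<and> P s t}"
  define m r where "m = (\<lambda>(s, t). (s + t) / 2 :: real)" and "r = (\<lambda>(s, t). (t - s) / 2 :: real)"
  have cb: "cball (m i) (r i) = {fst i..snd i}" for i
    by (auto simp: m_def r_def case_prod_unfold cball_def dist_real_def field_simps)
  have 1: "0 < r i" if "i \<in> K" for i using that by (auto simp: K_def r_def)
  have 2: "\<exists>i. i \<in> K \<and> x \<in> cball (m i) (r i) \<and> r i < d" if xd: "x \<in> S" "d > 0" for x d
  proof -
    obtain \<delta> where \<delta>: "\<delta> > 0" "ball x \<delta> \<subseteq> U" using openE[OF U(1), of x] U(3) xd(1) by blast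
    \<comment> \<open>Shortness below the distance \<delta> keeps the interval inside
      \<open>U\<close>, since it contains \<open>x\<close>.\<close>
    obtain s t where st: "s < t" "x \<in> {s..t}" "t - s < min d \<delta>" "P s t"
      using P[OF xd(1), of "min d \<delta>"] xd(2) \<delta>(1) by (metis min_less_iff_conj)
    have "{s..t} \<subseteq> ball x \<delta>" using st(2,3) by (auto simp: dist_real_def)
    then have "(s, t) \<in> K" using st(1,4) \<delta>(2) by (auto simp: K_def)
    moreover have "r (s, t) < d" using st(1,3) by (simp add: r_def)
    ultimately show ?thesis using st(2) unfolding cb by (intro exI[of _ "(s, t)"]) simp
  qed
  obtain C where C: "countable C" "C \<subseteq> K"
     "pairwise (\<lambda>i j. disjnt (cball (m i) (r i)) (cball (m j) (r j))) C"
     "negligible (S - (\<Union>i \<in> C. cball (m i) (r i)))"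
    by (rule Vitali_covering_theorem_cballs[OF 1 2]) auto
  define D where "D = (\<lambda>i. {fst i..snd i}) ` C"
  have DU: "k \<subseteq> U" "k \<in> lmeasurable" "\<exists>s t. k = {s..t} \<and> s < t \<and> P s t" if kD: "k \<in> D" for k
  proof -
    obtain i where i: "i \<in> K" "k = {fst i..snd i}" using kD C(2) by (auto simp: D_def)
    then show "k \<subseteq> U" "k \<in> lmeasurable" "\<exists>s t. k = {s..t} \<and> s < t \<and> P s t"
      by (auto simp: K_def case_prod_unfold simp del: atLeastatMost_subset_iff)
  qed
  have DU': "\<Union>D \<subseteq> U" using DU by auto
  have disjD: "k \<inter> l = {}" if kl: "k \<in> D" "l \<in> D" "k \<noteq> l" for k l
  proof -
    obtain i j where ij: "i \<in> C" "j \<in> C" "k = {fst i..snd i}" "l = {fst j..snd j}"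
      using kl(1,2) unfolding D_def by (elim imageE)
    then have "i \<noteq> j" using kl(3) by auto
    then show ?thesis using pairwiseD[OF C(3) ij(1,2)] ij(3,4) unfolding cb disjnt_def by simp
  qed
  have cD: "countable D" using C(1) by (auto simp: D_def)
  \<comment> \<open>This bound, uniform over finite subfamilies, is what allows the countable union
    to be approximated in measure by a finite one.\<close>
  have bound: "measure lebesgue (\<Union>D') \<le> measure lebesgue U" if that: "D' \<subseteq> D" "finite D'" for D'
  proof (rule measure_mono_fmeasurable)
    show "\<Union>D' \<subseteq> U" using that(1) DU(1) by blast
    show "\<Union>D' \<in> sets lebesgue"
      using that DU(2) by (intro sets.finite_Union) (auto dest!: fmeasurableD)
  qed (rule U(2))
  obtain D' where D': "D' \<subseteq> D" "finite D'" "measure lebesgue (\<Union>D) - e < measure lebesgue (\<Union>D')"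
    by (rule measure_countable_Union_approachable[OF cD e DU(2) bound])
  have mD: "\<Union>D \<in> lmeasurable"
  proof (rule fmeasurableI2[OF U(2) DU'])
    show "\<Union>D \<in> sets lebesgue"
      using cD DU(2) by (intro sets.countable_Union) (auto dest!: fmeasurableD)
  qed
  have mD': "\<Union>D' \<in> lmeasurable" using D'(1,2) DU(2) by (intro fmeasurable.finite_Union) auto
  define X where "X = (S - \<Union>D) \<union> (\<Union>D - \<Union>D')"
  have neg: "negligible (S - \<Union>D)" using C(4) unfolding D_def cb by simp
  have "measure lebesgue X = measure lebesgue (\<Union>D - \<Union>D')"
    unfolding X_def Un_commute[of "S - \<Union>D"] using neg mD mD'
    by (intro measure_Un_null_set) (auto simp: negligible_iff_null_sets)
  also have "\<dots> = measure lebesgue (\<Union>D) - measure lebesgue (\<Union>D')"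
    using mD mD' D' by (intro measurable_measure_Diff) auto
  also have "\<dots> < e" using D' by simp
  finally have mX: "measure lebesgue X < e" .
  show ?thesis
  proof (rule that)
    show "D' division_of \<Union>D'"
    proof (rule division_ofI)
      fix k assume "k \<in> D'"
      then obtain s t where "k = {s..t}" "s < t" using DU(3) D' by blast
      then show "k \<noteq> {}" "\<exists>a b. k = cbox a b" by auto
    next
      fix k l assume "k \<in> D'" "l \<in> D'" "k \<noteq> l"
      then have "k \<inter> l = {}" using disjD D' by blast
      then show "interior k \<inter> interior l = {}" using interior_subset by blast
    qed (use D' in auto)
    show "\<Union>D' \<subseteq> U" using D' DU' by auto
    show "Inf k < Sup k \<and> P (Inf k) (Sup k)" if kD: "k \<in> D'" for k
    proof -
      obtain s t where "k = {s..t}" "s < t" "P s t" using DU(3)[of k] kD D'(1) by blast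
      then show ?thesis by simp
    qed
    show "S \<subseteq> \<Union>D' \<union> X" by (auto simp: X_def)
    show "X \<in> lmeasurable" using neg mD mD' by (auto simp: X_def negligible_imp_measurable)
  qed (rule mX)
qed

section \<open>Differentiability almost everywhere\<close>

text \<open>
  \<open>S\<close> is covered, up to a small remainder, first by intervals with slope below \<open>u\<close> and then, inside
  these, by intervals with slope above \<open>v\<close>. The gaps between the two families have small total
  length, so absolute continuity makes the increments of \<open>f\<close> over both families nearly equal.
  The number \<open>m\<close> is the outer measure of \<open>S\<close>, which need not be known to be measurable.
\<close>

lemma AC_negligible_oscillation:
  fixes f :: "real \<Rightarrow> real"
  assumes f: "f \<in> AC a b" and "a < b" and "u < v" and S: "S \<subseteq> {a<..<b}"
    and lo: "\<And>x d. x \<in> S \<Longrightarrow> d > 0 \<Longrightarrow> \<exists>s t. s < t \<and> x \<in> {s..t} \<and> t - s < d \<and> f t - f s < u * (t - s)"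
    and hi: "\<And>x d. x \<in> S \<Longrightarrow> d > 0 \<Longrightarrow> \<exists>s t. s < t \<and> x \<in> {s..t} \<and> t - s < d \<and> f t - f s > v * (t - s)"
  shows "negligible S"
proof -
  let ?\<mu> = "measure lebesgue"
  define M where "M = ?\<mu> ` {T. T \<in> lmeasurable \<and> S \<subseteq> T}"
  define m where "m = Inf M"
  have "?\<mu> {a<..<b} \<in> M" unfolding M_def using S by (intro imageI) auto
  then have M: "M \<noteq> {}" by auto
  have bdd: "bdd_below M" unfolding M_def by (intro bdd_belowI[of _ 0]) auto
  have m_le: "m \<le> ?\<mu> T" if "T \<in> lmeasurable" "S \<subseteq> T" for T
    unfolding m_def using that by (intro cInf_lower bdd) (auto simp: M_def)
  have m_approx: "\<exists>T. T \<in> lmeasurable \<and> S \<subseteq> T \<and> ?\<mu> T < m + e" if "e > 0" for e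
  proof -
    have "\<exists>y\<in>M. y < m + e" using cInf_lessD[OF M, of "m + e"] that by (auto simp: m_def)
    then show ?thesis by (auto simp: M_def)
  qed
  have "\<not> m > 0"
  proof
    assume "m > 0"
    \<comment> \<open>A quarter of the excess \<open>(v - u) * m\<close>. At the end the excess is
      still at least three such quarters, while the errors consume at most two.\<close>
    define \<kappa> where "\<kappa> = (v - u) * m / 4"
    have "\<kappa> > 0" using \<open>m > 0\<close> \<open>u < v\<close> by (simp add: \<kappa>_def)
    obtain d where d: "d > 0" "\<And>D S. D division_of S \<Longrightarrow> S \<subseteq> {a..b} \<Longrightarrow> (\<Sum>k\<in>D. Sup k - Inf k) < d \<Longrightarrow>
        (\<Sum>k\<in>D. norm (f (Sup k) - f (Inf k))) < \<kappa>"
      using AC_division[OF f \<open>\<kappa> > 0\<close>] by blast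
    \<comment> \<open>The three bounds serve in turn to bring the gap length, which is below
      \<open>4 * \<eta>\<close>, under \<open>d\<close>; to keep the length of \<open>G\<close> at
      least \<open>3 / 4 * m\<close>; and to make \<open>u\<close> times the gap length at most
      \<kappa>. The summand 1 avoids division by zero.\<close>
    define \<eta> where "\<eta> = min (d / 4) (min (m / 8) (\<kappa> / (4 * (\<bar>u\<bar> + 1))))"
    have \<eta>: "\<eta> > 0" "\<eta> \<le> d / 4" "\<eta> \<le> m / 8" "\<eta> \<le> \<kappa> / (4 * (\<bar>u\<bar> + 1))"
    proof -
      show "\<eta> > 0" using d(1) \<open>m > 0\<close> \<open>\<kappa> > 0\<close> by (simp add: \<eta>_def)
      show "\<eta> \<le> d / 4" unfolding \<eta>_def by (rule min.cobounded1)
      show "\<eta> \<le> m / 8" unfolding \<eta>_def by (intro min.coboundedI2 min.cobounded1)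
      show "\<eta> \<le> \<kappa> / (4 * (\<bar>u\<bar> + 1))" unfolding \<eta>_def by (intro min.coboundedI2 min.cobounded2)
    qed
    obtain T where T: "T \<in> lmeasurable" "S \<subseteq> T" "?\<mu> T < m + \<eta>" using m_approx[OF \<eta>(1)] by blast
    define T1 where "T1 = T \<inter> {a<..<b}"
    have T1: "T1 \<in> lmeasurable" "S \<subseteq> T1"
      using T S by (auto simp: T1_def intro: fmeasurable.Int)
    have "?\<mu> T1 \<le> ?\<mu> T"
      using T T1 by (intro measure_mono_fmeasurable) (auto simp: T1_def dest: fmeasurableD)
    obtain U0 where U0: "open U0" "T1 \<subseteq> U0" "U0 - T1 \<in> lmeasurable" "emeasure lebesgue (U0 - T1) < ennreal \<eta>"
      using sets_lebesgue_outer_open[OF fmeasurableD[OF T1(1)] \<eta>(1)] by blast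
    define U where "U = U0 \<inter> {a<..<b}"
    have U: "open U" "S \<subseteq> U" "U \<subseteq> {a<..<b}" "U \<in> lmeasurable"
      using U0 T1(2) S unfolding U_def by (auto intro!: bounded_set_imp_lmeasurable bounded_Int)
    have "?\<mu> (U0 - T1) < \<eta>"
      using U0(3,4) \<eta>(1) by (simp add: emeasure_eq_measure2 ennreal_less_iff)
    moreover have "?\<mu> U \<le> ?\<mu> (T1 \<union> (U0 - T1))"
    proof (rule measure_mono_fmeasurable)
      show "U \<subseteq> T1 \<union> (U0 - T1)" by (auto simp: U_def)
      show "U \<in> sets lebesgue" using U(4) by (rule fmeasurableD)
      show "T1 \<union> (U0 - T1) \<in> lmeasurable" using T1(1) U0(3) by (rule fmeasurable.Un)
    qed
    moreover have "?\<mu> (T1 \<union> (U0 - T1)) \<le> ?\<mu> T1 + ?\<mu> (U0 - T1)"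
      using T1(1) U0(3) by (intro measure_Un_le fmeasurableD)
    ultimately have mU: "?\<mu> U < m + 2 * \<eta>" using T(3) \<open>?\<mu> T1 \<le> ?\<mu> T\<close> by simp
    obtain F X where F: "F division_of \<Union>F" "\<Union>F \<subseteq> U"
        "\<And>k. k \<in> F \<Longrightarrow> Inf k < Sup k \<and> f (Sup k) - f (Inf k) < u * (Sup k - Inf k)"
        and X: "S \<subseteq> \<Union>F \<union> X" "X \<in> lmeasurable" "?\<mu> X < \<eta>"
      by (rule Vitali_intervals[OF U(1,4,2) \<eta>(1) lo]) blast+
    \<comment> \<open>The second covering takes place in the open interiors of the cells of
      \<open>F\<close>, so that its intervals lie inside these cells. The end points lost in this
      way form the finite set \<open>E\<close>.\<close>
    define U' where "U' = (\<Union>k\<in>F. interior k)"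
    have "U' \<subseteq> \<Union>F" unfolding U'_def using interior_subset by blast
    then have "U' \<subseteq> {a<..<b}" using F(2) U(3) by blast
    moreover have "open U'" by (auto simp: U'_def)
    moreover have "bounded U'"
      using \<open>U' \<subseteq> {a<..<b}\<close> by (intro bounded_subset[OF bounded_closed_interval[of a b]]) auto
    ultimately have U': "open U'" "U' \<subseteq> {a<..<b}" "U' \<in> lmeasurable" "S \<inter> U' \<subseteq> U'"
      by (auto intro: lmeasurable_open)
    have lo': "\<exists>s t. s < t \<and> x \<in> {s..t} \<and> t - s < d \<and> f t - f s > v * (t - s)" if "x \<in> S \<inter> U'" "d > 0" for x d
      using hi that by blast
    obtain G X' where G: "G division_of \<Union>G" "\<Union>G \<subseteq> U'"
        "\<And>k. k \<in> G \<Longrightarrow> Inf k < Sup k \<and> f (Sup k) - f (Inf k) > v * (Sup k - Inf k)"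
        and X': "S \<inter> U' \<subseteq> \<Union>G \<union> X'" "X' \<in> lmeasurable" "?\<mu> X' < \<eta>"
      by (rule Vitali_intervals[OF U'(1,3,4) \<eta>(1) lo']) blast+
    define E where "E = (\<Union>k\<in>F. {Inf k, Sup k})"
    have "finite E" using division_ofD(1)[OF F(1)] by (simp add: E_def)
    have FE: "\<Union>F \<subseteq> U' \<union> E"
    proof
      fix x assume "x \<in> \<Union>F"
      then obtain k where k: "k \<in> F" "x \<in> k" by blast
      have keq: "k = {Inf k..Sup k}" by (rule division_real_interval(2)[OF F(1) k(1)])
      then have "interior k = {Inf k<..<Sup k}" by (metis interior_atLeastAtMost_real)
      moreover have "Inf k \<le> x" "x \<le> Sup k" using keq k(2) by (metis atLeastAtMost_iff)+
      ultimately have "x \<in> interior k \<or> x = Inf k \<or> x = Sup k" by auto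
      then show "x \<in> U' \<union> E" using k(1) by (auto simp: U'_def E_def)
    qed
    have E: "E \<in> lmeasurable" "?\<mu> E = 0"
      using negligible_finite[OF \<open>finite E\<close>] by (auto simp: negligible_imp_measurable negligible_imp_measure0)
    have FU: "\<Union>F \<subseteq> {a..b}"
      using order_trans[OF F(2) U(3)] greaterThanLessThan_subseteq_atLeastAtMost_iff[of a b a b] by (meson order_refl order_trans)
    have mF: "\<Union>F \<in> lmeasurable" "\<Union>G \<in> lmeasurable"
      using lmeasurable_division[OF F(1)] lmeasurable_division[OF G(1)] by auto
    \<comment> \<open>As \<open>m\<close> is the outer measure of \<open>S\<close>, and
      \<open>G\<close> covers \<open>S\<close> up to sets of measure below \<eta>, the family
      \<open>G\<close> nearly exhausts the length of \<open>F\<close>.\<close>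
    have "m \<le> ?\<mu> (\<Union>G \<union> X' \<union> X \<union> E)"
    proof (rule m_le)
      show "\<Union>G \<union> X' \<union> X \<union> E \<in> lmeasurable" using mF X'(2) X(2) E(1) by (intro fmeasurable.Un)
      show "S \<subseteq> \<Union>G \<union> X' \<union> X \<union> E" using X(1) X'(1) FE by blast
    qed
    also have "\<dots> \<le> ?\<mu> (\<Union>G \<union> X' \<union> X) + ?\<mu> E"
      using mF X'(2) X(2) E(1) by (intro measure_Un_le fmeasurableD fmeasurable.Un)
    also have "?\<mu> (\<Union>G \<union> X' \<union> X) \<le> ?\<mu> (\<Union>G \<union> X') + ?\<mu> X"
      using mF X'(2) X(2) by (intro measure_Un_le fmeasurableD fmeasurable.Un)
    also have "?\<mu> (\<Union>G \<union> X') \<le> ?\<mu> (\<Union>G) + ?\<mu> X'"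
      using mF X'(2) by (intro measure_Un_le fmeasurableD)
    finally have mG: "m - 2 * \<eta> \<le> ?\<mu> (\<Union>G)" using X(3) X'(3) E(2) by simp
    have "?\<mu> (\<Union>F) \<le> ?\<mu> U"
      by (rule measure_mono_fmeasurable[OF F(2) fmeasurableD[OF mF(1)] U(4)])
    with mU have mF': "?\<mu> (\<Union>F) < m + 2 * \<eta>" by simp
    have nondeg: "interior k \<noteq> {}" if "k \<in> G" for k
    proof -
      have "interior k = {Inf k<..<Sup k}"
        using division_real_interval(2)[OF G(1) that] by (metis interior_atLeastAtMost_real)
      then show ?thesis using G(3)[OF that] by simp
    qed
    obtain H S' where H: "H division_of S'" "S' \<subseteq> {a..b}"
      "\<And>\<phi> :: real \<Rightarrow> real. (\<Sum>k\<in>F. \<phi> (Sup k) - \<phi> (Inf k)) =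
        (\<Sum>k\<in>G. \<phi> (Sup k) - \<phi> (Inf k)) + (\<Sum>k\<in>H. \<phi> (Sup k) - \<phi> (Inf k))"
      by (rule division_complement[OF F(1) FU less_imp_le[OF \<open>a < b\<close>] G(1) G(2)[unfolded U'_def] nondeg]) blast+
    define LF LG LH where "LF = (\<Sum>k\<in>F. Sup k - Inf k)" and "LG = (\<Sum>k\<in>G. Sup k - Inf k)" and "LH = (\<Sum>k\<in>H. Sup k - Inf k)"
    have L: "LF = LG + LH" using H(3)[of "\<lambda>x. x"] by (simp add: LF_def LG_def LH_def)
    have LG: "LG \<ge> m - 2 * \<eta>" using mG sum_length_division[OF G(1)] by (simp add: LG_def)
    have LF: "LF < m + 2 * \<eta>" using mF' sum_length_division[OF F(1)] by (simp add: LF_def)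
    have LH: "0 \<le> LH" "LH < 4 * \<eta>"
      using L LG LF division_real_interval(1)[OF H(1)] by (auto simp: LH_def intro!: sum_nonneg)
    have "(\<Sum>k\<in>H. norm (f (Sup k) - f (Inf k))) < \<kappa>"
      using d(2)[OF H(1,2)] LH \<eta>(2) by (simp add: LH_def)
    moreover have "\<bar>\<Sum>k\<in>H. f (Sup k) - f (Inf k)\<bar> \<le> (\<Sum>k\<in>H. norm (f (Sup k) - f (Inf k)))"
      by (simp add: sum_abs)
    ultimately have Hf: "- \<kappa> < (\<Sum>k\<in>H. f (Sup k) - f (Inf k))" by linarith
    have "(\<Sum>k\<in>F. f (Sup k) - f (Inf k)) \<le> (\<Sum>k\<in>F. u * (Sup k - Inf k))"
      using F(3) by (intro sum_mono) (auto intro: less_imp_le)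
    then have Ff: "(\<Sum>k\<in>F. f (Sup k) - f (Inf k)) \<le> u * LF" by (simp add: LF_def sum_distrib_left)
    have "(\<Sum>k\<in>G. v * (Sup k - Inf k)) \<le> (\<Sum>k\<in>G. f (Sup k) - f (Inf k))"
      using G(3) by (intro sum_mono) (auto intro: less_imp_le)
    then have Gf: "v * LG \<le> (\<Sum>k\<in>G. f (Sup k) - f (Inf k))" by (simp add: LG_def sum_distrib_left)
    \<comment> \<open>The increment over \<open>F\<close> is at most \<open>u\<close> times its
      length, while its part over \<open>G\<close> is at least \<open>v * LG\<close> and the gaps
      can take away at most \<kappa>.\<close>
    have "v * LG - \<kappa> \<le> u * (LG + LH)" using Hf Ff Gf H(3)[of f] L by simp
    then have 1: "(v - u) * LG \<le> u * LH + \<kappa>" by (simp add: algebra_simps)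
    have "u * LH \<le> \<bar>u\<bar> * LH" using LH(1) by (intro mult_right_mono) auto
    also have "\<dots> \<le> (\<bar>u\<bar> + 1) * (4 * \<eta>)" using LH by (intro mult_mono) auto
    also have "\<dots> \<le> \<kappa>" using \<eta>(4) by (simp add: field_simps)
    finally have 2: "(v - u) * LG \<le> 2 * \<kappa>" using 1 by simp
    have "(v - u) * (3 / 4 * m) \<le> (v - u) * LG"
      using LG \<eta>(3) \<open>u < v\<close> by (intro mult_left_mono) auto
    moreover have "(v - u) * (3 / 4 * m) = 3 * \<kappa>" by (simp add: \<kappa>_def)
    ultimately have "3 * \<kappa> \<le> 2 * \<kappa>" using 2 by linarith
    with \<open>\<kappa> > 0\<close> show False by simp
  qed
  show ?thesis unfolding negligible_outer
  proof (intro allI impI)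
    fix e :: real assume "e > 0"
    then obtain T where "T \<in> lmeasurable" "S \<subseteq> T" "?\<mu> T < m + e" using m_approx by blast
    with \<open>\<not> m > 0\<close> show "\<exists>T. S \<subseteq> T \<and> T \<in> lmeasurable \<and> ?\<mu> T < e" by (intro exI[of _ T]) auto
  qed
qed

text \<open>Disjoint intervals on which the slope exceeds \<open>C\<close> have total length at most
  the variation bound divided by \<open>C\<close>, and \<open>C\<close> is arbitrary.\<close>

lemma AC_negligible_unbounded_slope:
  fixes f :: "real \<Rightarrow> real"
  assumes f: "f \<in> AC a b" and "a < b" and S: "S \<subseteq> {a<..<b}"
    and st: "\<And>C x d. x \<in> S \<Longrightarrow> d > 0 \<Longrightarrow> \<exists>s t. s < t \<and> x \<in> {s..t} \<and> t - s < d \<and> \<bar>f t - f s\<bar> > C * (t - s)"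
  shows "negligible S"
  unfolding negligible_outer_le
proof (intro allI impI)
  let ?\<mu> = "measure lebesgue"
  fix e :: real assume "e > 0"
  obtain B where B: "\<And>D S. D division_of S \<Longrightarrow> S \<subseteq> {a..b} \<Longrightarrow> (\<Sum>k\<in>D. norm (f (Sup k) - f (Inf k))) \<le> B"
    by (rule AC_bounded_variation[OF f less_imp_le[OF \<open>a < b\<close>]]) blast
  \<comment> \<open>One half of \<open>e\<close> goes to the selected intervals, the other to the
    Vitali remainder. Using \<open>\<bar>B\<bar> + 1\<close> makes \<open>C\<close> positive
    whatever the sign of \<open>B\<close>.\<close>
  define C where "C = (\<bar>B\<bar> + 1) * 2 / e"
  have C: "C > 0" using \<open>e > 0\<close> by (simp add: C_def)
  have "e / 2 > 0" using \<open>e > 0\<close> by simp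
  have ab: "{a<..<b} \<in> lmeasurable" by simp
  have st': "\<exists>s t. s < t \<and> x \<in> {s..t} \<and> t - s < d \<and> C * (t - s) < \<bar>f t - f s\<bar>" if "x \<in> S" "d > 0" for x d
    using st[OF that] .
  obtain G X where G: "G division_of \<Union>G" "\<Union>G \<subseteq> {a<..<b}"
      "\<And>k. k \<in> G \<Longrightarrow> Inf k < Sup k \<and> C * (Sup k - Inf k) < \<bar>f (Sup k) - f (Inf k)\<bar>"
      and X: "S \<subseteq> \<Union>G \<union> X" "X \<in> lmeasurable" "?\<mu> X < e / 2"
    by (rule Vitali_intervals[OF open_greaterThanLessThan ab S \<open>e / 2 > 0\<close> st']) blast+
  have mG: "\<Union>G \<in> lmeasurable" by (rule lmeasurable_division[OF G(1)])
  have "C * ?\<mu> (\<Union>G) = (\<Sum>k\<in>G. C * (Sup k - Inf k))"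
    by (simp add: sum_length_division[OF G(1), symmetric] sum_distrib_left)
  also have "\<dots> \<le> (\<Sum>k\<in>G. norm (f (Sup k) - f (Inf k)))"
    using G(3) by (intro sum_mono) (auto intro: less_imp_le)
  also have "\<dots> \<le> B" using G(2) by (intro B[OF G(1)]) auto
  also have "\<dots> \<le> C * (e / 2)" using \<open>e > 0\<close> by (simp add: C_def)
  finally have "?\<mu> (\<Union>G) \<le> e / 2" using C by simp
  moreover have "?\<mu> (\<Union>G \<union> X) \<le> ?\<mu> (\<Union>G) + ?\<mu> X"
    using mG X(2) by (intro measure_Un_le fmeasurableD)
  ultimately have "?\<mu> (\<Union>G \<union> X) \<le> e" using X(3) by simp
  then show "\<exists>T. S \<subseteq> T \<and> T \<in> lmeasurable \<and> ?\<mu> T \<le> e"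
    using mG X by (intro exI[of _ "\<Union>G \<union> X"]) auto
qed

text \<open>Boundedness makes the lower and upper limits finite, so their equality would give a
  limit. Otherwise two rationals fit strictly between them; rationality is what later keeps the
  exceptional set a countable union.\<close>

lemma real_limit_or_oscillates:
  fixes Q :: "'a \<Rightarrow> real"
  assumes F: "F \<noteq> bot" and bd: "\<forall>\<^sub>F y in F. \<bar>Q y\<bar> \<le> C" and no: "\<And>L. \<not> (Q \<longlongrightarrow> L) F"
  obtains u v where "u \<in> \<rat>" "v \<in> \<rat>" "u < v" "\<exists>\<^sub>F y in F. Q y < u" "\<exists>\<^sub>F y in F. Q y > v"
proof -
  define l L where "l = Liminf F (\<lambda>y. ereal (Q y))" and "L = Limsup F (\<lambda>y. ereal (Q y))"
  have bounds: "ereal (- C) \<le> l" "L \<le> ereal C"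
    unfolding l_def L_def using bd
    by (auto intro!: Liminf_bounded Limsup_bounded elim!: eventually_mono)
  have "l \<le> L" unfolding l_def L_def by (rule Liminf_le_Limsup[OF F])
  have "l \<noteq> L"
  proof
    assume "l = L"
    then obtain r where r: "L = ereal r" using bounds by (cases L) auto
    have "((\<lambda>y. ereal (Q y)) \<longlongrightarrow> L) F"
      using \<open>l = L\<close> F by (intro iffD2[OF tendsto_iff_Liminf_eq_Limsup]) (auto simp: l_def L_def)
    then have "(Q \<longlongrightarrow> r) F" by (simp add: r)
    with no show False by blast
  qed
  with \<open>l \<le> L\<close> have "l < L" by simp
  then obtain r1 where r1: "l < ereal (real_of_rat r1)" "ereal (real_of_rat r1) < L" using ereal_dense3 by blast
  then obtain r2 where r2: "ereal (real_of_rat r1) < ereal (real_of_rat r2)" "ereal (real_of_rat r2) < L"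
    using ereal_dense3 by blast
  show ?thesis
  proof (rule that)
    show "\<exists>\<^sub>F y in F. Q y < real_of_rat r1"
      unfolding frequently_def
    proof
      assume "\<forall>\<^sub>F y in F. \<not> Q y < real_of_rat r1"
      then have "ereal (real_of_rat r1) \<le> l"
        unfolding l_def by (intro Liminf_bounded) (auto elim!: eventually_mono)
      with r1 show False by simp
    qed
    show "\<exists>\<^sub>F y in F. Q y > real_of_rat r2"
      unfolding frequently_def
    proof
      assume "\<forall>\<^sub>F y in F. \<not> Q y > real_of_rat r2"
      then have "L \<le> ereal (real_of_rat r2)"
        unfolding L_def by (intro Limsup_bounded) (auto elim!: eventually_mono)
      with r2 show False by simp
    qed
  qed (use r2 in auto)
qed

text \<open>A difference quotient does not depend on the order of its two points, so either side of
  \<open>x\<close> yields an interval with end point \<open>x\<close>. The predicate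
  \<open>R\<close> covers the three uses: slope below \<open>u\<close>, above \<open>v\<close>, and
  large in absolute value.\<close>

lemma frequently_slope_interval:
  fixes f :: "real \<Rightarrow> real"
  assumes "\<exists>\<^sub>F y in at x. R ((f y - f x) / (y - x))" "d > 0"
  shows "\<exists>s t. s < t \<and> x \<in> {s..t} \<and> t - s < d \<and> R ((f t - f s) / (t - s))"
proof -
  obtain y where y: "y \<noteq> x" "\<bar>y - x\<bar> < d" "R ((f y - f x) / (y - x))"
    using assms unfolding frequently_def eventually_at dist_real_def by blast
  show ?thesis
  proof (cases "x < y")
    case True
    then show ?thesis using y by (intro exI[of _ x] exI[of _ y]) auto
  next
    case False
    have "(f y - f x) / (y - x) = (f x - f y) / (x - y)"
      by (metis minus_diff_eq minus_divide_divide)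
    then show ?thesis using y False by (intro exI[of _ y] exI[of _ x]) auto
  qed
qed

text \<open>Where no derivative exists, the difference quotients are either unbounded on every
  neighbourhood (\<open>S0\<close>) or oscillate across some rational gap
  (\<open>S\<close>).\<close>

lemma AC_real_differentiable_ae:
  fixes f :: "real \<Rightarrow> real"
  assumes f: "f \<in> AC a b" and "a < b"
  shows "negligible {x \<in> {a<..<b}. \<not> f differentiable at x}"
proof -
  define Q where "Q = (\<lambda>x y. (f y - f x) / (y - x))"
  define S0 where "S0 = {x \<in> {a<..<b}. \<forall>C. \<exists>\<^sub>F y in at x. \<bar>Q x y\<bar> > C}"
  \<comment> \<open>The conjunct \<open>u < v\<close> makes the set empty for all other pairs, so
    the union may run over the full product of the rationals.\<close>
  define S where "S = (\<lambda>(u, v). {x \<in> {a<..<b}. u < v \<and> (\<exists>\<^sub>F y in at x. Q x y < u) \<and> (\<exists>\<^sub>F y in at x. Q x y > v)})"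
  have "negligible S0"
  proof (rule AC_negligible_unbounded_slope[OF f \<open>a < b\<close>])
    fix C x d :: real assume "x \<in> S0" "d > 0"
    then obtain s t where "s < t" "x \<in> {s..t}" "t - s < d" "\<bar>(f t - f s) / (t - s)\<bar> > C"
      using frequently_slope_interval[of "\<lambda>q. \<bar>q\<bar> > C" f x d] by (auto simp: S0_def Q_def)
    then show "\<exists>s t. s < t \<and> x \<in> {s..t} \<and> t - s < d \<and> C * (t - s) < \<bar>f t - f s\<bar>"
      by (intro exI[of _ s] exI[of _ t]) (auto simp: abs_divide pos_less_divide_eq)
  qed (auto simp: S0_def)
  moreover have "negligible (S p)" for p
  proof (cases "fst p < snd p")
    case True
    obtain u v where p: "p = (u, v)" by (cases p)
    show ?thesis
    proof (rule AC_negligible_oscillation[OF f \<open>a < b\<close> True])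
      fix x d :: real assume x: "x \<in> S p" "d > 0"
      then obtain s t where "s < t" "x \<in> {s..t}" "t - s < d" "(f t - f s) / (t - s) < u"
        using frequently_slope_interval[of "\<lambda>q. q < u" f x d] by (auto simp: S_def Q_def p)
      then show "\<exists>s t. s < t \<and> x \<in> {s..t} \<and> t - s < d \<and> f t - f s < fst p * (t - s)"
        by (intro exI[of _ s] exI[of _ t]) (auto simp: p pos_divide_less_eq)
      obtain s t where "s < t" "x \<in> {s..t}" "t - s < d" "(f t - f s) / (t - s) > v"
        using frequently_slope_interval[of "\<lambda>q. q > v" f x d] x by (auto simp: S_def Q_def p)
      then show "\<exists>s t. s < t \<and> x \<in> {s..t} \<and> t - s < d \<and> snd p * (t - s) < f t - f s"
        by (intro exI[of _ s] exI[of _ t]) (auto simp: p pos_less_divide_eq)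
    qed (auto simp: S_def p)
  next
    case False
    then show ?thesis by (simp add: S_def case_prod_unfold)
  qed
  then have "negligible (\<Union>p\<in>\<rat> \<times> \<rat>. S p)"
    by (intro negligible_countable_Union) (auto simp: countable_rat)
  moreover have "{x \<in> {a<..<b}. \<not> f differentiable at x} \<subseteq> S0 \<union> (\<Union>p\<in>\<rat> \<times> \<rat>. S p)"
  proof
    fix x assume x: "x \<in> {x \<in> {a<..<b}. \<not> f differentiable at x}"
    show "x \<in> S0 \<union> (\<Union>p\<in>\<rat> \<times> \<rat>. S p)"
    proof (cases "x \<in> S0")
      case False
      then obtain C where "\<not> (\<exists>\<^sub>F y in at x. \<bar>Q x y\<bar> > C)" using x by (auto simp: S0_def)
      then have bd: "\<forall>\<^sub>F y in at x. \<bar>Q x y\<bar> \<le> C" by (simp add: frequently_def not_less)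
      have no: "\<not> (Q x \<longlongrightarrow> L) (at x)" for L
        using x by (auto simp: real_differentiable_def has_field_derivative_iff Q_def)
      obtain u v where uv: "u \<in> \<rat>" "v \<in> \<rat>" "u < v" "\<exists>\<^sub>F y in at x. Q x y < u" "\<exists>\<^sub>F y in at x. Q x y > v"
        by (rule real_limit_or_oscillates[OF _ bd no]) auto
      then have "x \<in> S (u, v)" using x by (simp add: S_def)
      then show ?thesis using uv by blast
    qed auto
  qed
  ultimately show ?thesis by (meson negligible_Un negligible_subset)
qed

section \<open>The fundamental theorem of calculus\<close>

lemma AC_differentiable_ae:
  fixes f :: "real \<Rightarrow> 'a::euclidean_space"
  assumes f: "f \<in> AC a b" and "a < b"
  shows "negligible {x \<in> {a<..<b}. \<not> f differentiable at x}"
proof -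
  have "negligible (\<Union>i\<in>Basis. {x \<in> {a<..<b}. \<not> (\<lambda>x. f x \<bullet> i) differentiable at x})"
  proof (intro negligible_Union_nat negligible_Union finite_imageI finite_Basis)
    fix T assume "T \<in> (\<lambda>i. {x \<in> {a<..<b}. \<not> (\<lambda>x. f x \<bullet> i) differentiable at x}) ` Basis"
    then obtain i :: 'a where "T = {x \<in> {a<..<b}. \<not> (\<lambda>x. f x \<bullet> i) differentiable at x}" by blast
    then show "negligible T"
      using AC_real_differentiable_ae[OF AC_bounded_linear[OF f bounded_linear_inner_left] \<open>a < b\<close>] by simp
  qed
  moreover have "{x \<in> {a<..<b}. \<not> f differentiable at x} \<subseteq>
      (\<Union>i\<in>Basis. {x \<in> {a<..<b}. \<not> (\<lambda>x. f x \<bullet> i) differentiable at x})"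
    by (auto simp: differentiable_componentwise_within[of f])
  ultimately show ?thesis by (rule negligible_subset)
qed

text \<open>Because \<open>x\<close> lies between \<open>s\<close> and \<open>t\<close>, the errors
  at the two ends add up to a multiple of \<open>(t - x) + (x - s) = t - s\<close>.\<close>

lemma has_vector_derivative_straddle:
  fixes f :: "real \<Rightarrow> 'a::real_normed_vector"
  assumes "(f has_vector_derivative D) (at x)" and "c > 0"
  obtains d where "d > 0"
    "\<And>s t. s \<le> x \<Longrightarrow> x \<le> t \<Longrightarrow> {s..t} \<subseteq> ball x d \<Longrightarrow> norm (f t - f s - (t - s) *\<^sub>R D) \<le> c * (t - s)"
proof -
  obtain d where d: "d > 0" "\<And>y. \<bar>y - x\<bar> < d \<Longrightarrow> norm (f y - f x - (y - x) *\<^sub>R D) \<le> c * \<bar>y - x\<bar>"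
    using assms unfolding has_vector_derivative_def has_derivative_at_alt by auto
  show ?thesis
  proof (rule that[OF d(1)])
    fix s t assume st: "s \<le> x" "x \<le> t" "{s..t} \<subseteq> ball x d"
    then have "s \<in> {s..t}" "t \<in> {s..t}" by auto
    with st(3) have "s \<in> ball x d" "t \<in> ball x d" by blast+
    then have "\<bar>s - x\<bar> < d" "\<bar>t - x\<bar> < d" by (auto simp: dist_real_def)
    then have "norm (f t - f x - (t - x) *\<^sub>R D) \<le> c * \<bar>t - x\<bar>" "norm (f s - f x - (s - x) *\<^sub>R D) \<le> c * \<bar>s - x\<bar>"
      by (auto intro: d(2))
    then have *: "norm (f t - f x - (t - x) *\<^sub>R D) + norm (f s - f x - (s - x) *\<^sub>R D) \<le> c * (t - s)"
      using st by (simp add: algebra_simps)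
    have "f t - f s - (t - s) *\<^sub>R D = (f t - f x - (t - x) *\<^sub>R D) - (f s - f x - (s - x) *\<^sub>R D)"
      by (simp add: algebra_simps)
    also have "norm \<dots> \<le> c * (t - s)"
      by (rule order_trans[OF norm_triangle_ineq4 *])
    finally show "norm (f t - f s - (t - s) *\<^sub>R D) \<le> c * (t - s)" .
  qed
qed

lemma AC_has_integral:
  fixes f :: "real \<Rightarrow> 'a::euclidean_space"
  assumes f: "f \<in> AC a b" and "a \<le> b"
  shows "((\<lambda>x. vector_derivative f (at x)) has_integral (f b - f a)) {a..b}"
proof (cases "a = b")
  case True
  then show ?thesis using has_integral_refl(2)[of "\<lambda>x. vector_derivative f (at x)" a] by simp
next
  case False
  with \<open>a \<le> b\<close> have "a < b" by simp
  \<comment> \<open>The end points are included because \<open>f\<close> is controlled only on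
    \<open>{a..b}\<close>, which gives no two-sided derivative there. The modified integrand
    \<open>F\<close> vanishes on \<open>N\<close>, so a cell tagged in \<open>N\<close> contributes
    just an increment of \<open>f\<close>.\<close>
  define N where "N = {a, b} \<union> {x \<in> {a<..<b}. \<not> f differentiable at x}"
  have N: "negligible N" unfolding N_def using AC_differentiable_ae[OF f \<open>a < b\<close>] by (simp add: negligible_Un_eq)
  define F where "F = (\<lambda>x. if x \<in> N then 0 else vector_derivative f (at x))"
  have "(F has_integral (f b - f a)) {a..b}"
    unfolding has_integral_real
  proof (intro allI impI)
    fix e :: real assume "e > 0"
    then have "e / 2 > 0" by simp
    obtain d where d: "d > 0" "\<forall>(J :: (real \<times> real set) set) s t. finite J \<longrightarrow> (\<forall>j\<in>J. a \<le> s j \<and> s j \<le> t j \<and> t j \<le> b) \<longrightarrow>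
       disjoint_family_on (\<lambda>j. {s j<..<t j}) J \<longrightarrow> (\<Sum>j\<in>J. t j - s j) < d \<longrightarrow>
       (\<Sum>j\<in>J. norm (f (t j) - f (s j))) < e / 2"
      using AC_family[OF f \<open>e / 2 > 0\<close>, where ?'i = "real \<times> real set"] by (elim exE conjE)
    have NL: "N \<in> lmeasurable" "measure lebesgue N = 0"
      using N by (auto simp: negligible_imp_measurable negligible_imp_measure0)
    obtain U where U: "open U" "N \<subseteq> U" "U - N \<in> lmeasurable" "emeasure lebesgue (U - N) < ennreal d"
      using sets_lebesgue_outer_open[OF fmeasurableD[OF NL(1)] d(1)] by blast
    have "N \<union> (U - N) = U" using U(2) by blast
    moreover have "measure lebesgue (U - N) < d"
      using U(3,4) d(1) by (simp add: emeasure_eq_measure2 ennreal_less_iff)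
    moreover have "measure lebesgue (N \<union> (U - N)) \<le> measure lebesgue N + measure lebesgue (U - N)"
      using NL(1) U(3) by (intro measure_Un_le fmeasurableD)
    moreover have "N \<union> (U - N) \<in> lmeasurable" using NL(1) U(3) by (rule fmeasurable.Un)
    ultimately have mU: "U \<in> lmeasurable" "measure lebesgue U < d" using NL(2) by simp_all
    define c where "c = e / 2 / (b - a)"
    have "c > 0" using \<open>e > 0\<close> \<open>a < b\<close> by (simp add: c_def)
    \<comment> \<open>The gauge: at points of \<open>N\<close> it keeps cells inside
      \<open>U\<close>, where their total length is below \<open>d\<close>; elsewhere it makes the
      straddle estimate valid with slope error \<open>c\<close>, which sums to \<open>e / 2\<close>
      over the interval.\<close>
    have "\<exists>r>0. if x \<in> N then ball x r \<subseteq> U else x \<in> {a..b} \<longrightarrow>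
        (\<forall>s t. s \<le> x \<longrightarrow> x \<le> t \<longrightarrow> {s..t} \<subseteq> ball x r \<longrightarrow> norm (f t - f s - (t - s) *\<^sub>R F x) \<le> c * (t - s))" for x
    proof (cases "x \<in> N \<or> x \<notin> {a..b}")
      case True
      show ?thesis
      proof (cases "x \<in> N")
        case True
        then have "x \<in> U" using U(2) by blast
        then obtain r where "r > 0" "ball x r \<subseteq> U" using openE[OF U(1)] by blast
        then show ?thesis using True by auto
      next
        case False
        then show ?thesis using True by (intro exI[of _ 1]) auto
      qed
    next
      case False
      then have "f differentiable at x" by (auto simp: N_def)
      then have "(f has_vector_derivative F x) (at x)"
        using False by (simp add: F_def vector_derivative_works)
      from has_vector_derivative_straddle[OF this \<open>c > 0\<close>] show ?thesis using False by metis
    qed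
    then obtain r where r: "\<And>x. r x > 0" "\<And>x. if x \<in> N then ball x (r x) \<subseteq> U else x \<in> {a..b} \<longrightarrow>
        (\<forall>s t. s \<le> x \<longrightarrow> x \<le> t \<longrightarrow> {s..t} \<subseteq> ball x (r x) \<longrightarrow> norm (f t - f s - (t - s) *\<^sub>R F x) \<le> c * (t - s))"
      by metis
    show "\<exists>\<gamma>. gauge \<gamma> \<and> (\<forall>\<D>. \<D> tagged_division_of {a..b} \<and> \<gamma> fine \<D> \<longrightarrow>
          norm ((\<Sum>(x,k)\<in>\<D>. measure lborel k *\<^sub>R F x) - (f b - f a)) < e)"
    proof (intro exI conjI allI impI; (elim conjE)?)
      show "gauge (\<lambda>x. ball x (r x))" using r(1) by (intro gaugeI) auto
      fix \<D> assume D: "\<D> tagged_division_of {a..b}" and fine: "(\<lambda>x. ball x (r x)) fine \<D>"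
      have fin: "finite \<D>" by (rule tagged_division_of_finite[OF D])
      have K: "k = {Inf k..Sup k}" "Inf k \<le> x" "x \<le> Sup k" "a \<le> Inf k" "Sup k \<le> b" "measure lborel k = Sup k - Inf k"
        "{Inf k..Sup k} \<subseteq> ball x (r x)" "x \<in> {a..b}" if xk: "(x, k) \<in> \<D>" for x k
      proof -
        obtain s t where k: "k = cbox s t" using tagged_division_ofD(4)[OF D xk] by blast
        have x: "x \<in> k" "k \<subseteq> {a..b}" using tagged_division_ofD(2,3)[OF D xk] by auto
        have "k \<subseteq> ball x (r x)" using fineD[OF fine xk] .
        with k x show "k = {Inf k..Sup k}" "Inf k \<le> x" "x \<le> Sup k" "a \<le> Inf k" "Sup k \<le> b" "measure lborel k = Sup k - Inf k"
          "{Inf k..Sup k} \<subseteq> ball x (r x)" "x \<in> {a..b}" by auto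
      qed
      define D1 D2 where "D1 = {p \<in> \<D>. fst p \<in> N}" and "D2 = {p \<in> \<D>. fst p \<notin> N}"
      have D12: "\<D> = D1 \<union> D2" "D1 \<inter> D2 = {}" "finite D1" "finite D2" using fin by (auto simp: D1_def D2_def)
      let ?E = "\<lambda>p. measure lborel (snd p) *\<^sub>R F (fst p) - (f (Sup (snd p)) - f (Inf (snd p)))"
      have "(\<Sum>p\<in>\<D>. f (Sup (snd p)) - f (Inf (snd p))) = f b - f a"
        using additive_tagged_division_1[OF \<open>a \<le> b\<close> D, of f] by (simp add: case_prod_unfold)
      then have "norm ((\<Sum>(x,k)\<in>\<D>. measure lborel k *\<^sub>R F x) - (f b - f a)) = norm (\<Sum>p\<in>\<D>. ?E p)"
        by (simp only: sum_subtractf case_prod_unfold)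
      also have "\<dots> \<le> (\<Sum>p\<in>\<D>. norm (?E p))" by (rule norm_sum)
      also have "\<dots> = (\<Sum>p\<in>D1. norm (?E p)) + (\<Sum>p\<in>D2. norm (?E p))"
        unfolding D12(1) by (rule sum.union_disjoint[OF D12(3,4,2)])
      also have "(\<Sum>p\<in>D1. norm (?E p)) < e / 2"
      proof -
        have "(\<Sum>p\<in>D1. norm (?E p)) = (\<Sum>p\<in>D1. norm (f (Sup (snd p)) - f (Inf (snd p))))"
          by (intro sum.cong) (auto simp: D1_def F_def norm_minus_commute)
        also have "\<dots> < e / 2"
        proof (intro d(2)[THEN spec, THEN spec, THEN spec, THEN mp, THEN mp, THEN mp, THEN mp] ballI D12(3))
          show "a \<le> Inf (snd p) \<and> Inf (snd p) \<le> Sup (snd p) \<and> Sup (snd p) \<le> b" if "p \<in> D1" for p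
            using K[of "fst p" "snd p"] that by (auto simp: D1_def)
          have int: "interior (snd p) = {Inf (snd p)<..<Sup (snd p)}" if "p \<in> D1" for p
            using K(1)[of "fst p" "snd p"] that by (metis D1_def interior_atLeastAtMost_real mem_Collect_eq prod.collapse)
          show disj: "disjoint_family_on (\<lambda>p. {Inf (snd p)<..<Sup (snd p)}) D1"
            unfolding disjoint_family_on_def
          proof (intro ballI impI)
            fix p q assume pq: "p \<in> D1" "q \<in> D1" "p \<noteq> q"
            then have "interior (snd p) \<inter> interior (snd q) = {}"
              using tagged_division_ofD(5)[OF D, of "fst p" "snd p" "fst q" "snd q"] by (simp add: D1_def)
            then show "{Inf (snd p)<..<Sup (snd p)} \<inter> {Inf (snd q)<..<Sup (snd q)} = {}"
              using int pq by simp
          qed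
          have "Inf (snd p) \<le> Sup (snd p) \<and> {Inf (snd p)<..<Sup (snd p)} \<subseteq> U" if "p \<in> D1" for p
          proof -
            have p: "(fst p, snd p) \<in> \<D>" "fst p \<in> N" using that by (auto simp: D1_def)
            then have "ball (fst p) (r (fst p)) \<subseteq> U" using r(2)[of "fst p"] by simp
            with K(7)[OF p(1)] have "{Inf (snd p)..Sup (snd p)} \<subseteq> U" by (rule order_trans)
            moreover have "{Inf (snd p)<..<Sup (snd p)} \<subseteq> {Inf (snd p)..Sup (snd p)}"
              by (rule greaterThanLessThan_subseteq_atLeastAtMost_iff[THEN iffD2]) simp
            ultimately have "{Inf (snd p)<..<Sup (snd p)} \<subseteq> U" by (rule order_trans[rotated])
            moreover have "Inf (snd p) \<le> Sup (snd p)" using K(2,3)[OF p(1)] by (rule order_trans)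
            ultimately show ?thesis by blast
          qed
          from sum_lengths_le[OF D12(3) this disj mU(1)] mU(2)
          show "(\<Sum>p\<in>D1. Sup (snd p) - Inf (snd p)) < d" by simp
        qed
        finally show ?thesis .
      qed
      also have "(\<Sum>p\<in>D2. norm (?E p)) \<le> e / 2"
      proof -
        have "(\<Sum>p\<in>D2. norm (?E p)) \<le> (\<Sum>p\<in>D2. c * measure lborel (snd p))"
        proof (rule sum_mono)
          fix p assume "p \<in> D2"
          then have p: "(fst p, snd p) \<in> \<D>" "fst p \<notin> N" by (auto simp: D2_def)
          note K = K[OF p(1)]
          have "norm (f (Sup (snd p)) - f (Inf (snd p)) - (Sup (snd p) - Inf (snd p)) *\<^sub>R F (fst p)) \<le> c * (Sup (snd p) - Inf (snd p))"
            using r(2)[of "fst p"] p(2) K(2,3,7,8) by simp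
          then show "norm (?E p) \<le> c * measure lborel (snd p)"
            unfolding K(6) by (simp add: norm_minus_commute)
        qed
        also have "\<dots> \<le> (\<Sum>p\<in>\<D>. c * measure lborel (snd p))"
          using fin \<open>c > 0\<close> by (intro sum_mono2) (auto simp: D2_def)
        also have "\<dots> = c * (\<Sum>(x,k)\<in>\<D>. measure lborel k)"
          by (simp add: sum_distrib_left case_prod_unfold)
        also have "(\<Sum>(x,k)\<in>\<D>. measure lborel k) = b - a"
          using additive_content_tagged_division[of \<D> a b] D \<open>a \<le> b\<close> by simp
        also have "c * (b - a) = e / 2"
          using \<open>a < b\<close> by (intro iffD1[OF nonzero_eq_divide_eq c_def]) simp
        finally show ?thesis .
      qed
      finally show "norm ((\<Sum>(x,k)\<in>\<D>. measure lborel k *\<^sub>R F x) - (f b - f a)) < e" by simp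
    qed
  qed
  then show ?thesis
    by (rule has_integral_spike[OF N, rotated]) (simp add: F_def)
qed

text \<open>The gauge integral of the derivative over any cell is the increment of \<open>f\<close>
  there. The sums of norms of these integrals are therefore bounded by the variation of
  \<open>f\<close>, which is the criterion for absolute integrability.\<close>

lemma AC_FTC:
  fixes f :: "real \<Rightarrow> 'a::euclidean_space"
  assumes f: "f \<in> AC a b" and "a \<le> b"
  shows "integrable (lebesgue_on {a<..<b}) (\<lambda>x. vector_derivative f (at x))"
    and "(LINT x|lebesgue_on {a<..<b}. vector_derivative f (at x)) = f b - f a"
proof -
  let ?D = "\<lambda>x. vector_derivative f (at x)"
  have int: "?D integrable_on {a..b}" "integral {a..b} ?D = f b - f a"
    using AC_has_integral[OF f \<open>a \<le> b\<close>] by (auto simp: has_integral_iff)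
  obtain B where B: "\<And>D S. D division_of S \<Longrightarrow> S \<subseteq> {a..b} \<Longrightarrow> (\<Sum>k\<in>D. norm (f (Sup k) - f (Inf k))) \<le> B"
    by (rule AC_bounded_variation[OF f \<open>a \<le> b\<close>]) blast
  have "?D absolutely_integrable_on cbox a b"
  proof (rule bounded_variation_absolutely_integrable_interval[of _ _ _ B])
    show "?D integrable_on cbox a b" using int by simp
    fix d assume d: "d division_of cbox a b"
    have "(\<Sum>K\<in>d. norm (integral K ?D)) = (\<Sum>K\<in>d. norm (f (Sup K) - f (Inf K)))"
    proof (rule sum.cong[OF refl])
      fix K assume "K \<in> d"
      note DI = division_real_interval[OF d this]
      have "f \<in> AC (Inf K) (Sup K)" using DI(3,4) by (intro AC_subinterval[OF f]) auto
      from AC_has_integral[OF this DI(1)] have "integral {Inf K..Sup K} ?D = f (Sup K) - f (Inf K)"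
        by (simp add: integral_unique)
      then show "norm (integral K ?D) = norm (f (Sup K) - f (Inf K))" using DI(2) by simp
    qed
    also have "\<dots> \<le> B" by (rule B[OF d]) simp
    finally show "(\<Sum>K\<in>d. norm (integral K ?D)) \<le> B" .
  qed
  then have "set_integrable lebesgue {a<..<b} ?D"
    by (rule set_integrable_subset) auto
  then show I: "integrable (lebesgue_on {a<..<b}) ?D"
    by (simp add: set_integrable_def integrable_restrict_space)
  have "integral\<^sup>L (lebesgue_on {a<..<b}) ?D = integral {a<..<b} ?D"
    by (rule lebesgue_integral_eq_integral[OF I]) auto
  then show "(LINT x|lebesgue_on {a<..<b}. ?D x) = f b - f a"
    using int(2) integral_open_interval_real[of a b ?D] by simp
qed

section \<open>Derivatives known almost everywhere\<close>

lemma AC_AE_has_vector_derivative: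
  fixes f :: "real \<Rightarrow> 'a::euclidean_space"
  assumes f: "f \<in> AC a b" and "a < b"
  shows "AE x in lebesgue_on {a<..<b}. (f has_vector_derivative vector_derivative f (at x)) (at x)"
proof -
  have "{x \<in> {a<..<b}. \<not> f differentiable at x} \<in> null_sets lebesgue"
    using AC_differentiable_ae[OF f \<open>a < b\<close>] by (simp add: negligible_iff_null_sets)
  then have "AE x in lebesgue. x \<notin> {x \<in> {a<..<b}. \<not> f differentiable at x}"
    by (rule AE_not_in)
  then have "AE x in lebesgue. x \<in> {a<..<b} \<longrightarrow> (f has_vector_derivative vector_derivative f (at x)) (at x)"
    by eventually_elim (auto simp: vector_derivative_works)
  then show ?thesis by (subst AE_restrict_space_iff) auto
qed

text \<open>Here \<open>F1\<close> is an explicit formula, typically from the product rule, that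
  agrees with the derivative only almost everywhere.\<close>

lemma AC_integral:
  fixes F :: "real \<Rightarrow> 'a::euclidean_space"
  assumes F: "F \<in> AC a b" and "a < b" and F1: "F1 \<in> borel_measurable (lebesgue_on {a<..<b})"
    and D: "AE x in lebesgue_on {a<..<b}. (F has_vector_derivative F1 x) (at x)"
  shows "integrable (lebesgue_on {a<..<b}) F1"
    and "(LINT x|lebesgue_on {a<..<b}. F1 x) = F b - F a"
proof -
  note FTC = AC_FTC[OF F less_imp_le[OF \<open>a < b\<close>]]
  have eq: "AE x in lebesgue_on {a<..<b}. vector_derivative F (at x) = F1 x"
    using D by eventually_elim (rule vector_derivative_at)
  show "integrable (lebesgue_on {a<..<b}) F1"
    using FTC(1) integrable_cong_AE[OF borel_measurable_integrable[OF FTC(1)] F1 eq] by simp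
  show "(LINT x|lebesgue_on {a<..<b}. F1 x) = F b - F a"
    using FTC(2) integral_cong_AE[OF borel_measurable_integrable[OF FTC(1)] F1 eq] by simp
qed

text \<open>The bound is taken over all of \<open>(a,b)\<close> so that it does not depend on
  \<open>s\<close> and \<open>t\<close> and controls the oscillation of \<open>F\<close>.\<close>

lemma AC_increment_le:
  fixes F :: "real \<Rightarrow> 'a::euclidean_space"
  assumes F: "F \<in> AC a b" and "a < b" and F1: "F1 \<in> borel_measurable (lebesgue_on {a<..<b})"
    and D: "AE x in lebesgue_on {a<..<b}. (F has_vector_derivative F1 x) (at x)"
    and st: "a \<le> s" "s \<le> t" "t \<le> b"
  shows "norm (F t - F s) \<le> (LINT x|lebesgue_on {a<..<b}. norm (F1 x))"
proof -
  let ?D = "\<lambda>x. vector_derivative F (at x)"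
  note FTC = AC_FTC[OF F less_imp_le[OF \<open>a < b\<close>]]
  have eq: "AE x in lebesgue_on {a<..<b}. norm (?D x) = norm (F1 x)"
    using D by eventually_elim (simp add: vector_derivative_at)
  note FTC' = AC_FTC[OF AC_subinterval[OF F st(1,3)] st(2)]
  have n: "integrable (lebesgue_on {a<..<b}) (\<lambda>x. norm (?D x))" by (rule integrable_norm[OF FTC(1)])
  have n': "integrable (lebesgue_on {s<..<t}) (\<lambda>x. norm (?D x))" by (rule integrable_norm[OF FTC'(1)])
  have "norm (F t - F s) \<le> (LINT x|lebesgue_on {s<..<t}. norm (?D x))"
    unfolding FTC'(2)[symmetric] by (rule integral_norm_bound)
  also have "\<dots> = integral {s<..<t} (\<lambda>x. norm (?D x))"
    by (rule lebesgue_integral_eq_integral[OF n']) auto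
  also have "\<dots> \<le> integral {a<..<b} (\<lambda>x. norm (?D x))"
  proof (rule integral_subset_le)
    show "{s<..<t} \<subseteq> {a<..<b}" using st by auto
    show "(\<lambda>x. norm (?D x)) integrable_on {s<..<t}" "(\<lambda>x. norm (?D x)) integrable_on {a<..<b}"
      using n n' by (auto intro!: integrable_on_lebesgue_on)
  qed auto
  also have "\<dots> = (LINT x|lebesgue_on {a<..<b}. norm (?D x))"
    by (rule lebesgue_integral_eq_integral[OF n, symmetric]) auto
  also have "\<dots> = (LINT x|lebesgue_on {a<..<b}. norm (F1 x))"
    using borel_measurable_integrable[OF n] F1 eq by (intro integral_cong_AE) auto
  finally show ?thesis .
qed

lemma AC_measurable:
  assumes "f \<in> AC a b"
  shows "f \<in> borel_measurable (lebesgue_on {a<..<b})"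
  by (rule continuous_imp_measurable_on_sets_lebesgue)
    (auto intro: continuous_on_subset[OF AC_continuous_on[OF assms]])

section \<open>Integral estimates\<close>

lemma integrable_mult_bounded:
  fixes u v :: "'a \<Rightarrow> real"
  assumes u: "integrable M u" and v: "v \<in> borel_measurable M" and C: "\<And>x. x \<in> space M \<Longrightarrow> \<bar>v x\<bar> \<le> C"
  shows "integrable M (\<lambda>x. u x * v x)"
proof (rule Bochner_Integration.integrable_bound)
  show "integrable M (\<lambda>x. C * u x)" using u by simp
  show "(\<lambda>x. u x * v x) \<in> borel_measurable M" using u v by measurable
  show "AE x in M. norm (u x * v x) \<le> norm (C * u x)"
  proof (rule AE_I2)
    fix x assume "x \<in> space M"
    then have "\<bar>v x\<bar> \<le> \<bar>C\<bar>" using C[of x] by linarith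
    then have "\<bar>v x\<bar> * \<bar>u x\<bar> \<le> \<bar>C\<bar> * \<bar>u x\<bar>" by (rule mult_right_mono) simp
    then show "norm (u x * v x) \<le> norm (C * u x)" by (simp add: abs_mult mult.commute)
  qed
qed

lemma integral_Cauchy_Schwarz:
  fixes u v :: "'a \<Rightarrow> real"
  assumes [measurable]: "u \<in> borel_measurable M" "v \<in> borel_measurable M"
    and u: "integrable M (\<lambda>x. (u x)\<^sup>2)" and v: "integrable M (\<lambda>x. (v x)\<^sup>2)"
  shows "integrable M (\<lambda>x. u x * v x)"
    and "(LINT x|M. \<bar>u x * v x\<bar>) \<le> sqrt (LINT x|M. (u x)\<^sup>2) * sqrt (LINT x|M. (v x)\<^sup>2)"
proof -
  show I: "integrable M (\<lambda>x. u x * v x)"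
  proof (rule Bochner_Integration.integrable_bound[OF Bochner_Integration.integrable_add[OF u v]])
    show "AE x in M. norm (u x * v x) \<le> norm ((u x)\<^sup>2 + (v x)\<^sup>2)"
    proof (rule AE_I2)
      fix x
      have "2 * \<bar>u x\<bar> * \<bar>v x\<bar> \<le> (u x)\<^sup>2 + (v x)\<^sup>2"
        using sum_squares_bound[of "\<bar>u x\<bar>" "\<bar>v x\<bar>"] by simp
      moreover have "0 \<le> \<bar>u x\<bar> * \<bar>v x\<bar>" by simp
      ultimately have "\<bar>u x\<bar> * \<bar>v x\<bar> \<le> (u x)\<^sup>2 + (v x)\<^sup>2" by linarith
      then show "norm (u x * v x) \<le> norm ((u x)\<^sup>2 + (v x)\<^sup>2)" by (simp add: abs_mult)
    qed
  qed measurable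
  have I': "integrable M (\<lambda>x. \<bar>u x * v x\<bar>)" using integrable_norm[OF I] by simp
  define U V T where "U = (LINT x|M. (u x)\<^sup>2)" and "V = (LINT x|M. (v x)\<^sup>2)" and "T = (LINT x|M. \<bar>u x * v x\<bar>)"
  have nn: "U \<ge> 0" "V \<ge> 0" "T \<ge> 0" by (simp_all add: U_def V_def T_def)
  have "(\<integral>\<^sup>+x. ennreal \<bar>u x\<bar> * ennreal \<bar>v x\<bar> \<partial>M)\<^sup>2 \<le> (\<integral>\<^sup>+x. (ennreal \<bar>u x\<bar>)\<^sup>2 \<partial>M) * (\<integral>\<^sup>+x. (ennreal \<bar>v x\<bar>)\<^sup>2 \<partial>M)"
    by (rule Cauchy_Schwarz_nn_integral) measurable
  also have "(\<integral>\<^sup>+x. ennreal \<bar>u x\<bar> * ennreal \<bar>v x\<bar> \<partial>M) = ennreal T"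
    unfolding T_def by (subst nn_integral_eq_integral[OF I', symmetric]) (auto simp: abs_mult ennreal_mult)
  also have "(\<integral>\<^sup>+x. (ennreal \<bar>u x\<bar>)\<^sup>2 \<partial>M) = ennreal U"
    unfolding U_def by (subst nn_integral_eq_integral[OF u, symmetric]) (auto simp: ennreal_power)
  also have "(\<integral>\<^sup>+x. (ennreal \<bar>v x\<bar>)\<^sup>2 \<partial>M) = ennreal V"
    unfolding V_def by (subst nn_integral_eq_integral[OF v, symmetric]) (auto simp: ennreal_power)
  finally have "ennreal (T\<^sup>2) \<le> ennreal (U * V)" using nn by (simp add: ennreal_power ennreal_mult)
  then have "T\<^sup>2 \<le> U * V" using nn by (simp add: ennreal_le_iff)
  then have "T \<le> sqrt (U * V)" by (rule real_le_rsqrt)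
  then show "T \<le> sqrt U * sqrt V" by (simp add: real_sqrt_mult)
qed

section \<open>The boundary form\<close>

text \<open>The share of one end point in \<open>bc_constant\<close>; it reduces the four separated
  cases to a single estimate per end point.\<close>

fun endpoint_constant :: "endpoint_param \<Rightarrow> real" where
  "endpoint_constant (Finite l) = \<bar>l\<bar>"
| "endpoint_constant Infinite = 0"

lemma endpoint_form:
  assumes "endpoint_condition l u v" "cmod u \<le> K"
  shows "Im (v * cnj u) = 0" "\<bar>Re (v * cnj u)\<bar> \<le> endpoint_constant l * K\<^sup>2"
proof -
  have "(cmod u)\<^sup>2 \<le> K\<^sup>2" using assms(2) by (intro power_mono) auto
  have "v * cnj u = of_real (l' * (cmod u)\<^sup>2)" if "l = Finite l'" for l'
    using assms(1) that by (simp add: complex_norm_square[symmetric] mult.assoc del: of_real_power)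
  with assms(1) show "Im (v * cnj u) = 0" by (cases l) auto
  have "\<bar>Re (v * cnj u)\<bar> = endpoint_constant l * (cmod u)\<^sup>2"
  proof (cases l)
    case (Finite l')
    then have "v * cnj u = of_real (l' * (cmod u)\<^sup>2)"
      using assms(1) by (simp add: complex_norm_square[symmetric] mult.assoc del: of_real_power)
    then show ?thesis using Finite by (simp only: Re_complex_of_real abs_mult) simp
  qed (use assms(1) in auto)
  also have "\<dots> \<le> endpoint_constant l * K\<^sup>2"
  proof (rule mult_left_mono[OF \<open>(cmod u)\<^sup>2 \<le> K\<^sup>2\<close>])
    show "0 \<le> endpoint_constant l" by (cases l) auto
  qed
  finally show "\<bar>Re (v * cnj u)\<bar> \<le> endpoint_constant l * K\<^sup>2" .
qed

lemma bc_constant_Separated: "bc_constant (Separated l r) = endpoint_constant l + endpoint_constant r"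
  by (cases l; cases r) auto

text \<open>A real matrix of determinant 1 preserves the imaginary part of \<open>v * cnj u\<close>.
  For \<open>r12 \<noteq> 0\<close> the boundary condition determines the quasi-derivatives from the
  values: \<open>r12 v = U - r11 u\<close> and \<open>r12 V = r22 U - u\<close>. The form times
  \<open>r12\<close> is then quadratic in \<open>u\<close> and \<open>U\<close>, with coefficients
  \<open>r22\<close>, \<open>r11\<close> and two mixed terms, which explains the constant. For
  \<open>r12 = 0\<close> one has \<open>r11 r22 = 1\<close>, and the terms with \<open>v\<close>
  cancel.\<close>

lemma coupled_form:
  fixes u v U V :: complex and r11 r12 r21 r22 :: real
  assumes U: "U = of_real r11 * u + of_real r12 * v" and V: "V = of_real r21 * u + of_real r22 * v"
    and det: "r11 * r22 - r12 * r21 = 1" and K: "cmod u \<le> K" "cmod U \<le> K"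
  shows "Im (V * cnj U - v * cnj u) = 0"
    and "\<bar>Re (V * cnj U - v * cnj u)\<bar> \<le>
      (if r12 \<noteq> 0 then (\<bar>r11\<bar> + \<bar>r22\<bar> + 2) / \<bar>r12\<bar> else \<bar>r11 * r21\<bar>) * K\<^sup>2"
proof -
  have "Im (V * cnj U - v * cnj u) = (r11 * r22 - r12 * r21 - 1) * (Im v * Re u - Re v * Im u)"
    by (simp add: U V algebra_simps)
  with det show "Im (V * cnj U - v * cnj u) = 0" by simp
  have u2: "(cmod u)\<^sup>2 \<le> K\<^sup>2" "(cmod U)\<^sup>2 \<le> K\<^sup>2" using K by (auto intro: power_mono)
  have K0: "K \<ge> 0" using K(1) norm_ge_zero[of u] by linarith
  show "\<bar>Re (V * cnj U - v * cnj u)\<bar> \<le>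
      (if r12 \<noteq> 0 then (\<bar>r11\<bar> + \<bar>r22\<bar> + 2) / \<bar>r12\<bar> else \<bar>r11 * r21\<bar>) * K\<^sup>2"
  proof (cases "r12 = 0")
    case True
    then have "r22 * r11 = 1" using det by (simp add: mult.commute)
    have "V * cnj U - v * cnj u = of_real (r11 * r21) * (u * cnj u) + of_real (r22 * r11 - 1) * (v * cnj u)"
      using True by (simp add: U V algebra_simps)
    also have "\<dots> = of_real (r11 * r21 * (cmod u)\<^sup>2)"
      unfolding \<open>r22 * r11 = 1\<close> of_real_mult[of "r11 * r21" "(cmod u)\<^sup>2"] complex_norm_square by simp
    finally have "\<bar>Re (V * cnj U - v * cnj u)\<bar> = \<bar>r11 * r21\<bar> * (cmod u)\<^sup>2"
      by (simp only: Re_complex_of_real abs_mult) simp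
    also have "\<dots> \<le> \<bar>r11 * r21\<bar> * K\<^sup>2" using u2(1) by (intro mult_left_mono) auto
    finally show ?thesis using True by simp
  next
    case False
    have v: "of_real r12 * v = U - of_real r11 * u" by (simp add: U)
    have "of_real r12 * V = of_real r21 * (of_real r12 * u) + of_real r22 * (of_real r12 * v)"
      by (simp add: V algebra_simps)
    also have "\<dots> = of_real r22 * U - of_real (r11 * r22 - r12 * r21) * u"
      unfolding v by (simp add: algebra_simps)
    finally have V': "of_real r12 * V = of_real r22 * U - u" using det by simp
    have "of_real r12 * (V * cnj U - v * cnj u) = (of_real r12 * V) * cnj U - (of_real r12 * v) * cnj u"
      by (simp add: algebra_simps)
    also have "\<dots> = of_real r22 * (U * cnj U) + of_real r11 * (u * cnj u) - u * cnj U - U * cnj u"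
      unfolding v V' by (simp add: algebra_simps)
    finally have eq: "of_real r12 * (V * cnj U - v * cnj u) =
        of_real r22 * (U * cnj U) + of_real r11 * (u * cnj u) - u * cnj U - U * cnj u" .
    have "cmod (of_real r12 * (V * cnj U - v * cnj u)) \<le>
        cmod (of_real r22 * (U * cnj U)) + cmod (of_real r11 * (u * cnj u)) + cmod (u * cnj U) + cmod (U * cnj u)"
      unfolding eq
      using norm_triangle_ineq4[of "of_real r22 * (U * cnj U) + of_real r11 * (u * cnj u) - u * cnj U" "U * cnj u"]
        norm_triangle_ineq4[of "of_real r22 * (U * cnj U) + of_real r11 * (u * cnj u)" "u * cnj U"]
        norm_triangle_ineq[of "of_real r22 * (U * cnj U)" "of_real r11 * (u * cnj u)"] by linarith
    also have "\<dots> = \<bar>r22\<bar> * (cmod U)\<^sup>2 + \<bar>r11\<bar> * (cmod u)\<^sup>2 + 2 * (cmod u * cmod U)"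
      by (simp add: norm_mult power2_eq_square)
    also have "\<dots> \<le> \<bar>r22\<bar> * K\<^sup>2 + \<bar>r11\<bar> * K\<^sup>2 + 2 * (K * K)"
      using u2 K K0 by (intro add_mono mult_left_mono mult_mono) auto
    also have "\<dots> = (\<bar>r11\<bar> + \<bar>r22\<bar> + 2) * K\<^sup>2"
      by (simp add: power2_eq_square algebra_simps)
    finally have "\<bar>r12\<bar> * cmod (V * cnj U - v * cnj u) \<le> (\<bar>r11\<bar> + \<bar>r22\<bar> + 2) * K\<^sup>2"
      unfolding norm_mult[of "of_real r12"] norm_of_real .
    then have "cmod (V * cnj U - v * cnj u) \<le> (\<bar>r11\<bar> + \<bar>r22\<bar> + 2) * K\<^sup>2 / \<bar>r12\<bar>"
      using False by (simp add: pos_le_divide_eq mult.commute)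
    with abs_Re_le_cmod[of "V * cnj U - v * cnj u"] have
      "\<bar>Re (V * cnj U - v * cnj u)\<bar> \<le> (\<bar>r11\<bar> + \<bar>r22\<bar> + 2) * K\<^sup>2 / \<bar>r12\<bar>" by linarith
    then show ?thesis using False by simp
  qed
qed

lemma boundary_form:
  assumes B: "admissible B" and bc: "satisfies_bc a b B f h"
    and K: "cmod (f a) \<le> K" "cmod (f b) \<le> K"
  shows "Im (h b * cnj (f b) - h a * cnj (f a)) = 0"
    and "\<bar>Re (h b * cnj (f b) - h a * cnj (f a))\<bar> \<le> bc_constant B * K\<^sup>2"
proof -
  have "Im (h b * cnj (f b) - h a * cnj (f a)) = 0 \<and>
    \<bar>Re (h b * cnj (f b) - h a * cnj (f a))\<bar> \<le> bc_constant B * K\<^sup>2"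
  proof (cases B)
    case (Separated l r)
    then have l: "endpoint_condition l (f a) (h a)" and r: "endpoint_condition r (f b) (h b)"
      using bc by auto
    show ?thesis
      using endpoint_form[OF l K(1)] endpoint_form[OF r K(2)]
      unfolding Separated bc_constant_Separated distrib_right minus_complex.sel by linarith
  next
    case (Coupled \<phi> R)
    have eq: "(vector [f b, h b] :: complex ^ 2) = cis \<phi> *s ((\<chi> i j. of_real (R $ i $ j)) *v vector [f a, h a])"
      using bc Coupled by simp
    \<comment> \<open>Removing the common phase from both boundary values at \<open>b\<close>
      changes neither \<open>h b * cnj (f b)\<close> nor the modulus of \<open>f b\<close>.\<close>
    define U V where "U = cnj (cis \<phi>) * f b" and "V = cnj (cis \<phi>) * h b"
    have fb: "f b = cis \<phi> * (of_real (R $ 1 $ 1) * f a + of_real (R $ 1 $ 2) * h a)"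
      using arg_cong[OF eq, of "\<lambda>x. x $ 1"] by (simp add: matrix_vector_mult_def sum_2)
    have hb: "h b = cis \<phi> * (of_real (R $ 2 $ 1) * f a + of_real (R $ 2 $ 2) * h a)"
      using arg_cong[OF eq, of "\<lambda>x. x $ 2"] by (simp add: matrix_vector_mult_def sum_2)
    have c: "cnj (cis \<phi>) * cis \<phi> = 1" "cis \<phi> * cnj (cis \<phi>) = 1" by (simp_all add: cis_cnj cis_mult)
    have U: "U = of_real (R $ 1 $ 1) * f a + of_real (R $ 1 $ 2) * h a"
      unfolding U_def fb mult.assoc[symmetric] c by simp
    have V: "V = of_real (R $ 2 $ 1) * f a + of_real (R $ 2 $ 2) * h a"
      unfolding V_def hb mult.assoc[symmetric] c by simp
    have det: "R $ 1 $ 1 * R $ 2 $ 2 - R $ 1 $ 2 * R $ 2 $ 1 = 1"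
      using B Coupled by (simp add: det_2)
    have "cmod U \<le> K" using K(2) by (simp add: U_def norm_mult)
    from coupled_form[OF U V det K(1) this] have
      "Im (V * cnj U - h a * cnj (f a)) = 0 \<and> \<bar>Re (V * cnj U - h a * cnj (f a))\<bar> \<le> bc_constant B * K\<^sup>2"
      by (simp add: Coupled)
    moreover have "V * cnj U = h b * cnj (f b) * (cnj (cis \<phi>) * cis \<phi>)"
      unfolding U_def V_def by (simp only: complex_cnj_mult complex_cnj_cnj ac_simps)
    ultimately show ?thesis unfolding c by simp
  qed
  then show "Im (h b * cnj (f b) - h a * cnj (f a)) = 0"
    "\<bar>Re (h b * cnj (f b) - h a * cnj (f a))\<bar> \<le> bc_constant B * K\<^sup>2" by auto
qed

section \<open>Nonreal eigenvalues\<close>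

text \<open>
  \<open>r\<close> stands for \<open>1 / p\<close>, changed on a null set so that it is nonnegative everywhere, and \<open>h\<close> for the
  quasi-derivative \<open>p f'\<close>.
\<close>

locale indefinite_SL_solution =
  fixes a b K :: real and r q w :: "real \<Rightarrow> real" and z :: complex and f h :: "real \<Rightarrow> complex" and c :: real
  assumes ab: "a < b"
    and r: "integrable (lebesgue_on {a<..<b}) r" "\<And>x. r x \<ge> 0"
    and q: "integrable (lebesgue_on {a<..<b}) q"
    and w: "integrable (lebesgue_on {a<..<b}) w"
    and f: "f \<in> AC a b" and h: "h \<in> AC a b"
    and f': "AE x in lebesgue_on {a<..<b}. (f has_vector_derivative of_real (r x) * h x) (at x)"
    and h': "AE x in lebesgue_on {a<..<b}. (h has_vector_derivative of_real (q x) * f x - z * of_real (w x) * f x) (at x)"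
    and Im_z: "Im z \<noteq> 0"
    and K: "\<And>x. x \<in> {a..b} \<Longrightarrow> cmod (f x) \<le> K" "K > 0" "\<exists>x\<in>{a..b}. cmod (f x) = K"
    and bc: "Im (h b * cnj (f b) - h a * cnj (f a)) = 0"
      "\<bar>Re (h b * cnj (f b) - h a * cnj (f a))\<bar> \<le> c * K\<^sup>2"
begin

abbreviation "M \<equiv> lebesgue_on {a<..<b}"

text \<open>With \<open>r = 1 / p\<close> and \<open>h = p f'\<close> this is the energy
  \<open>\<integral> p \<bar>f'\<bar>\<^sup>2\<close>, written without a derivative or a division;
  \<open>N\<close> is \<open>\<integral> \<bar>f\<bar>\<^sup>2 / p\<close>.\<close>

definition "P = (LINT x|M. r x * (cmod (h x))\<^sup>2)"
definition "N = (LINT x|M. r x * (cmod (f x))\<^sup>2)"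
definition "\<alpha> = c + (LINT x|M. \<bar>min 0 (q x)\<bar>)"

lemma measurable_coefficients [measurable]:
  "r \<in> borel_measurable M" "q \<in> borel_measurable M" "w \<in> borel_measurable M"
  "f \<in> borel_measurable M" "h \<in> borel_measurable M"
  "(\<lambda>x. cnj (f x)) \<in> borel_measurable M" "(\<lambda>x. cnj (h x)) \<in> borel_measurable M"
  by (fact borel_measurable_integrable[OF r(1)] borel_measurable_integrable[OF q] borel_measurable_integrable[OF w]
    AC_measurable[OF f] AC_measurable[OF h]
    AC_measurable[OF AC_bounded_linear[OF f bounded_linear_cnj]] AC_measurable[OF AC_bounded_linear[OF h bounded_linear_cnj]])+

lemma f_sq_le: "x \<in> {a..b} \<Longrightarrow> (cmod (f x))\<^sup>2 \<le> K\<^sup>2"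
  using K(1) by (intro power_mono) auto

lemma integrable_mult_f_sq:
  assumes "integrable M u"
  shows "integrable M (\<lambda>x. u x * (cmod (f x))\<^sup>2)"
  by (rule integrable_mult_bounded[OF assms, of _ "K\<^sup>2"]) (use f_sq_le in auto)

lemma integral_mult_f_sq_le:
  assumes u: "integrable M u" and nn: "\<And>x. u x \<ge> 0"
  shows "(LINT x|M. u x * (cmod (f x))\<^sup>2) \<le> (LINT x|M. u x) * K\<^sup>2"
proof -
  have "(LINT x|M. u x * (cmod (f x))\<^sup>2) \<le> (LINT x|M. u x * K\<^sup>2)"
    using u nn f_sq_le by (intro integral_mono integrable_mult_f_sq u) (auto intro!: mult_left_mono)
  then show ?thesis by simp
qed

lemma integrable_r_h_sq: "integrable M (\<lambda>x. r x * (cmod (h x))\<^sup>2)"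
proof -
  obtain L where "L \<ge> 0" "\<And>x. x \<in> {a..b} \<Longrightarrow> cmod (h x) \<le> L" using AC_bounded[OF h] by blast
  then show ?thesis
    by (intro integrable_mult_bounded[OF r(1), of _ "L\<^sup>2"]) (auto intro!: power_mono)
qed

lemma P_nonneg: "P \<ge> 0" and N_nonneg: "N \<ge> 0"
  unfolding P_def N_def using r(2) by (auto intro!: integral_nonneg_AE)

section \<open>The energy identity and the size of the eigenfunction\<close>

lemma energy_identity:
  "of_real (P + (LINT x|M. q x * (cmod (f x))\<^sup>2)) - z * of_real (LINT x|M. w x * (cmod (f x))\<^sup>2)
    = h b * cnj (f b) - h a * cnj (f a)"
proof -
  let ?A = "\<lambda>x. r x * (cmod (h x))\<^sup>2 + q x * (cmod (f x))\<^sup>2" and ?W = "\<lambda>x. w x * (cmod (f x))\<^sup>2"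
  let ?D = "\<lambda>x. complex_of_real (?A x) - z * complex_of_real (?W x)"
  have D: "AE x in M. ((\<lambda>x. h x * cnj (f x)) has_vector_derivative ?D x) (at x)"
    using f' h'
  proof eventually_elim
    case (elim x)
    have "((\<lambda>x. h x * cnj (f x)) has_vector_derivative
        (h x * cnj (of_real (r x) * h x) + (of_real (q x) * f x - z * of_real (w x) * f x) * cnj (f x))) (at x)"
      by (rule has_vector_derivative_mult[OF elim(2) bounded_linear.has_vector_derivative[OF bounded_linear_cnj elim(1)]])
    also have "h x * cnj (of_real (r x) * h x) + (of_real (q x) * f x - z * of_real (w x) * f x) * cnj (f x) = ?D x"
      unfolding of_real_add of_real_mult complex_norm_square by (simp add: algebra_simps)
    finally show ?case .
  qed
  have A: "integrable M ?A" using integrable_r_h_sq integrable_mult_f_sq[OF q] by (rule Bochner_Integration.integrable_add)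
  have W: "integrable M ?W" by (rule integrable_mult_f_sq[OF w])
  have "h b * cnj (f b) - h a * cnj (f a) = (LINT x|M. ?D x)"
    by (rule AC_integral(2)[OF AC_mult[OF h AC_bounded_linear[OF f bounded_linear_cnj]] ab _ D, symmetric]) measurable
  also have "\<dots> = (LINT x|M. complex_of_real (?A x)) - (LINT x|M. z * complex_of_real (?W x))"
    using A W by (intro Bochner_Integration.integral_diff integrable_of_real integrable_mult_right) auto
  also have "(LINT x|M. complex_of_real (?A x)) = of_real (LINT x|M. ?A x)"
    by (rule integral_complex_of_real)
  also have "(LINT x|M. z * complex_of_real (?W x)) = z * of_real (LINT x|M. ?W x)"
    by (simp only: integral_mult_right_zero integral_complex_of_real)
  also have "(LINT x|M. ?A x) = P + (LINT x|M. q x * (cmod (f x))\<^sup>2)"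
    unfolding P_def by (rule Bochner_Integration.integral_add[OF integrable_r_h_sq integrable_mult_f_sq[OF q]])
  finally show ?thesis by (rule sym)
qed

text \<open>In the imaginary part of the energy identity only \<open>Im z\<close> times this
  integral survives, because the boundary term is real.\<close>

lemma w_orthogonal: "(LINT x|M. w x * (cmod (f x))\<^sup>2) = 0"
proof -
  have "Im (h b * cnj (f b) - h a * cnj (f a)) = - (Im z * (LINT x|M. w x * (cmod (f x))\<^sup>2))"
    unfolding energy_identity[symmetric] by simp
  then show ?thesis using bc(1) Im_z by simp
qed

text \<open>After \<open>w_orthogonal\<close> the energy identity no longer contains
  \<open>z\<close>, and only the negative part of \<open>q\<close> can make \<open>P\<close> larger
  than the boundary term.\<close>

lemma P_le: "P \<le> \<alpha> * K\<^sup>2"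
proof -
  have "P + (LINT x|M. q x * (cmod (f x))\<^sup>2) = Re (h b * cnj (f b) - h a * cnj (f a))"
    unfolding energy_identity[symmetric] w_orthogonal by simp
  then have 1: "P \<le> c * K\<^sup>2 + - (LINT x|M. q x * (cmod (f x))\<^sup>2)" using bc(2) by linarith
  have q_: "integrable M (\<lambda>x. \<bar>min 0 (q x)\<bar>)" using q by simp
  have "- (LINT x|M. q x * (cmod (f x))\<^sup>2) = (LINT x|M. - (q x * (cmod (f x))\<^sup>2))" by simp
  also have "\<dots> \<le> (LINT x|M. \<bar>min 0 (q x)\<bar> * (cmod (f x))\<^sup>2)"
  proof (rule integral_mono)
    show "integrable M (\<lambda>x. - (q x * (cmod (f x))\<^sup>2))" using integrable_mult_f_sq[OF q] by simp
    fix x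
    have "- q x \<le> \<bar>min 0 (q x)\<bar>" by simp
    from mult_right_mono[OF this, of "(cmod (f x))\<^sup>2"]
    show "- (q x * (cmod (f x))\<^sup>2) \<le> \<bar>min 0 (q x)\<bar> * (cmod (f x))\<^sup>2" by simp
  qed (rule integrable_mult_f_sq[OF q_])
  also have "\<dots> \<le> (LINT x|M. \<bar>min 0 (q x)\<bar>) * K\<^sup>2" by (rule integral_mult_f_sq_le[OF q_]) simp
  finally show ?thesis unfolding \<alpha>_def distrib_right using 1 by linarith
qed

text \<open>The derivative of \<open>\<bar>f\<bar>\<^sup>2\<close> is
  \<open>2 r Re (h cnj f)\<close>, to which Cauchy-Schwarz applies.\<close>

lemma f_sq_oscillation:
  assumes "x \<in> {a..b}" "y \<in> {a..b}"
  shows "\<bar>(cmod (f x))\<^sup>2 - (cmod (f y))\<^sup>2\<bar> \<le> 2 * (sqrt P * sqrt N)"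
proof -
  let ?F = "\<lambda>x. f x * cnj (f x)"
  let ?D = "\<lambda>x. of_real (r x) * (h x * cnj (f x) + f x * cnj (h x))"
  have F: "?F \<in> AC a b" by (rule AC_mult[OF f AC_bounded_linear[OF f bounded_linear_cnj]])
  have D: "AE x in M. (?F has_vector_derivative ?D x) (at x)"
    using f'
  proof eventually_elim
    case (elim x)
    have "(?F has_vector_derivative (f x * cnj (of_real (r x) * h x) + (of_real (r x) * h x) * cnj (f x))) (at x)"
      by (rule has_vector_derivative_mult[OF elim bounded_linear.has_vector_derivative[OF bounded_linear_cnj elim]])
    also have "f x * cnj (of_real (r x) * h x) + (of_real (r x) * h x) * cnj (f x) = ?D x"
      by (simp add: algebra_simps)
    finally show ?case .
  qed
  have Dm: "?D \<in> borel_measurable M" by measurable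
  \<comment> \<open>The weight \<open>r\<close> is split evenly between the factors, so that their
    squares integrate to \<open>P\<close> and \<open>N\<close>.\<close>
  let ?u = "\<lambda>x. sqrt (r x) * cmod (h x)" and ?v = "\<lambda>x. sqrt (r x) * cmod (f x)"
  have sq: "(?u x)\<^sup>2 = r x * (cmod (h x))\<^sup>2" "(?v x)\<^sup>2 = r x * (cmod (f x))\<^sup>2" for x
    using r(2)[of x] by (auto simp: power_mult_distrib)
  have um: "?u \<in> borel_measurable M" "?v \<in> borel_measurable M" by measurable
  have i: "integrable M (\<lambda>x. (?u x)\<^sup>2)" "integrable M (\<lambda>x. (?v x)\<^sup>2)"
    unfolding sq using integrable_r_h_sq integrable_mult_f_sq[OF r(1)] by auto
  note CS = integral_Cauchy_Schwarz[OF um i, unfolded sq, folded P_def N_def]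
  have bound: "cmod (?F t - ?F s) \<le> 2 * (sqrt P * sqrt N)" if "a \<le> s" "s \<le> t" "t \<le> b" for s t
  proof -
    have "cmod (?F t - ?F s) \<le> (LINT x|M. cmod (?D x))"
      by (rule AC_increment_le[OF F ab Dm D that])
    also have "\<dots> \<le> (LINT x|M. 2 * \<bar>?u x * ?v x\<bar>)"
    proof (rule integral_mono)
      show "integrable M (\<lambda>x. cmod (?D x))" using AC_integral(1)[OF F ab Dm D] by (rule integrable_norm)
      show "integrable M (\<lambda>x. 2 * \<bar>?u x * ?v x\<bar>)" using integrable_abs[OF CS(1)] by (rule integrable_mult_right)
      fix x
      have "cmod (?D x) \<le> r x * (cmod (h x * cnj (f x)) + cmod (f x * cnj (h x)))"
        unfolding norm_mult[of "of_real (r x)"] using r(2)[of x]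
        by (simp only: norm_of_real abs_of_nonneg) (rule mult_left_mono[OF norm_triangle_ineq])
      also have "\<dots> = 2 * (r x * (cmod (h x) * cmod (f x)))" by (simp add: norm_mult)
      also have "r x * (cmod (h x) * cmod (f x)) = (sqrt (r x) * sqrt (r x)) * (cmod (h x) * cmod (f x))"
        using r(2)[of x] by simp
      also have "\<dots> = \<bar>?u x * ?v x\<bar>"
        using r(2)[of x] by (simp only: abs_mult abs_of_nonneg[OF norm_ge_zero] abs_of_nonneg[OF real_sqrt_ge_zero] ac_simps)
      finally show "cmod (?D x) \<le> 2 * \<bar>?u x * ?v x\<bar>" .
    qed
    also have "\<dots> = 2 * (LINT x|M. \<bar>?u x * ?v x\<bar>)" by (rule integral_mult_right_zero)
    also have "\<dots> \<le> 2 * (sqrt P * sqrt N)" using CS(2) by simp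
    finally show ?thesis .
  qed
  have F_eq: "?F x = of_real ((cmod (f x))\<^sup>2)" for x by (rule complex_norm_square[symmetric])
  have bound': "\<bar>(cmod (f t))\<^sup>2 - (cmod (f s))\<^sup>2\<bar> \<le> 2 * (sqrt P * sqrt N)" if "a \<le> s" "s \<le> t" "t \<le> b" for s t
    using bound[OF that] unfolding F_eq of_real_diff[symmetric] norm_of_real .
  show ?thesis
  proof (cases "x \<le> y")
    case True
    then show ?thesis using bound'[of x y] assms by (simp add: abs_minus_commute)
  next
    case False
    then show ?thesis using bound'[of y x] assms by simp
  qed
qed

text \<open>By \<open>w_orthogonal\<close> a multiple of \<open>w\<close> may be traded for
  \<open>w\<close> times a difference. At a maximum point \<open>x0\<close> of
  \<open>\<bar>f\<bar>\<close> the difference \<open>K\<^sup>2 - \<bar>f\<bar>\<^sup>2\<close> is an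
  oscillation of \<open>\<bar>f\<bar>\<^sup>2\<close>.\<close>

lemma K_sq_le: "K\<^sup>2 * \<bar>LINT x|M. w x\<bar> \<le> (LINT x|M. \<bar>w x\<bar>) * (2 * (sqrt P * sqrt N))"
proof -
  obtain x0 where x0: "x0 \<in> {a..b}" "cmod (f x0) = K" using K(3) by blast
  have wK: "integrable M (\<lambda>x. w x * K\<^sup>2)" using w by simp
  have "K\<^sup>2 * (LINT x|M. w x) = (LINT x|M. w x * K\<^sup>2) - (LINT x|M. w x * (cmod (f x))\<^sup>2)"
    unfolding w_orthogonal by simp
  also have "\<dots> = (LINT x|M. w x * (K\<^sup>2 - (cmod (f x))\<^sup>2))"
    unfolding right_diff_distrib by (rule Bochner_Integration.integral_diff[OF wK integrable_mult_f_sq[OF w], symmetric])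
  finally have eq: "K\<^sup>2 * (LINT x|M. w x) = (LINT x|M. w x * (K\<^sup>2 - (cmod (f x))\<^sup>2))" .
  have "K\<^sup>2 * \<bar>LINT x|M. w x\<bar> = \<bar>LINT x|M. w x * (K\<^sup>2 - (cmod (f x))\<^sup>2)\<bar>"
    unfolding eq[symmetric] abs_mult by simp
  also have "\<dots> \<le> (LINT x|M. \<bar>w x * (K\<^sup>2 - (cmod (f x))\<^sup>2)\<bar>)" by (rule integral_abs_bound)
  also have "\<dots> \<le> (LINT x|M. \<bar>w x\<bar> * (2 * (sqrt P * sqrt N)))"
  proof (rule integral_mono)
    have "integrable M (\<lambda>x. w x * (K\<^sup>2 - (cmod (f x))\<^sup>2))"
      unfolding right_diff_distrib using wK integrable_mult_f_sq[OF w] by (rule Bochner_Integration.integrable_diff)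
    then show "integrable M (\<lambda>x. \<bar>w x * (K\<^sup>2 - (cmod (f x))\<^sup>2)\<bar>)" by (rule integrable_abs)
    show "integrable M (\<lambda>x. \<bar>w x\<bar> * (2 * (sqrt P * sqrt N)))" using integrable_abs[OF w] by (rule integrable_mult_left)
    fix x assume "x \<in> space M"
    then have "x \<in> {a..b}" by auto
    from f_sq_oscillation[OF x0(1) this] show "\<bar>w x * (K\<^sup>2 - (cmod (f x))\<^sup>2)\<bar> \<le> \<bar>w x\<bar> * (2 * (sqrt P * sqrt N))"
      unfolding abs_mult[of "w x"] x0(2) by (rule mult_left_mono) simp
  qed
  also have "\<dots> = (LINT x|M. \<bar>w x\<bar>) * (2 * (sqrt P * sqrt N))" by (rule integral_mult_left_zero)
  finally show ?thesis .
qed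

text \<open>From \<open>K\<^sup>2 \<le> \<delta> sqrt P sqrt N\<close> and
  \<open>P \<le> \<alpha> K\<^sup>2\<close>, squaring and cancelling one \<open>K\<^sup>2\<close>
  leaves \<open>N\<close>. If \<open>\<alpha>\<close> were not positive, then \<open>P = 0\<close>
  and hence \<open>K = 0\<close>; so positivity is a consequence of the existence of a nonreal
  eigenvalue.\<close>

lemma N_lower_bound:
  assumes w0: "(LINT x|M. w x) \<noteq> 0"
    and \<delta>: "\<delta> = 2 + 2 * ((LINT x|M. \<bar>w x\<bar>) / \<bar>LINT x|M. w x\<bar>)"
  shows "\<alpha> > 0" and "K\<^sup>2 \<le> \<delta>\<^sup>2 * \<alpha> * N"
proof -
  define W where "W = (LINT x|M. \<bar>w x\<bar>) / \<bar>LINT x|M. w x\<bar>"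
  have W: "W \<ge> 0" unfolding W_def by (intro divide_nonneg_nonneg) auto
  have "K\<^sup>2 \<le> (LINT x|M. \<bar>w x\<bar>) * (2 * (sqrt P * sqrt N)) / \<bar>LINT x|M. w x\<bar>"
    using K_sq_le w0 by (simp add: pos_le_divide_eq)
  also have "\<dots> = 2 * W * (sqrt P * sqrt N)" by (simp add: W_def)
  also have "\<dots> \<le> \<delta> * (sqrt P * sqrt N)"
    using P_nonneg N_nonneg by (intro mult_right_mono) (auto simp: \<delta> W_def)
  finally have 1: "K\<^sup>2 \<le> \<delta> * (sqrt P * sqrt N)" .
  have "\<alpha> * K\<^sup>2 \<noteq> 0 \<and> 0 \<le> \<alpha> * K\<^sup>2"
  proof
    show "0 \<le> \<alpha> * K\<^sup>2" using P_nonneg P_le by linarith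
    show "\<alpha> * K\<^sup>2 \<noteq> 0"
    proof
      assume "\<alpha> * K\<^sup>2 = 0"
      then have "P = 0" using P_nonneg P_le by linarith
      with 1 K(2) show False by simp
    qed
  qed
  then show \<alpha>: "\<alpha> > 0" using K(2) by (auto simp: zero_le_mult_iff)
  have \<delta>0: "\<delta> \<ge> 0" using W by (simp add: \<delta> W_def)
  have "(K\<^sup>2)\<^sup>2 \<le> (\<delta> * (sqrt P * sqrt N))\<^sup>2" using 1 by (intro power_mono) auto
  also have "\<dots> = \<delta>\<^sup>2 * N * P" using P_nonneg N_nonneg by (simp add: power_mult_distrib)
  also have "\<dots> \<le> \<delta>\<^sup>2 * N * (\<alpha> * K\<^sup>2)" using P_le N_nonneg by (intro mult_left_mono) auto
  also have "\<dots> = (\<delta>\<^sup>2 * \<alpha> * N) * K\<^sup>2" by (simp add: ac_simps)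
  finally have "K\<^sup>2 * K\<^sup>2 \<le> (\<delta>\<^sup>2 * \<alpha> * N) * K\<^sup>2" by (simp add: power2_eq_square)
  then show "K\<^sup>2 \<le> \<delta>\<^sup>2 * \<alpha> * N" by (rule mult_right_le_imp_le) (use K(2) in simp)
qed

section \<open>The identity with the test function\<close>

text \<open>The zeros of \<open>g\<close> at \<open>a\<close> and \<open>b\<close> remove the
  boundary terms whatever the boundary condition. The coefficient of \<open>z\<close> now carries
  the weight \<open>g w\<close>, and the price is the cross term with \<open>g'\<close>.\<close>

lemma eigenvalue_identity:
  fixes g :: "real \<Rightarrow> real"
  assumes g: "g \<in> AC a b" "g a = 0" "g b = 0" and G1m: "g' \<in> borel_measurable M"
    and g': "AE x in M. (g has_vector_derivative g' x) (at x)"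
    and gL: "\<And>x. x \<in> {a<..<b} \<Longrightarrow> \<bar>g x\<bar> \<le> L"
    and hg: "integrable M (\<lambda>x. g' x * cmod (h x))"
  shows "z * of_real (LINT x|M. w x * g x * (cmod (f x))\<^sup>2) =
      of_real (LINT x|M. r x * (cmod (h x))\<^sup>2 * g x + q x * (cmod (f x))\<^sup>2 * g x) +
      (LINT x|M. h x * (of_real (g' x) * cnj (f x)))"
    and "integrable M (\<lambda>x. w x * g x * (cmod (f x))\<^sup>2)"
    and "integrable M (\<lambda>x. r x * (cmod (h x))\<^sup>2 * g x)" and "integrable M (\<lambda>x. q x * (cmod (f x))\<^sup>2 * g x)"
    and "integrable M (\<lambda>x. h x * (of_real (g' x) * cnj (f x)))"
proof -
  let ?A = "\<lambda>x. r x * (cmod (h x))\<^sup>2 * g x + q x * (cmod (f x))\<^sup>2 * g x" and ?W = "\<lambda>x. w x * g x * (cmod (f x))\<^sup>2"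
  let ?C = "\<lambda>x. h x * (of_real (g' x) * cnj (f x))"
  let ?D = "\<lambda>x. complex_of_real (?A x) - z * complex_of_real (?W x) + ?C x"
  let ?H = "\<lambda>x. h x * (of_real (g x) * cnj (f x))"
  note [measurable] = G1m AC_measurable[OF g(1)]
  have gL': "\<And>x. x \<in> space M \<Longrightarrow> \<bar>g x\<bar> \<le> L" using gL by simp
  show W: "integrable M ?W"
    by (intro integrable_mult_f_sq integrable_mult_bounded[OF w AC_measurable[OF g(1)] gL'])
  show A1: "integrable M (\<lambda>x. r x * (cmod (h x))\<^sup>2 * g x)" and A2: "integrable M (\<lambda>x. q x * (cmod (f x))\<^sup>2 * g x)"
    using integrable_mult_bounded[OF integrable_r_h_sq AC_measurable[OF g(1)] gL']
      integrable_mult_bounded[OF integrable_mult_f_sq[OF q] AC_measurable[OF g(1)] gL'] by auto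
  have A: "integrable M ?A" using A1 A2 by (rule Bochner_Integration.integrable_add)
  show C: "integrable M ?C"
  proof (rule Bochner_Integration.integrable_bound)
    show "integrable M (\<lambda>x. K * (g' x * cmod (h x)))" using hg by (rule integrable_mult_right)
    show "AE x in M. norm (?C x) \<le> norm (K * (g' x * cmod (h x)))"
    proof (rule AE_I2)
      fix x assume "x \<in> space M"
      then have "cmod (f x) \<le> \<bar>K\<bar>" using K(1)[of x] by auto
      then have "(\<bar>g' x\<bar> * cmod (h x)) * cmod (f x) \<le> (\<bar>g' x\<bar> * cmod (h x)) * \<bar>K\<bar>"
        by (rule mult_left_mono) simp
      then show "norm (?C x) \<le> norm (K * (g' x * cmod (h x)))" by (simp add: norm_mult abs_mult ac_simps)
    qed
  qed measurable
  have D: "AE x in M. (?H has_vector_derivative ?D x) (at x)"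
    using f' h' g'
  proof eventually_elim
    case (elim x)
    have gf: "((\<lambda>x. of_real (g x) * cnj (f x)) has_vector_derivative
        (of_real (g x) * cnj (of_real (r x) * h x) + of_real (g' x) * cnj (f x))) (at x)"
      by (rule has_vector_derivative_mult[OF
            bounded_linear.has_vector_derivative[OF bounded_linear_of_real elim(3)]
            bounded_linear.has_vector_derivative[OF bounded_linear_cnj elim(1)]])
    have "(?H has_vector_derivative
        (h x * (of_real (g x) * cnj (of_real (r x) * h x) + of_real (g' x) * cnj (f x)) +
        (of_real (q x) * f x - z * of_real (w x) * f x) * (of_real (g x) * cnj (f x)))) (at x)"
      by (rule has_vector_derivative_mult[OF elim(2) gf])
    also have "h x * (of_real (g x) * cnj (of_real (r x) * h x) + of_real (g' x) * cnj (f x)) +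
        (of_real (q x) * f x - z * of_real (w x) * f x) * (of_real (g x) * cnj (f x)) = ?D x"
      unfolding of_real_add of_real_mult complex_norm_square by (simp add: algebra_simps)
    finally show ?case .
  qed
  have H: "?H \<in> AC a b"
    by (intro AC_mult[OF h] AC_mult AC_bounded_linear[OF g(1) bounded_linear_of_real] AC_bounded_linear[OF f bounded_linear_cnj])
  have "0 = ?H b - ?H a" by (simp add: g)
  also have "\<dots> = (LINT x|M. ?D x)"
    by (rule AC_integral(2)[OF H ab _ D, symmetric]) measurable
  also have "\<dots> = (LINT x|M. complex_of_real (?A x) - z * complex_of_real (?W x)) + (LINT x|M. ?C x)"
    using A W C by (intro Bochner_Integration.integral_add Bochner_Integration.integrable_diff integrable_of_real integrable_mult_right) auto
  also have "(LINT x|M. complex_of_real (?A x) - z * complex_of_real (?W x)) =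
      (LINT x|M. complex_of_real (?A x)) - (LINT x|M. z * complex_of_real (?W x))"
    using A W by (intro Bochner_Integration.integral_diff integrable_of_real integrable_mult_right) auto
  also have "(LINT x|M. complex_of_real (?A x)) = of_real (LINT x|M. ?A x)"
    by (rule integral_complex_of_real)
  also have "(LINT x|M. z * complex_of_real (?W x)) = z * of_real (LINT x|M. ?W x)"
    by (simp only: integral_mult_right_zero integral_complex_of_real)
  finally have 0: "0 = of_real (LINT x|M. ?A x) - z * of_real (LINT x|M. ?W x) + (LINT x|M. ?C x)" .
  have "Y = X + Z" if "0 = X - Y + Z" for X Y Z :: complex
    using that by (simp add: algebra_simps)
  from this[OF 0] show "z * of_real (LINT x|M. ?W x) = of_real (LINT x|M. ?A x) + (LINT x|M. ?C x)" .
qed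

text \<open>The comparison is pointwise. Off \<Omega> it is \<open>\<epsilon> r \<le> w g\<close>;
  on \<Omega> the left integrand is at most zero because \<open>\<bar>f\<bar> \<le> K\<close>, while
  the right one is nonnegative.\<close>

lemma gw_lower_bound:
  assumes gw: "integrable M (\<lambda>x. w x * g x * (cmod (f x))\<^sup>2)" "AE x in M. g x * w x > 0"
    and \<Omega>: "\<Omega> \<in> sets M" "AE x in M. x \<notin> \<Omega> \<longrightarrow> \<epsilon> * r x \<le> w x * g x" and "\<epsilon> > 0"
  shows "\<epsilon> * (N - K\<^sup>2 * (LINT x|M. r x * indicator \<Omega> x)) \<le> (LINT x|M. w x * g x * (cmod (f x))\<^sup>2)"
proof -
  have N: "integrable M (\<lambda>x. r x * (cmod (f x))\<^sup>2)" by (rule integrable_mult_f_sq[OF r(1)])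
  have I: "integrable M (\<lambda>x. r x * indicator \<Omega> x)"
    by (rule integrable_mult_bounded[OF r(1) borel_measurable_indicator[OF \<Omega>(1)], of 1]) (simp add: indicator_def)
  have KI: "integrable M (\<lambda>x. K\<^sup>2 * (r x * indicator \<Omega> x))" using I by (rule integrable_mult_right)
  have d: "integrable M (\<lambda>x. r x * (cmod (f x))\<^sup>2 - K\<^sup>2 * (r x * indicator \<Omega> x))"
    using N KI by (rule Bochner_Integration.integrable_diff)
  have "N - K\<^sup>2 * (LINT x|M. r x * indicator \<Omega> x) = (LINT x|M. r x * (cmod (f x))\<^sup>2 - K\<^sup>2 * (r x * indicator \<Omega> x))"
    unfolding N_def Bochner_Integration.integral_diff[OF N KI] integral_mult_right_zero ..
  then have "\<epsilon> * (N - K\<^sup>2 * (LINT x|M. r x * indicator \<Omega> x)) =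
      (LINT x|M. \<epsilon> * (r x * (cmod (f x))\<^sup>2 - K\<^sup>2 * (r x * indicator \<Omega> x)))"
    unfolding integral_mult_right_zero by simp
  also have "\<dots> \<le> (LINT x|M. w x * g x * (cmod (f x))\<^sup>2)"
  proof (rule integral_mono_AE)
    show "integrable M (\<lambda>x. \<epsilon> * (r x * (cmod (f x))\<^sup>2 - K\<^sup>2 * (r x * indicator \<Omega> x)))"
      using d by (rule integrable_mult_right)
    show "AE x in M. \<epsilon> * (r x * (cmod (f x))\<^sup>2 - K\<^sup>2 * (r x * indicator \<Omega> x)) \<le> w x * g x * (cmod (f x))\<^sup>2"
      using gw(2) \<Omega>(2) AE_space
    proof eventually_elim
      case (elim x)
      show ?case
      proof (cases "x \<in> \<Omega>")
        case True
        have "x \<in> {a..b}" using elim(3) by auto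
        from mult_left_mono[OF f_sq_le[OF this] r(2)[of x]]
        have "r x * (cmod (f x))\<^sup>2 - K\<^sup>2 * (r x * indicator \<Omega> x) \<le> 0" using True by (simp add: mult.commute)
        then have "\<epsilon> * (r x * (cmod (f x))\<^sup>2 - K\<^sup>2 * (r x * indicator \<Omega> x)) \<le> 0"
          using \<open>\<epsilon> > 0\<close> by (intro mult_nonneg_nonpos) auto
        also have "0 \<le> w x * g x * (cmod (f x))\<^sup>2"
        proof (rule mult_nonneg_nonneg)
          show "0 \<le> w x * g x" using less_imp_le[OF elim(1)] by (simp only: mult.commute)
        qed simp
        finally show ?thesis .
      next
        case False
        then show ?thesis using elim(2) mult_right_mono[of "\<epsilon> * r x" "w x * g x" "(cmod (f x))\<^sup>2"] by (simp add: mult.assoc)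
      qed
    qed
  qed (rule gw(1))
  finally show ?thesis .
qed

text \<open>The identity is divided by its denominator \<open>Y\<close>, which is at least a
  positive multiple of \<open>K\<^sup>2\<close>. The guard in \<open>small\<close> keeps the real
  quotient meaningful; \<open>N_lower_bound\<close> discharges it.\<close>

lemma eigenvalue_bounds:
  fixes g p :: "real \<Rightarrow> real"
  assumes w0: "(LINT x|M. w x) \<noteq> 0"
    and \<delta>: "\<delta> = 2 + 2 * ((LINT x|M. \<bar>w x\<bar>) / \<bar>LINT x|M. w x\<bar>)"
    and p [measurable]: "p \<in> borel_measurable M" and rp: "AE x in M. p x > 0 \<and> r x = 1 / p x"
    and g: "g \<in> AC a b" "g a = 0" "g b = 0"
    and g' [measurable]: "g' \<in> borel_measurable M"
    and Dg: "AE x in M. (g has_vector_derivative g' x) (at x)"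
    and G: "integrable M (\<lambda>x. p x * (g' x)\<^sup>2)" "G = sqrt (LINT x|M. p x * (g' x)\<^sup>2)"
    and gL: "AE x in M. \<bar>g x\<bar> \<le> L" and gw: "AE x in M. g x * w x > 0"
    and \<epsilon>: "\<epsilon> > 0" and \<Omega>: "\<Omega> \<in> sets M" "AE x in M. x \<notin> \<Omega> \<longrightarrow> \<epsilon> * r x \<le> w x * g x"
    and small: "\<alpha> > 0 \<Longrightarrow> (LINT x|M. r x * indicator \<Omega> x) \<le> 1 / (2 * \<alpha> * \<delta>\<^sup>2)"
  shows "\<bar>Im z\<bar> \<le> 2 / \<epsilon> * \<alpha> powr (3 / 2) * \<delta>\<^sup>2 * G"
    and "\<bar>Re z\<bar> \<le> 2 / \<epsilon> * \<alpha> * \<delta>\<^sup>2 * (sqrt \<alpha> * G + (\<alpha> + (LINT x|M. \<bar>q x\<bar>)) * L)"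
proof -
  note NL = N_lower_bound[OF w0 \<delta>]
  have \<alpha>: "\<alpha> > 0" by (rule NL(1))
  have "\<delta> \<ge> 2" unfolding \<delta> by simp
  then have \<delta>2: "\<delta>\<^sup>2 > 0" by simp
  have K2: "K\<^sup>2 > 0" using K(2) by simp
  have G0: "G \<ge> 0" unfolding G(2) using rp by (auto intro!: integral_nonneg_AE)
  \<comment> \<open>A negative \<open>L\<close> would make the measure space null, and the integral
    of \<open>w\<close> would vanish.\<close>
  have L0: "L \<ge> 0"
  proof (rule ccontr)
    assume "\<not> L \<ge> 0"
    have "AE x in M. w x = 0" using gL by eventually_elim (use \<open>\<not> L \<ge> 0\<close> in auto)
    then have "(LINT x|M. w x) = (LINT x|M. 0)" by (intro integral_cong_AE) auto
    with w0 show False by simp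
  qed
  \<comment> \<open>Positivity of \<open>p\<close> holds only almost everywhere, so the absolute
    value is needed for the square identity to hold at every point.\<close>
  let ?u = "\<lambda>x. sqrt (r x) * cmod (h x)" and ?v = "\<lambda>x. sqrt \<bar>p x\<bar> * g' x"
  have usq: "(?u x)\<^sup>2 = r x * (cmod (h x))\<^sup>2" and vsq: "(?v x)\<^sup>2 = \<bar>p x\<bar> * (g' x)\<^sup>2" for x
    using r(2)[of x] by (auto simp: power_mult_distrib)
  have veq: "AE x in M. p x * (g' x)\<^sup>2 = \<bar>p x\<bar> * (g' x)\<^sup>2" using rp by eventually_elim auto
  have vm: "(\<lambda>x. p x * (g' x)\<^sup>2) \<in> borel_measurable M" "(\<lambda>x. \<bar>p x\<bar> * (g' x)\<^sup>2) \<in> borel_measurable M" by measurable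
  have vi: "integrable M (\<lambda>x. \<bar>p x\<bar> * (g' x)\<^sup>2)" using G(1) integrable_cong_AE[OF vm veq] by simp
  have G': "G = sqrt (LINT x|M. \<bar>p x\<bar> * (g' x)\<^sup>2)" unfolding G(2) integral_cong_AE[OF vm veq] ..
  have um: "?u \<in> borel_measurable M" "?v \<in> borel_measurable M" by measurable
  note CS = integral_Cauchy_Schwarz[OF um, unfolded usq vsq, OF integrable_r_h_sq vi, folded P_def G']
  have uv: "AE x in M. ?u x * ?v x = g' x * cmod (h x)"
    using rp
  proof eventually_elim
    case (elim x)
    have "sqrt (r x) * sqrt \<bar>p x\<bar> = 1" using elim by (simp flip: real_sqrt_mult)
    moreover have "?u x * ?v x = (sqrt (r x) * sqrt \<bar>p x\<bar>) * (g' x * cmod (h x))" by (simp only: ac_simps)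
    ultimately show ?case by simp
  qed
  have hgm: "(\<lambda>x. g' x * cmod (h x)) \<in> borel_measurable M" "(\<lambda>x. ?u x * ?v x) \<in> borel_measurable M" by measurable
  have hg: "integrable M (\<lambda>x. g' x * cmod (h x))" using CS(1) integrable_cong_AE[OF hgm(2,1) uv] by simp
  have uv': "AE x in M. \<bar>?u x * ?v x\<bar> = \<bar>g' x * cmod (h x)\<bar>" using uv by eventually_elim (rule arg_cong)
  have hg_le: "(LINT x|M. \<bar>g' x * cmod (h x)\<bar>) \<le> sqrt P * G"
    using CS(2) integral_cong_AE[OF borel_measurable_abs[OF hgm(2)] borel_measurable_abs[OF hgm(1)] uv'] by simp
  obtain L' where "\<And>x. x \<in> {a..b} \<Longrightarrow> norm (g x) \<le> L'" using AC_bounded[OF g(1)] by blast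
  then have L': "\<And>x. x \<in> {a<..<b} \<Longrightarrow> \<bar>g x\<bar> \<le> L'" by simp
  define Y where "Y = (LINT x|M. w x * g x * (cmod (f x))\<^sup>2)"
  define A where "A = (LINT x|M. r x * (cmod (h x))\<^sup>2 * g x + q x * (cmod (f x))\<^sup>2 * g x)"
  define C where "C = (LINT x|M. h x * (of_real (g' x) * cnj (f x)))"
  note EI = eigenvalue_identity[OF g g' Dg L' hg]
  have zY: "z * of_real Y = of_real A + C" unfolding Y_def A_def C_def by (rule EI(1))
  have "sqrt P \<le> sqrt (\<alpha> * K\<^sup>2)" using P_le by (rule real_sqrt_le_mono)
  then have sP: "sqrt P \<le> sqrt \<alpha> * K" using K(2) by (simp add: real_sqrt_mult)
  have C_le: "cmod C \<le> sqrt \<alpha> * G * K\<^sup>2"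
  proof -
    have "cmod C \<le> (LINT x|M. cmod (h x * (of_real (g' x) * cnj (f x))))"
      unfolding C_def by (rule integral_norm_bound)
    also have "\<dots> \<le> (LINT x|M. \<bar>g' x * cmod (h x)\<bar> * K)"
    proof (rule integral_mono)
      show "integrable M (\<lambda>x. cmod (h x * (of_real (g' x) * cnj (f x))))" using EI(5) by (rule integrable_norm)
      show "integrable M (\<lambda>x. \<bar>g' x * cmod (h x)\<bar> * K)" using integrable_abs[OF hg] by (rule integrable_mult_left)
      fix x assume "x \<in> space M"
      then have "cmod (f x) \<le> K" using K(1)[of x] by auto
      then have "\<bar>g' x * cmod (h x)\<bar> * cmod (f x) \<le> \<bar>g' x * cmod (h x)\<bar> * K" by (rule mult_left_mono) simp
      then show "cmod (h x * (of_real (g' x) * cnj (f x))) \<le> \<bar>g' x * cmod (h x)\<bar> * K"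
        by (simp add: norm_mult abs_mult ac_simps)
    qed
    also have "\<dots> = (LINT x|M. \<bar>g' x * cmod (h x)\<bar>) * K" by (rule integral_mult_left_zero)
    also have "\<dots> \<le> (sqrt P * G) * K" using hg_le K(2) by (intro mult_right_mono) auto
    also have "\<dots> \<le> (sqrt \<alpha> * K * G) * K" using sP G0 K(2) by (intro mult_right_mono) auto
    also have "\<dots> = sqrt \<alpha> * G * K\<^sup>2" by (simp add: power2_eq_square)
    finally show ?thesis .
  qed
  define Q where "Q = (LINT x|M. \<bar>q x\<bar>)"
  have A_le: "\<bar>A\<bar> \<le> (\<alpha> + Q) * L * K\<^sup>2"
  proof -
    let ?B = "\<lambda>x. r x * (cmod (h x))\<^sup>2 + \<bar>q x\<bar> * (cmod (f x))\<^sup>2"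
    have qi: "integrable M (\<lambda>x. \<bar>q x\<bar> * (cmod (f x))\<^sup>2)" by (rule integrable_mult_f_sq[OF integrable_abs[OF q]])
    have AI: "integrable M (\<lambda>x. r x * (cmod (h x))\<^sup>2 * g x + q x * (cmod (f x))\<^sup>2 * g x)"
      using EI(3,4) by (rule Bochner_Integration.integrable_add)
    have B: "integrable M ?B" using integrable_r_h_sq qi by (rule Bochner_Integration.integrable_add)
    have "\<bar>A\<bar> \<le> (LINT x|M. \<bar>r x * (cmod (h x))\<^sup>2 * g x + q x * (cmod (f x))\<^sup>2 * g x\<bar>)"
      unfolding A_def by (rule integral_abs_bound)
    also have "\<dots> \<le> (LINT x|M. ?B x * L)"
    proof (rule integral_mono_AE)
      show "integrable M (\<lambda>x. \<bar>r x * (cmod (h x))\<^sup>2 * g x + q x * (cmod (f x))\<^sup>2 * g x\<bar>)"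
        using AI by (rule integrable_abs)
      show "integrable M (\<lambda>x. ?B x * L)" using B by (rule integrable_mult_left)
      show "AE x in M. \<bar>r x * (cmod (h x))\<^sup>2 * g x + q x * (cmod (f x))\<^sup>2 * g x\<bar> \<le> ?B x * L"
        using gL
      proof eventually_elim
        case (elim x)
        have "\<bar>r x * (cmod (h x))\<^sup>2 + q x * (cmod (f x))\<^sup>2\<bar> \<le> ?B x"
          using r(2)[of x] by (intro order_trans[OF abs_triangle_ineq]) (simp add: abs_mult)
        moreover have "0 \<le> ?B x" using r(2)[of x] by simp
        ultimately have "\<bar>r x * (cmod (h x))\<^sup>2 + q x * (cmod (f x))\<^sup>2\<bar> * \<bar>g x\<bar> \<le> ?B x * L"
          using elim by (intro mult_mono) auto
        then show ?case unfolding abs_mult[symmetric] distrib_right .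
      qed
    qed
    also have "\<dots> = (LINT x|M. ?B x) * L" by (rule integral_mult_left_zero)
    also have "(LINT x|M. ?B x) = P + (LINT x|M. \<bar>q x\<bar> * (cmod (f x))\<^sup>2)"
      unfolding P_def by (rule Bochner_Integration.integral_add[OF integrable_r_h_sq qi])
    also have "(P + (LINT x|M. \<bar>q x\<bar> * (cmod (f x))\<^sup>2)) * L \<le> (\<alpha> * K\<^sup>2 + Q * K\<^sup>2) * L"
      unfolding Q_def by (intro mult_right_mono add_mono P_le integral_mult_f_sq_le integrable_abs q L0) simp
    also have "\<dots> = (\<alpha> + Q) * L * K\<^sup>2" by (simp add: algebra_simps)
    finally show ?thesis .
  qed
  \<comment> \<open>\<open>N\<close> is at least
    \<open>K\<^sup>2 / (\<alpha> \<delta>\<^sup>2)\<close>, and the exceptional set \<Omega> takes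
    away at most half of that.\<close>
  define T where "T = \<epsilon> / (2 * \<alpha> * \<delta>\<^sup>2)"
  have T: "T > 0" using \<epsilon> \<alpha> \<delta>2 by (simp add: T_def)
  have Y: "T * K\<^sup>2 \<le> Y"
  proof -
    have "K\<^sup>2 / (\<alpha> * \<delta>\<^sup>2) \<le> N" using NL(2) \<alpha> \<delta>2 by (simp add: pos_divide_le_eq ac_simps)
    moreover have "K\<^sup>2 * (LINT x|M. r x * indicator \<Omega> x) \<le> K\<^sup>2 * (1 / (2 * \<alpha> * \<delta>\<^sup>2))"
      using small[OF \<alpha>] by (rule mult_left_mono) simp
    moreover have "K\<^sup>2 / (\<alpha> * \<delta>\<^sup>2) - K\<^sup>2 * (1 / (2 * \<alpha> * \<delta>\<^sup>2)) = K\<^sup>2 / (2 * \<alpha> * \<delta>\<^sup>2)"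
      using \<alpha> \<delta>2 by (simp add: field_simps)
    ultimately have "K\<^sup>2 / (2 * \<alpha> * \<delta>\<^sup>2) \<le> N - K\<^sup>2 * (LINT x|M. r x * indicator \<Omega> x)" by linarith
    then have "\<epsilon> * (K\<^sup>2 / (2 * \<alpha> * \<delta>\<^sup>2)) \<le> \<epsilon> * (N - K\<^sup>2 * (LINT x|M. r x * indicator \<Omega> x))"
      using \<epsilon> by (intro mult_left_mono) auto
    also have "\<dots> \<le> Y" unfolding Y_def by (rule gw_lower_bound[OF EI(2) gw \<Omega> \<epsilon>])
    finally show ?thesis by (simp add: T_def)
  qed
  have bound: "t \<le> 2 / \<epsilon> * \<alpha> * \<delta>\<^sup>2 * S" if "t \<ge> 0" "t * Y \<le> S * K\<^sup>2" for t S
  proof -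
    have "t * T * K\<^sup>2 \<le> t * Y" using mult_left_mono[OF Y \<open>t \<ge> 0\<close>] by (simp add: mult.assoc)
    also have "\<dots> \<le> S * K\<^sup>2" by fact
    finally have "t * T \<le> S" by (rule mult_right_le_imp_le[OF _ K2])
    then have "t \<le> S / T" using T by (simp add: pos_le_divide_eq)
    also have "S / T = 2 / \<epsilon> * \<alpha> * \<delta>\<^sup>2 * S" by (simp add: T_def)
    finally show ?thesis .
  qed
  have Y0: "Y \<ge> 0" using Y T K2 by (meson less_imp_le mult_pos_pos order_trans)
  \<comment> \<open>\<open>A\<close> and \<open>Y\<close> are real, so \<open>A\<close>, and with it
    \<open>Q\<close> and \<open>L\<close>, affects only the real part of \<open>z\<close>.\<close>
  have "Im z * Y = Im C" using arg_cong[OF zY, of Im] by simp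
  then have "\<bar>Im z\<bar> * Y = \<bar>Im C\<bar>" using Y0 by (metis abs_mult abs_of_nonneg)
  also have "\<dots> \<le> sqrt \<alpha> * G * K\<^sup>2" using C_le abs_Im_le_cmod[of C] by linarith
  finally have "\<bar>Im z\<bar> \<le> 2 / \<epsilon> * \<alpha> * \<delta>\<^sup>2 * (sqrt \<alpha> * G)" by (intro bound) simp_all
  also have "\<dots> = 2 / \<epsilon> * (\<alpha> * sqrt \<alpha>) * \<delta>\<^sup>2 * G" by simp
  also have "\<alpha> * sqrt \<alpha> = \<alpha> powr (3 / 2)"
    using \<alpha> powr_add[of \<alpha> 1 "1 / 2"] by (simp add: powr_half_sqrt)
  finally show "\<bar>Im z\<bar> \<le> 2 / \<epsilon> * \<alpha> powr (3 / 2) * \<delta>\<^sup>2 * G" .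
  have "Re z * Y = A + Re C" using arg_cong[OF zY, of Re] by simp
  then have "\<bar>Re z\<bar> * Y = \<bar>A + Re C\<bar>" using Y0 by (metis abs_mult abs_of_nonneg)
  also have "\<dots> \<le> \<bar>A\<bar> + \<bar>Re C\<bar>" by (rule abs_triangle_ineq)
  also have "\<dots> \<le> (\<alpha> + Q) * L * K\<^sup>2 + sqrt \<alpha> * G * K\<^sup>2"
    using A_le C_le abs_Re_le_cmod[of C] by linarith
  also have "\<dots> = (sqrt \<alpha> * G + (\<alpha> + Q) * L) * K\<^sup>2" by (simp add: algebra_simps)
  finally show "\<bar>Re z\<bar> \<le> 2 / \<epsilon> * \<alpha> * \<delta>\<^sup>2 * (sqrt \<alpha> * G + (\<alpha> + Q) * L)"
    by (intro bound) simp_all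
qed

end

section \<open>The eigenvalue bounds\<close>

text \<open>\<open>real_of_ereal\<close> sends infinite values to 0. The bound \<open>L\<close>
  excludes an essential supremum of \<infinity>, and the value \<open>-\<infinity>\<close> cannot
  lie above \<open>\<bar>g x\<bar>\<close>.\<close>

lemma AE_abs_le_Linf_norm:
  fixes g :: "real \<Rightarrow> real"
  assumes g: "g \<in> borel_measurable (lebesgue_on {a<..<b})" and L: "\<And>x. x \<in> {a<..<b} \<Longrightarrow> \<bar>g x\<bar> \<le> L"
  shows "AE x in lebesgue_on {a<..<b}. \<bar>g x\<bar> \<le> Linf_norm a b g"
proof -
  let ?e = "esssup (lebesgue_on {a<..<b}) (\<lambda>x. ereal \<bar>g x\<bar>)"
  have m: "(\<lambda>x. ereal \<bar>g x\<bar>) \<in> borel_measurable (lebesgue_on {a<..<b})" using g by measurable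
  have "?e \<le> ereal L" by (rule esssup_I[OF m AE_I2]) (use L in simp)
  then have "?e \<noteq> \<infinity>" by auto
  have "AE x in lebesgue_on {a<..<b}. ereal \<bar>g x\<bar> \<le> ?e" by (rule esssup_AE)
  then show ?thesis
    unfolding Linf_norm_def
  proof eventually_elim
    case (elim x)
    with \<open>?e \<noteq> \<infinity>\<close> show ?case by (cases ?e) auto
  qed
qed

lemma
  fixes u :: "real \<Rightarrow> real"
  assumes r: "r \<in> borel_measurable (lebesgue_on {a<..<b})" "AE x in lebesgue_on {a<..<b}. r x \<ge> 0"
    and u: "u \<in> borel_measurable (lebesgue_on {a<..<b})"
  shows L2_space_integrable: "u \<in> L2_space a b r \<Longrightarrow> integrable (lebesgue_on {a<..<b}) (\<lambda>x. r x * (u x)\<^sup>2)"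
    and L2_norm_eq: "L2_norm a b r u = sqrt (LINT x|lebesgue_on {a<..<b}. r x * (u x)\<^sup>2)"
proof -
  have u2: "(\<lambda>x. (u x)\<^sup>2) \<in> borel_measurable (lebesgue_on {a<..<b})" using u by measurable
  show "integrable (lebesgue_on {a<..<b}) (\<lambda>x. r x * (u x)\<^sup>2)" if "u \<in> L2_space a b r"
  proof -
    have "integrable (density (lebesgue_on {a<..<b}) (\<lambda>x. ennreal (r x))) (\<lambda>x. (u x)\<^sup>2)"
      using that by (simp add: L2_space_def weighted_measure_def)
    then show ?thesis using integrable_density[OF u2 r] by simp
  qed
  show "L2_norm a b r u = sqrt (LINT x|lebesgue_on {a<..<b}. r x * (u x)\<^sup>2)"
    unfolding L2_norm_def weighted_measure_def using integral_density[OF u2 r] by simp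
qed

text \<open>As \<open>w\<close> vanishes only on a null set, \<open>\<bar>w\<bar> dt\<close> and
  Lebesgue measure have the same null sets.\<close>

lemma AE_weighted_measure_abs:
  assumes w: "w \<in> borel_measurable (lebesgue_on {a<..<b})" "AE x in lebesgue_on {a<..<b}. w x \<noteq> 0"
  shows "(AE x in weighted_measure a b (\<lambda>x. \<bar>w x\<bar>). Q x) \<longleftrightarrow> (AE x in lebesgue_on {a<..<b}. Q x)"
proof -
  have "(AE x in weighted_measure a b (\<lambda>x. \<bar>w x\<bar>). Q x) \<longleftrightarrow> (AE x in lebesgue_on {a<..<b}. 0 < ennreal \<bar>w x\<bar> \<longrightarrow> Q x)"
    unfolding weighted_measure_def using w(1) by (intro AE_density) measurable
  also have "\<dots> \<longleftrightarrow> (AE x in lebesgue_on {a<..<b}. Q x)"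
  proof
    assume "AE x in lebesgue_on {a<..<b}. 0 < ennreal \<bar>w x\<bar> \<longrightarrow> Q x"
    with w(2) show "AE x in lebesgue_on {a<..<b}. Q x" by eventually_elim simp
  next
    assume "AE x in lebesgue_on {a<..<b}. Q x"
    then show "AE x in lebesgue_on {a<..<b}. 0 < ennreal \<bar>w x\<bar> \<longrightarrow> Q x" by eventually_elim simp
  qed
  finally show ?thesis .
qed

text \<open>The eigenvalue equation becomes the first-order system \<open>f' = h / p\<close>,
  \<open>h' = (q - z w) f\<close>, the form in which the product rule is applied. The absolute value
  of \<open>1 / p\<close> gives a coefficient that is nonnegative everywhere.\<close>

lemma eigenfunction_solution:
  assumes ab: "a < b" and w: "w \<in> borel_measurable (lebesgue_on {a<..<b})" "AE x in lebesgue_on {a<..<b}. w x \<noteq> 0"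
    and p: "AE x in lebesgue_on {a<..<b}. p x > 0"
    and ev: "is_eigenvalue a b p q w (selfadjoint_domain a b p q w B) z"
  obtains f h where "f \<in> AC a b" "h \<in> AC a b" "satisfies_bc a b B f h" "\<exists>x\<in>{a<..<b}. f x \<noteq> 0"
    "AE x in lebesgue_on {a<..<b}. (f has_vector_derivative of_real \<bar>1 / p x\<bar> * h x) (at x)"
    "AE x in lebesgue_on {a<..<b}. (h has_vector_derivative of_real (q x) * f x - z * of_real (w x) * f x) (at x)"
proof -
  let ?M = "lebesgue_on {a<..<b}"
  obtain f where dom: "f \<in> selfadjoint_domain a b p q w B"
    and nz: "\<not> (AE x in ?M. f x = 0)" and eq: "AE x in ?M. SL_expr a b p q w f x = z * f x"
    using ev unfolding is_eigenvalue_def AE_weighted_measure_abs[OF w] by blast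
  define h where "h = quasi_derivative a b p f"
  have f: "f \<in> AC a b" and ex: "\<exists>h. is_quasi_derivative a b p f h" and bc: "satisfies_bc a b B f h"
    using dom by (auto simp: selfadjoint_domain_def maximal_domain_def h_def)
  \<comment> \<open>Membership in the maximal domain supplies a witness, so the choice in
    \<open>quasi_derivative\<close> is a genuine quasi-derivative.\<close>
  from ex have "is_quasi_derivative a b p f h" unfolding h_def quasi_derivative_def by (rule someI_ex)
  then have h: "h \<in> AC a b" and hf: "AE x in ?M. h x = of_real (p x) * vector_derivative f (at x)"
    by (auto simp: is_quasi_derivative_def)
  show ?thesis
  proof (rule that[OF f h bc])
    show "\<exists>x\<in>{a<..<b}. f x \<noteq> 0"
    proof (rule ccontr)
      assume "\<not> (\<exists>x\<in>{a<..<b}. f x \<noteq> 0)"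
      then have "AE x in ?M. f x = 0" by (intro AE_I2) auto
      with nz show False by simp
    qed
    show "AE x in ?M. (f has_vector_derivative of_real \<bar>1 / p x\<bar> * h x) (at x)"
      using AC_AE_has_vector_derivative[OF f ab] hf p
    proof eventually_elim
      case (elim x)
      then have "of_real \<bar>1 / p x\<bar> * h x = vector_derivative f (at x)" by simp
      with elim(1) show ?case by simp
    qed
    show "AE x in ?M. (h has_vector_derivative of_real (q x) * f x - z * of_real (w x) * f x) (at x)"
      using AC_AE_has_vector_derivative[OF h ab] eq w(2)
    proof eventually_elim
      case (elim x)
      have "of_real (w x) * (z * f x) = - vector_derivative h (at x) + of_real (q x) * f x"
        using elim(3) unfolding elim(2)[symmetric] SL_expr_def h_def by simp
      then have "vector_derivative h (at x) = of_real (q x) * f x - z * of_real (w x) * f x"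
        by (simp add: algebra_simps)
      with elim(1) show ?case by simp
    qed
  qed
qed

theorem theorem3p6:
  fixes a b \<epsilon> \<alpha> \<delta> :: real and p q w g :: "real \<Rightarrow> real"
    and B :: boundary_condition and z :: complex
  assumes "a < b"
    and "p \<in> borel_measurable (lebesgue_on {a<..<b})"
    and "q \<in> borel_measurable (lebesgue_on {a<..<b})"
    and "w \<in> borel_measurable (lebesgue_on {a<..<b})"
    and "integrable (lebesgue_on {a<..<b}) (\<lambda>x. 1 / p x)"
    and "integrable (lebesgue_on {a<..<b}) q"
    and "integrable (lebesgue_on {a<..<b}) w"
    and "AE x in lebesgue_on {a<..<b}. p x > 0"
    and "AE x in lebesgue_on {a<..<b}. w x \<noteq> 0"
    and "emeasure (lebesgue_on {a<..<b}) {x \<in> {a<..<b}. w x > 0} > 0"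
    and "emeasure (lebesgue_on {a<..<b}) {x \<in> {a<..<b}. w x < 0} > 0"
    and "(LINT x|lebesgue_on {a<..<b}. w x) \<noteq> 0"
    and "admissible B"
    and "\<alpha> = bc_constant B + L1_norm a b (\<lambda>x. min 0 (q x))"
    and "\<delta> = 2 + 2 * (L1_norm a b w / \<bar>LINT x|lebesgue_on {a<..<b}. w x\<bar>)"
    and "g \<in> AC a b" and "g a = 0" and "g b = 0"
    and "(\<lambda>x. vector_derivative g (at x)) \<in> L2_space a b p"
    and "AE x in lebesgue_on {a<..<b}. g x * w x > 0"
    and "\<epsilon> > 0"
    \<comment> \<open>in \<^typ>\<open>ennreal\<close>, the right-hand side is \<open>\<infinity>\<close> if \<open>\<alpha> = 0\<close>\<close>
    and "emeasure (weighted_measure a b (\<lambda>x. 1 / p x))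
           {x \<in> {a<..<b}. p x * g x * w x < \<epsilon>} \<le> 1 / ennreal (2 * \<alpha> * \<delta>\<^sup>2)"
    and "z \<notin> \<real>"
    and "is_eigenvalue a b p q w (selfadjoint_domain a b p q w B) z"
  shows "\<bar>Im z\<bar> \<le> 2 / \<epsilon> * \<alpha> powr (3 / 2) * \<delta>\<^sup>2 * L2_norm a b p (\<lambda>x. vector_derivative g (at x)) \<and>
         \<bar>Re z\<bar> \<le> 2 / \<epsilon> * \<alpha> * \<delta>\<^sup>2 *
           (sqrt \<alpha> * L2_norm a b p (\<lambda>x. vector_derivative g (at x)) +
            (\<alpha> + L1_norm a b q) * Linf_norm a b g)"
proof -
  let ?M = "lebesgue_on {a<..<b}"
  note ab = assms(1) and p [measurable] = assms(2) and w [measurable] = assms(4) and p0 = assms(8)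
  obtain f h where f: "f \<in> AC a b" and h: "h \<in> AC a b" and bc: "satisfies_bc a b B f h"
    and nz: "\<exists>x\<in>{a<..<b}. f x \<noteq> 0"
    and f': "AE x in ?M. (f has_vector_derivative of_real \<bar>1 / p x\<bar> * h x) (at x)"
    and h': "AE x in ?M. (h has_vector_derivative of_real (q x) * f x - z * of_real (w x) * f x) (at x)"
    by (rule eigenfunction_solution[OF ab w assms(9) p0 \<open>is_eigenvalue a b p q w (selfadjoint_domain a b p q w B) z\<close>])
  have "continuous_on {a..b} (\<lambda>x. cmod (f x))" by (intro continuous_on_norm AC_continuous_on f)
  then obtain x0 where x0: "x0 \<in> {a..b}" "\<forall>y\<in>{a..b}. cmod (f y) \<le> cmod (f x0)"
    using continuous_attains_sup[of "{a..b}" "\<lambda>x. cmod (f x)"] ab by auto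
  define K where "K = cmod (f x0)"
  have K: "\<And>x. x \<in> {a..b} \<Longrightarrow> cmod (f x) \<le> K" using x0(2) by (simp add: K_def)
  have K0: "K > 0"
  proof -
    obtain x where "x \<in> {a<..<b}" "f x \<noteq> 0" using nz by blast
    then have "0 < cmod (f x)" "cmod (f x) \<le> K" using K[of x] by auto
    then show ?thesis by linarith
  qed
  have "cmod (f a) \<le> K" "cmod (f b) \<le> K" using K ab by auto
  note BF = boundary_form[OF \<open>admissible B\<close> bc this]
  interpret indefinite_SL_solution a b K "\<lambda>x. \<bar>1 / p x\<bar>" q w z f h "bc_constant B"
  proof
    show "integrable ?M (\<lambda>x. \<bar>1 / p x\<bar>)" by (rule integrable_abs[OF assms(5)])
    show "Im z \<noteq> 0" using \<open>z \<notin> \<real>\<close> by (simp add: complex_is_Real_iff)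
    show "\<exists>x\<in>{a..b}. cmod (f x) = K" using x0(1) by (auto simp: K_def)
  qed (fact ab assms(6) assms(7) f h f' h' K K0 BF | simp)+
  have \<alpha>_eq: "local.\<alpha> = \<alpha>"
    using \<open>\<alpha> = _\<close> by (simp add: local.\<alpha>_def L1_norm_def)
  have \<delta>_eq: "\<delta> = 2 + 2 * ((LINT x|?M. \<bar>w x\<bar>) / \<bar>LINT x|?M. w x\<bar>)"
    using \<open>\<delta> = _\<close> by (simp add: L1_norm_def)
  have gm [measurable]: "g \<in> borel_measurable ?M" by (rule AC_measurable[OF \<open>g \<in> AC a b\<close>])
  let ?g' = "\<lambda>x. vector_derivative g (at x)"
  have g'm: "?g' \<in> borel_measurable ?M"
    by (rule borel_measurable_integrable[OF AC_FTC(1)[OF \<open>g \<in> AC a b\<close> less_imp_le[OF ab]]])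
  have p_nn: "AE x in ?M. p x \<ge> 0" using p0 by eventually_elim simp
  obtain L where L: "\<And>x. x \<in> {a..b} \<Longrightarrow> norm (g x) \<le> L" using AC_bounded[OF \<open>g \<in> AC a b\<close>] by blast
  define \<Omega> where "\<Omega> = {x \<in> {a<..<b}. p x * g x * w x < \<epsilon>}"
  have \<Omega>: "\<Omega> \<in> sets ?M"
  proof -
    have "{x \<in> space ?M. p x * g x * w x < \<epsilon>} \<in> sets ?M" by measurable
    then show ?thesis by (simp add: \<Omega>_def)
  qed
  have off: "AE x in ?M. x \<notin> \<Omega> \<longrightarrow> \<epsilon> * \<bar>1 / p x\<bar> \<le> w x * g x"
    using p0 AE_space
  proof eventually_elim
    case (elim x)
    show ?case
    proof
      assume "x \<notin> \<Omega>"
      then have "\<epsilon> \<le> w x * g x * p x" using elim(2) by (simp add: \<Omega>_def ac_simps)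
      then show "\<epsilon> * \<bar>1 / p x\<bar> \<le> w x * g x" using elim(1) by (simp add: pos_divide_le_eq)
    qed
  qed
  \<comment> \<open>For positive \<alpha> the extended quotient in the hypothesis is finite and
    equals the real one, so the measure bound becomes a bound for a Lebesgue integral.\<close>
  have small: "(LINT x|?M. \<bar>1 / p x\<bar> * indicator \<Omega> x) \<le> 1 / (2 * local.\<alpha> * \<delta>\<^sup>2)" if "local.\<alpha> > 0"
  proof -
    have pos: "2 * \<alpha> * \<delta>\<^sup>2 > 0"
    proof -
      have "\<delta> \<ge> 2" unfolding \<delta>_eq by simp
      then show ?thesis using that by (simp add: \<alpha>_eq)
    qed
    have I: "integrable ?M (\<lambda>x. \<bar>1 / p x\<bar> * indicator \<Omega> x)"
      by (rule integrable_mult_bounded[OF r(1) borel_measurable_indicator[OF \<Omega>], of 1]) (simp add: indicator_def)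
    have "emeasure (weighted_measure a b (\<lambda>x. 1 / p x)) \<Omega> = (\<integral>\<^sup>+x. ennreal (1 / p x) * indicator \<Omega> x \<partial>?M)"
      unfolding weighted_measure_def using \<Omega> by (intro emeasure_density) measurable
    also have "\<dots> = (\<integral>\<^sup>+x. ennreal (\<bar>1 / p x\<bar> * indicator \<Omega> x) \<partial>?M)"
      using p0 by (intro nn_integral_cong_AE) (auto elim!: eventually_mono simp: indicator_def)
    also have "\<dots> = ennreal (LINT x|?M. \<bar>1 / p x\<bar> * indicator \<Omega> x)"
      by (rule nn_integral_eq_integral[OF I]) simp
    finally have "ennreal (LINT x|?M. \<bar>1 / p x\<bar> * indicator \<Omega> x) \<le> 1 / ennreal (2 * \<alpha> * \<delta>\<^sup>2)"
      using \<open>emeasure (weighted_measure a b (\<lambda>x. 1 / p x)) _ \<le> _\<close> by (simp add: \<Omega>_def)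
    also have "\<dots> = ennreal (1 / (2 * \<alpha> * \<delta>\<^sup>2))"
      using divide_ennreal[of 1 "2 * \<alpha> * \<delta>\<^sup>2"] pos by simp
    finally show ?thesis using pos unfolding \<alpha>_eq by (subst (asm) ennreal_le_iff) auto
  qed
  have rp: "AE x in ?M. p x > 0 \<and> \<bar>1 / p x\<bar> = 1 / p x" using p0 by eventually_elim simp
  have "AE x in ?M. \<bar>g x\<bar> \<le> Linf_norm a b g"
    by (rule AE_abs_le_Linf_norm[OF gm, of L]) (use L in simp)
  note bounds = eigenvalue_bounds[OF \<open>(LINT x|?M. w x) \<noteq> 0\<close> \<delta>_eq p rp \<open>g \<in> AC a b\<close> \<open>g a = 0\<close> \<open>g b = 0\<close> g'm
      AC_AE_has_vector_derivative[OF \<open>g \<in> AC a b\<close> ab]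
      L2_space_integrable[OF p p_nn g'm \<open>?g' \<in> L2_space a b p\<close>] L2_norm_eq[OF p p_nn g'm]
      this \<open>AE x in ?M. g x * w x > 0\<close> \<open>\<epsilon> > 0\<close> \<Omega> off small]
  from bounds show ?thesis unfolding \<alpha>_eq L1_norm_def by blast
qed

end
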